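(* For every positive integer $k$, \[ \sum_{\substack{n_1,\dots,n_k\geq 0 \\ m_1,\dots,m_{k-1}\geq 0}} \frac{q^{n_k^2}}{(q)_{n_1}} \prod_{i=1}^{k-1} q^{n_i^2-n_im_i+m_i^2} {n_i \brack n_{i+1}} {n_i-n_{i+1}+m_{i+1} \brack m_i} =\frac{(q^{3k+2};q^{3k+2})_{\infty}^2}{(q;q)_{\infty}^2}\, \theta(q^k,q^{k+1},q^{k+1};q^{3k+2}), \] where $m_k:=2n_k$. Moreover, for every integer $k\geq 2$, \[ \sum_{\substack{n_1,\dots,n_{k-1}\geq 0 \\ m_1,\dots,m_{k-1}\geq 0}} \frac{q^{\sum_{i=1}^{k-1} (n_i^2-n_im_i+m_i^2)}}{(q)_{n_1}}\, {2n_{k-1} \brack m_{k-1}} \prod_{i=1}^{k-2} {n_i \brack n_{i+1}}{n_i-n_{i+1}+m_{i+1} \brack m_i} =\frac{(q^{3k+1};q^{3k+1})_{\infty}^2}{(q;q)_{\infty}^2}\, \theta(q^k,q^k,q^{k+1};q^{3k+1}), \] while for $k=1$ the right-hand side of this second expression equals $1$.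
   Context: Identities are between formal power series in $q$. For $n\in\mathbb{Z}$, $(a)_n=(a;q)_n:=(a;q)_\infty/(aq^n;q)_\infty$ with $(a;q)_\infty=\prod_{i\geq0}(1-aq^i)$; in particular $(a)_n=\prod_{i=0}^{n-1}(1-aq^i)$ for $n\geq0$ and $1/(q)_n=0$ for $n<0$. $\theta(a;q):=(a;q)_\infty(q/a;q)_\infty$ and $\theta(a_1,\dots,a_j;q):=\theta(a_1;q)\cdots\theta(a_j;q)$. For $n,m\in\mathbb{Z}$ the $q$-binomial coefficient is ${n\brack m}=\frac{(q)_n}{(q)_m(q)_{n-m}}$ if $0\leq m\leq n$ and $0$ otherwise. Empty sums are $0$ and empty products are $1$. *)

theory Defs
  imports "HOL-Analysis.Analysis"
begin

text \<open>
  All identities are between formal power series in \<open>q\<close>, that is, in \<^typ>\<open>complex fps\<close> with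
  \<open>q\<close> = \<^term>\<open>fps_X :: complex fps\<close>. Infinite sums and products are taken in the usual (\<open>q\<close>-adic)
  topology of \<^typ>\<open>complex fps\<close>.
\<close>

definition qpoch :: "complex fps \<Rightarrow> complex fps \<Rightarrow> nat \<Rightarrow> complex fps" where
  "qpoch a p n = (\<Prod>i<n. 1 - a * p ^ i)"

text \<open>The product converges when \<open>p\<close> has zero constant term; for other \<open>p\<close> the value is junk.\<close>

definition qpoch_inf :: "complex fps \<Rightarrow> complex fps \<Rightarrow> complex fps" where
  "qpoch_inf a p = prodinf (\<lambda>i. 1 - a * p ^ i)"

text \<open>
  \<open>theta [a\<^sub>1, \<dots>, a\<^sub>j] p\<close> is \<open>\<theta>(a\<^sub>1, \<dots>, a\<^sub>j; p)\<close>. The quotient \<open>p / a\<close> is division in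
  \<^typ>\<open>complex fps\<close>, hence exact when \<open>a\<close> divides \<open>p\<close>; here \<open>a\<close> and \<open>p\<close> are always powers
  \<open>q\<^sup>s\<close> and \<open>q\<^sup>t\<close> with \<open>s \<le> t\<close>.
\<close>

definition theta :: "complex fps list \<Rightarrow> complex fps \<Rightarrow> complex fps" where
  "theta as p = (\<Prod>a\<leftarrow>as. qpoch_inf a p * qpoch_inf (p / a) p)"

definition qbinom :: "int \<Rightarrow> int \<Rightarrow> complex fps" where
  "qbinom n m =
     (if 0 \<le> m \<and> m \<le> n
      then qpoch fps_X fps_X (nat n) /
             (qpoch fps_X fps_X (nat m) * qpoch fps_X fps_X (nat (n - m)))
      else 0)"

text \<open>The form \<open>n\<^sup>2 - n m + m\<^sup>2\<close> is nonnegative, so \<^const>\<open>nat\<close> does not truncate.\<close>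

definition quad_form :: "nat \<Rightarrow> nat \<Rightarrow> nat" where
  "quad_form n m = nat ((int n)\<^sup>2 - int n * int m + (int m)\<^sup>2)"

text \<open>
  In the two summands, \<open>n\<close> and \<open>m\<close> are the tuples of summation indices, given as functions on
  positions \<open>1, 2, \<dots>\<close>. In the first one \<open>m k\<close> is not a summation index but stands for \<open>2 n\<^sub>k\<close>.
\<close>

definition summand1 :: "nat \<Rightarrow> (nat \<Rightarrow> nat) \<Rightarrow> (nat \<Rightarrow> nat) \<Rightarrow> complex fps" where
  "summand1 k n m0 =
     (let m = m0(k := 2 * n k) in
        fps_X ^ ((n k)\<^sup>2) / qpoch fps_X fps_X (n 1) *
        (\<Prod>i=1..k-1. fps_X ^ quad_form (n i) (m i) *
           qbinom (int (n i)) (int (n (i + 1))) *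
           qbinom (int (n i) - int (n (i + 1)) + int (m (i + 1))) (int (m i))))"

definition summand2 :: "nat \<Rightarrow> (nat \<Rightarrow> nat) \<Rightarrow> (nat \<Rightarrow> nat) \<Rightarrow> complex fps" where
  "summand2 k n m =
     fps_X ^ (\<Sum>i=1..k-1. quad_form (n i) (m i)) / qpoch fps_X fps_X (n 1) *
     qbinom (2 * int (n (k - 1))) (int (m (k - 1))) *
     (\<Prod>i=1..k-2. qbinom (int (n i)) (int (n (i + 1))) *
        qbinom (int (n i) - int (n (i + 1)) + int (m (i + 1))) (int (m i)))"

definition rhs1 :: "nat \<Rightarrow> complex fps" where
  "rhs1 k =
     (qpoch_inf (fps_X ^ (3 * k + 2)) (fps_X ^ (3 * k + 2)))\<^sup>2 / (qpoch_inf fps_X fps_X)\<^sup>2 *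
     theta [fps_X ^ k, fps_X ^ (k + 1), fps_X ^ (k + 1)] (fps_X ^ (3 * k + 2))"

definition rhs2 :: "nat \<Rightarrow> complex fps" where
  "rhs2 k =
     (qpoch_inf (fps_X ^ (3 * k + 1)) (fps_X ^ (3 * k + 1)))\<^sup>2 / (qpoch_inf fps_X fps_X)\<^sup>2 *
     theta [fps_X ^ k, fps_X ^ k, fps_X ^ (k + 1)] (fps_X ^ (3 * k + 1))"

end

(*
  Write (q)_n for (q;q)_n. Summing over the m_i with Heine's transformation trades each factor
  [n_i - n_{i+1} + m_{i+1}; m_i] for 1/(q)_{s_i - s_{i+1}}, at the cost of a factor (q)_infinity:
  both left-hand sides become sums over two chains r_1 >= r_2 >= ... and s_1 >= s_2 >= ... of
  prod q^{r_i^2 - r_i s_i + s_i^2} / ((q)_{r_i - r_{i+1}} (q)_{s_i - s_{i+1}}), as in the work of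
  Andrews, Schilling and Warnaar, ending in 1/((q)_r (q)_s (q)_{r+s}), respectively in that
  times q^{2rs}. An A_2 Bailey lemma performs one step of such a chain on the functions
  (q)_{n+m} / prod_i (q)_{n-y_i} (q)_{m+y_i}, where y_1 + y_2 + y_3 = 0, and multiplies them by
  q^{|y|^2/2}. So it suffices to expand the end of the chain in these functions. The expansion of
  the first one is the evaluation of the pairing of prod_i (-x_i;q)_N with (x_1 x_2 x_3)^n under
  the affine A_2 Weyl denominator; shifting x_1 -> q x_1 (a Macdonald operator at t = 0) gives a
  first-order recurrence for it. The other one follows by q -> 1/q. The sum over y which remains
  in the limit factors by the A_2 Macdonald identity: multiply three Jacobi triple products and
  sum along a diagonal by the pentagonal number theorem.
*)
theory Submission
  imports Defs "HOL-Library.Groups_Big_Fun" "HOL-Computational_Algebra.Formal_Laurent_Series"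
begin

section \<open>Transformations of terminating basic hypergeometric sums\<close>

text \<open>Write y = (a, b, c) - rho with rho = (1, 0, -1) and a + b + c = 0. On the support of
  \<open>chi3\<close>, \<open>cas a b\<close> is the exponent in the affine A_2 Weyl denominator,
  \<open>half_norm a b\<close> is |y|^2/2, and |y|^2/2 = 3 cas - <y, rho>. The two ends of the chain
  have weights cas + |y|^2/2 and, after q -> 1/q, -cas + |y|^2/2. With the remaining Bailey steps
  the exponents become k |y|^2/2 + cas = (3k+1) cas - k <y, rho> and (k+1) |y|^2/2 - cas = (3k+2)
  cas - (k+1) <y, rho>. These are the exponents of the Macdonald identity with base q^K and both
  simple roots specialised to q^c, for (K, c) = (3k+1, k) and (3k+2, k+1): hence the moduli and the
  theta arguments. The finite identities contain negative powers of q and are needed at q, at 1/q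
  and at q^K. They are therefore proved over a field, for any nonzero q that is not a root of unity,
  and then read in Laurent series. Power series enter only in the limit, where the positive definite
  form |y|^2/2 controls every coefficient.\<close>

locale generic_q =
  fixes q :: "'a::field_char_0"
  assumes q_nz: "q \<noteq> 0" and q_pow_ne_1: "n > 0 \<Longrightarrow> q ^ n \<noteq> 1"
begin

section \<open>q-factorials and their reciprocals at a generic base\<close>

definition qfac :: "nat \<Rightarrow> 'a" where "qfac n = (\<Prod>i<n. 1 - q * q ^ i)"

text \<open>The value 0 at negative arguments is the convention 1/(q)_n = 0. It makes
  \<open>iqfac_rec\<close> true at every integer and lets the sums below run over any interval
  containing their support.\<close>

definition iqfac :: "int \<Rightarrow> 'a" where "iqfac k = (if k < 0 then 0 else 1 / qfac (nat k))"

declare q_nz [simp]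

lemma powi_ne_1: "k > 0 \<Longrightarrow> q powi k \<noteq> 1"
  by (auto simp: power_int_def q_pow_ne_1)

lemma powi_add: "q powi (a + b) = q powi a * q powi b"
  using q_nz by (simp add: power_int_add)

lemma powi_nz [simp]: "q powi a \<noteq> 0"
  using q_nz by simp

lemma qfac_0 [simp]: "qfac 0 = 1" by (simp add: qfac_def)

lemma qfac_Suc: "qfac (Suc n) = qfac n * (1 - q powi (int n + 1))"
  by (simp add: qfac_def power_int_add q_nz mult.commute)

lemma qfac_nz [simp]: "qfac n \<noteq> 0"
  using powi_ne_1[of "int _ + 1"] by (induction n) (auto simp: qfac_Suc)

lemma iqfac_neg [simp]: "k < 0 \<Longrightarrow> iqfac k = 0" by (simp add: iqfac_def)
lemma iqfac_0 [simp]: "iqfac 0 = 1" by (simp add: iqfac_def)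
lemma iqfac_nat: "iqfac (int n) = 1 / qfac n" by (simp add: iqfac_def)

lemma iqfac_rec: "(1 - q powi k) * iqfac k = iqfac (k - 1)"
proof (cases "k > 0")
  case True
  define n where "n = nat (k - 1)"
  have k: "k = int n + 1" using True by (simp add: n_def)
  have "nat k = Suc n" "nat (k - 1) = n" using k by auto
  thus ?thesis using True powi_ne_1[OF True]
    by (simp add: iqfac_def qfac_Suc k field_simps)
qed (cases "k = 0"; simp)

lemma iqfac_eq_0_iff [simp]: "iqfac k = 0 \<longleftrightarrow> k < 0"
  by (simp add: iqfac_def)

text \<open>Up to normalisation this is the terminating series 1phi1(q^-T; q^(U-R+1); q,
  q^(T-R+1)).\<close>

definition heine :: "int \<Rightarrow> int \<Rightarrow> int \<Rightarrow> 'a" where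
  "heine R T U = (\<Sum>S\<in>{0..T}. q powi (S * (S - R)) * iqfac S * iqfac (T - S) * iqfac (S + U - R))"

text \<open>Contiguous relation in \<open>T\<close>: split 1 - q^T as (1 - q^(T-S)) + q^(T-S) (1 -
  q^S); the two halves lower the index of \<open>iqfac (T - S)\<close> and of \<open>iqfac S\<close>
  respectively.\<close>

lemma heine_rec1:
  "(1 - q powi T) * heine R T U = heine R (T - 1) U + q powi (T - R) * heine (R - 1) (T - 1) U"
proof (cases "T \<ge> 0")
  case True
  define f where "f S = q powi (S * (S - R)) * iqfac S * iqfac (T - 1 - S) * iqfac (S + U - R)" for S
  define g where "g S = q powi (S * (S - R) + T - S) * iqfac (S - 1) * iqfac (T - S) * iqfac (S + U - R)" for S
  have "(1 - q powi T) * heine R T U = (\<Sum>S\<in>{0..T}. f S + g S)"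
    unfolding heine_def sum_distrib_left
  proof (rule sum.cong[OF refl])
    fix S
    have e: "1 - q powi T = (1 - q powi (T - S)) + q powi (T - S) * (1 - q powi S)"
      by (simp add: algebra_simps flip: powi_add)
    have "f S + g S = q powi (S * (S - R)) * iqfac (S + U - R) *
       (iqfac S * iqfac (T - S - 1) + q powi (T - S) * (iqfac (S - 1) * iqfac (T - S)))"
      by (simp add: f_def g_def algebra_simps flip: powi_add)
    also have "\<dots> = q powi (S * (S - R)) * iqfac (S + U - R) * ((1 - q powi T) * (iqfac S * iqfac (T - S)))"
      unfolding iqfac_rec[symmetric] e by (simp add: algebra_simps)
    finally show "(1 - q powi T) * (q powi (S * (S - R)) * iqfac S * iqfac (T - S) * iqfac (S + U - R)) = f S + g S"
      by (simp add: mult_ac)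
  qed
  also have "\<dots> = sum f {0..T} + sum g {0..T}" by (rule sum.distrib)
  also have "sum f {0..T} = heine R (T - 1) U"
    unfolding heine_def by (rule sum.mono_neutral_cong_right) (auto simp: f_def)
  also have "sum g {0..T} = (\<Sum>S\<in>{0..T - 1}. g (S + 1))"
  proof -
    have "sum g {0..T} = sum g {1..T}"
      by (rule sum.mono_neutral_cong_right) (auto simp: g_def)
    also have "\<dots> = (\<Sum>S\<in>{0..T - 1}. g (S + 1))"
      by (rule sum.reindex_bij_witness[of _ "\<lambda>s. s + 1" "\<lambda>s. s - 1"]) auto
    finally show ?thesis .
  qed
  also have "\<dots> = q powi (T - R) * heine (R - 1) (T - 1) U"
    unfolding heine_def sum_distrib_left
    by (rule sum.cong) (simp_all add: g_def algebra_simps flip: powi_add)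
  finally show ?thesis .
qed (simp add: heine_def)

text \<open>Contiguous relation in \<open>U\<close>, from 1/(q)_z = 1/(q)_(z-1) + q^z/(q)_z at z = S
  + U - R. Its coefficient q^(U-R) is that of \<open>heine_rec1\<close> with \<open>T\<close> and
  \<open>U\<close> exchanged, which is the source of \<open>heine_sym\<close>.\<close>

lemma heine_rec2: "heine R T U = heine R T (U - 1) + q powi (U - R) * heine (R - 1) T (U - 1)"
  unfolding heine_def sum_distrib_left sum.distrib[symmetric]
proof (rule sum.cong[OF refl])
  fix S
  define z where "z = iqfac (S + U - R)"
  have z: "iqfac (S + U - R - 1) = z - q powi (S + U - R) * z"
    using iqfac_rec[of "S + U - R"] by (simp add: z_def algebra_simps)
  have e: "iqfac (S + (U - 1) - R) = iqfac (S + U - R - 1)" "iqfac (S + (U - 1) - (R - 1)) = z"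
    by (simp_all add: z_def algebra_simps)
  have p: "q powi (U - R) * q powi (S * (S - (R - 1))) = q powi (S * (S - R)) * q powi (S + U - R)"
    by (simp add: algebra_simps flip: powi_add)
  show "q powi (S * (S - R)) * iqfac S * iqfac (T - S) * iqfac (S + U - R) =
    q powi (S * (S - R)) * iqfac S * iqfac (T - S) * iqfac (S + (U - 1) - R) +
    q powi (U - R) * (q powi (S * (S - (R - 1))) * iqfac S * iqfac (T - S) * iqfac (S + (U - 1) - (R - 1)))"
    unfolding e z z_def[symmetric] using p by (simp add: algebra_simps)
qed

text \<open>The summable case of the series. The recurrence lowers \<open>R\<close> together with
  \<open>T\<close>, so the induction has to be over all \<open>R\<close>.\<close>

lemma heine_0: "heine R T 0 = iqfac T * iqfac (T - R)"
proof (cases "T \<ge> 0")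
  case True
  then obtain t where "T = int t" using zero_le_imp_eq_int by blast
  moreover have "heine R (int t) 0 = iqfac (int t) * iqfac (int t - R)"
  proof (induction t arbitrary: R)
    case 0 show ?case by (simp add: heine_def)
  next
    case (Suc t)
    define T where "T = int (Suc t)"
    have "T - 1 = int t" by (simp add: T_def)
    have "(1 - q powi T) * heine R T 0 = iqfac (T - 1) * (iqfac (T - R - 1) + q powi (T - R) * iqfac (T - R))"
      unfolding heine_rec1 \<open>T - 1 = int t\<close> Suc.IH
      using \<open>T - 1 = int t\<close> by (simp add: algebra_simps)
    also have "\<dots> = (1 - q powi T) * (iqfac T * iqfac (T - R))"
      unfolding iqfac_rec[symmetric] by (simp add: algebra_simps)
    finally show ?case using powi_ne_1[of T] by (simp add: T_def)
  qed
  ultimately show ?thesis by simp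
qed (simp add: heine_def)

text \<open>Heine's transformation. As functions of R and T both sides satisfy (1 - q^T) f(R,T) =
  f(R,T-1) + q^(T-R) f(R-1,T-1): the left one by \<open>heine_rec1\<close>, the right one by
  \<open>heine_rec2\<close> and \<open>iqfac_rec\<close>. At T = 0 they agree by
  \<open>heine_0\<close>.\<close>

lemma heine_sym: "iqfac U * heine R T U = iqfac T * heine R U T"
proof (cases "T \<ge> 0")
  case True
  then obtain t where "T = int t" using zero_le_imp_eq_int by blast
  moreover have "iqfac U * heine R (int t) U = iqfac (int t) * heine R U (int t)"
  proof (induction t arbitrary: R)
    case 0
    show ?case unfolding of_nat_0 heine_0 by (simp add: heine_def)
  next
    case (Suc t)
    define T where "T = int (Suc t)"
    have *: "T - 1 = int t" by (simp add: T_def)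
    have "(1 - q powi T) * (iqfac U * heine R T U) =
       iqfac U * heine R (T - 1) U + q powi (T - R) * (iqfac U * heine (R - 1) (T - 1) U)"
      using arg_cong[OF heine_rec1[of T R U], of "\<lambda>x. iqfac U * x"] by (simp add: algebra_simps)
    also have "\<dots> = iqfac (T - 1) * (heine R U (T - 1) + q powi (T - R) * heine (R - 1) U (T - 1))"
      unfolding * Suc.IH by (simp add: algebra_simps)
    also have "\<dots> = (1 - q powi T) * (iqfac T * heine R U T)"
      unfolding heine_rec2[symmetric] iqfac_rec[symmetric] by (simp add: algebra_simps)
    finally show ?case using powi_ne_1[of T] by (simp add: T_def)
  qed
  ultimately show ?thesis by simp
qed (simp add: heine_def)

lemma heine_shifted:
  assumes "finite I" "{b..n} \<subseteq> I"
  shows "(\<Sum>r\<in>I. q powi (r\<^sup>2 - r * s) * iqfac (n - r) * iqfac (r - b) * iqfac (r - c)) =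
         q powi (b\<^sup>2 - b * s) * heine (s - 2 * b) (n - b) (s - b - c)"
proof -
  have "(\<Sum>r\<in>I. q powi (r\<^sup>2 - r * s) * iqfac (n - r) * iqfac (r - b) * iqfac (r - c)) =
        (\<Sum>r\<in>{b..n}. q powi (r\<^sup>2 - r * s) * iqfac (n - r) * iqfac (r - b) * iqfac (r - c))"
    by (rule sum.mono_neutral_right) (use assms in \<open>auto simp: not_le\<close>)
  also have "\<dots> = q powi (b\<^sup>2 - b * s) * heine (s - 2 * b) (n - b) (s - b - c)"
    unfolding heine_def sum_distrib_left
    by (rule sum.reindex_bij_witness[of _ "\<lambda>S. S + b" "\<lambda>r. r - b"])
       (auto simp: algebra_simps power2_eq_square simp flip: powi_add)
  finally show ?thesis .
qed

text \<open>For s = b + c the third parameter of \<open>heine\<close> in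
  \<open>heine_shifted\<close> is 0. The result is also the limit M -> infinity of
  \<open>vandermonde\<close>.\<close>

lemma limit_vandermonde:
  assumes "finite I" "{b..n} \<subseteq> I"
  shows "(\<Sum>r\<in>I. q powi ((r - b) * (r - c)) * iqfac (n - r) * iqfac (r - b) * iqfac (r - c)) =
         iqfac (n - b) * iqfac (n - c)"
proof -
  have "(\<Sum>r\<in>I. q powi ((r - b) * (r - c)) * iqfac (n - r) * iqfac (r - b) * iqfac (r - c)) =
     q powi (b * c) * (\<Sum>r\<in>I. q powi (r\<^sup>2 - r * (b + c)) * iqfac (n - r) * iqfac (r - b) * iqfac (r - c))"
    unfolding sum_distrib_left
    by (rule sum.cong) (auto simp: algebra_simps power2_eq_square simp flip: powi_add)
  also have "\<dots> = heine (c - b) (n - b) 0"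
    unfolding heine_shifted[OF assms] by (simp add: algebra_simps power2_eq_square flip: powi_add)
  also have "\<dots> = iqfac (n - b) * iqfac (n - c)"
    unfolding heine_0 by (simp add: algebra_simps)
  finally show ?thesis .
qed

text \<open>\<open>heine_sym\<close> in the form used by the Bailey lemma. The factor
  \<open>iqfac (s - b - c)\<close> on the left is the one that the symmetry requires, and the new
  variable is v = s - S.\<close>

lemma heine_transform:
  assumes "finite I" "{b..n} \<subseteq> I" "finite J" "{b + c..s} \<subseteq> J"
  shows "(\<Sum>r\<in>I. q powi (r\<^sup>2 - r * s) * iqfac (n - r) * iqfac (r - b) * iqfac (r - c) * iqfac (s - b - c)) =
     (\<Sum>v\<in>J. q powi (b\<^sup>2 - b * s + (s - v) * (2 * b - v)) * iqfac (s - v) * iqfac (v - b - c) *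
        iqfac (n - v + b) * iqfac (n - b))"
proof -
  have "(\<Sum>r\<in>I. q powi (r\<^sup>2 - r * s) * iqfac (n - r) * iqfac (r - b) * iqfac (r - c) * iqfac (s - b - c)) =
     q powi (b\<^sup>2 - b * s) * (iqfac (s - b - c) * heine (s - 2 * b) (n - b) (s - b - c))"
    unfolding sum_distrib_right[symmetric] heine_shifted[OF assms(1,2)] by simp
  also have "\<dots> = q powi (b\<^sup>2 - b * s) * iqfac (n - b) * heine (s - 2 * b) (s - b - c) (n - b)"
    unfolding heine_sym by simp
  also have "\<dots> = (\<Sum>v\<in>{b + c..s}. q powi (b\<^sup>2 - b * s + (s - v) * (2 * b - v)) * iqfac (s - v) * iqfac (v - b - c) *
        iqfac (n - v + b) * iqfac (n - b))"
    unfolding heine_def sum_distrib_left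
  proof (rule sum.reindex_bij_witness[of _ "\<lambda>S. s - S" "\<lambda>r. s - r"])
    fix S
    have "q powi (b\<^sup>2 - b * s + S * (2 * b - (s - S))) =
          q powi (b\<^sup>2 - b * s) * q powi (S * (S - (s - 2 * b)))"
      by (simp add: algebra_simps flip: powi_add)
    thus "q powi (b\<^sup>2 - b * s + (s - (s - S)) * (2 * b - (s - S))) * iqfac (s - (s - S)) *
          iqfac (s - S - b - c) * iqfac (n - (s - S) + b) * iqfac (n - b) =
          q powi (b\<^sup>2 - b * s) * iqfac (n - b) * (q powi (S * (S - (s - 2 * b))) * iqfac S *
            iqfac (s - b - c - S) * iqfac (S + (n - b) - (s - 2 * b)))"
      by (simp add: algebra_simps)
  qed auto
  also have "\<dots> = (\<Sum>v\<in>J. q powi (b\<^sup>2 - b * s + (s - v) * (2 * b - v)) * iqfac (s - v) * iqfac (v - b - c) *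
        iqfac (n - v + b) * iqfac (n - b))"
    by (rule sum.mono_neutral_left) (use assms in \<open>auto simp: not_le\<close>)
  finally show ?thesis .
qed

end

section \<open>The $A_2$ Bailey lemma\<close>

context generic_q begin

section \<open>The finite q-Vandermonde sum\<close>

definition vdm :: "int \<Rightarrow> int \<Rightarrow> int \<Rightarrow> 'a" where
  "vdm n M c = (\<Sum>S\<in>{0..n}. q powi (S * (S - c)) * iqfac S * iqfac (S - c) * iqfac (n - S) * iqfac (M - S))"

lemma vdm_rec:
  "(1 - q powi M) * vdm n M c = vdm n (M - 1) c + q powi (M - c) * vdm (n - 1) (M - 1) (c - 1)"
proof (cases "n \<ge> 0")
  case True
  define f where "f S = q powi (S * (S - c)) * iqfac S * iqfac (S - c) * iqfac (n - S) * iqfac (M - 1 - S)" for S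
  define g where "g S = q powi (S * (S - c) + M - S) * iqfac (S - 1) * iqfac (S - c) * iqfac (n - S) * iqfac (M - S)" for S
  have "(1 - q powi M) * vdm n M c = (\<Sum>S\<in>{0..n}. f S + g S)"
    unfolding vdm_def sum_distrib_left
  proof (rule sum.cong[OF refl])
    fix S
    have e: "1 - q powi M = (1 - q powi (M - S)) + q powi (M - S) * (1 - q powi S)"
      by (simp add: algebra_simps flip: powi_add)
    have "f S + g S = q powi (S * (S - c)) * iqfac (S - c) * iqfac (n - S) *
       (iqfac S * iqfac (M - S - 1) + q powi (M - S) * (iqfac (S - 1) * iqfac (M - S)))"
      by (simp add: f_def g_def algebra_simps flip: powi_add)
    also have "\<dots> = q powi (S * (S - c)) * iqfac (S - c) * iqfac (n - S) * ((1 - q powi M) * (iqfac S * iqfac (M - S)))"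
      unfolding iqfac_rec[symmetric] e by (simp add: algebra_simps)
    finally show "(1 - q powi M) * (q powi (S * (S - c)) * iqfac S * iqfac (S - c) * iqfac (n - S) * iqfac (M - S)) =
        f S + g S"
      by (simp add: mult_ac)
  qed
  also have "\<dots> = sum f {0..n} + sum g {0..n}" by (rule sum.distrib)
  also have "sum f {0..n} = vdm n (M - 1) c"
    unfolding vdm_def by (simp add: f_def)
  also have "sum g {0..n} = (\<Sum>S\<in>{0..n - 1}. g (S + 1))"
  proof -
    have "sum g {0..n} = sum g {1..n}"
      by (rule sum.mono_neutral_cong_right) (auto simp: g_def)
    also have "\<dots> = (\<Sum>S\<in>{0..n - 1}. g (S + 1))"
      by (rule sum.reindex_bij_witness[of _ "\<lambda>s. s + 1" "\<lambda>s. s - 1"]) auto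
    finally show ?thesis .
  qed
  also have "\<dots> = q powi (M - c) * vdm (n - 1) (M - 1) (c - 1)"
    unfolding vdm_def sum_distrib_left
    by (rule sum.cong) (simp_all add: g_def algebra_simps flip: powi_add)
  finally show ?thesis .
qed (simp add: vdm_def)

lemma qfac_iqfac: "k \<ge> 0 \<Longrightarrow> qfac (nat k) * iqfac k = 1"
  by (simp add: iqfac_def)

text \<open>Induction on the second argument; the closed form satisfies \<open>vdm_rec\<close>
  because 1 - q^(n+M-c) = (1 - q^(M-c)) + q^(M-c) (1 - q^n).\<close>

lemma vdm_eq: "vdm n (int t) c = qfac (nat (n + int t - c)) * iqfac n * iqfac (n - c) * iqfac (int t) * iqfac (int t - c)"
proof (induction t arbitrary: n c)
  case 0
  show ?case
  proof (cases "n \<ge> 0 \<and> c \<le> 0")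
    case True
    have "vdm n 0 c = (\<Sum>S\<in>{0}. q powi (S * (S - c)) * iqfac S * iqfac (S - c) * iqfac (n - S) * iqfac (0 - S))"
      unfolding vdm_def by (rule sum.mono_neutral_right) (use True in auto)
    thus ?thesis using True qfac_iqfac[of "n - c"] by (simp add: mult_ac)
  next
    case False
    thus ?thesis by (auto simp: vdm_def intro!: sum.neutral)
  qed
next
  case (Suc t)
  define M where "M = int (Suc t)"
  have *: "M - 1 = int t" and M: "M \<ge> 1" by (simp_all add: M_def)
  show ?case unfolding M_def[symmetric]
  proof (cases "n + M - c \<ge> 1")
    case True
    define X where "X = qfac (nat (n + M - c - 1))"
    have "nat (n + M - c) = Suc (nat (n + M - c - 1))" using True by simp
    hence X: "qfac (nat (n + M - c)) = X * (1 - q powi (n + M - c))"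
      using True by (simp only: qfac_Suc) (simp add: X_def)
    have e: "1 - q powi (n + M - c) = (1 - q powi (M - c)) + q powi (M - c) * (1 - q powi n)"
      by (simp add: algebra_simps flip: powi_add)
    have "(1 - q powi M) * vdm n M c =
       X * iqfac n * iqfac (n - c) * iqfac (M - 1) * iqfac (M - c - 1) +
       q powi (M - c) * (X * iqfac (n - 1) * iqfac (n - c) * iqfac (M - 1) * iqfac (M - c))"
    proof -
      have "vdm n' (M - 1) c' = qfac (nat (n' + (M - 1) - c')) * iqfac n' * iqfac (n' - c') * iqfac (M - 1) * iqfac (M - 1 - c')" for n' c'
        unfolding * by (rule Suc.IH)
      thus ?thesis
        unfolding vdm_rec X_def by (simp add: algebra_simps)
    qed
    also have "\<dots> = (1 - q powi M) * (qfac (nat (n + M - c)) * iqfac n * iqfac (n - c) * iqfac M * iqfac (M - c))"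
      unfolding iqfac_rec[symmetric] X e by (simp add: algebra_simps)
    finally show "vdm n M c = qfac (nat (n + M - c)) * iqfac n * iqfac (n - c) * iqfac M * iqfac (M - c)"
      using powi_ne_1[of M] M by simp
  next
    \<comment> \<open>Here \<open>nat\<close> truncates and \<open>qfac\<close> takes the value 1;
      the formula survives because both sides vanish through their reciprocal factors.\<close>
    case False
    hence "n < 0 \<or> M < c \<or> n < c" using M by linarith
    moreover have "vdm n M c = 0" unfolding vdm_def
    proof (rule sum.neutral, rule ballI)
      fix S assume "S \<in> {0..n}"
      hence "S - c < 0 \<or> M - S < 0" using False M by auto
      thus "q powi (S * (S - c)) * iqfac S * iqfac (S - c) * iqfac (n - S) * iqfac (M - S) = 0" by auto
    qed
    ultimately show "vdm n M c = qfac (nat (n + M - c)) * iqfac n * iqfac (n - c) * iqfac M * iqfac (M - c)" by auto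
  qed
qed

lemma vandermonde:
  assumes "finite I" "{b..n} \<subseteq> I"
  shows "(\<Sum>u\<in>I. q powi ((u - b) * (u - c)) * iqfac (u - b) * iqfac (u - c) * iqfac (n - u) * iqfac (M - u)) =
         qfac (nat (n + M - b - c)) * iqfac (n - b) * iqfac (n - c) * iqfac (M - b) * iqfac (M - c)"
proof (cases "M \<ge> b")
  case True
  then obtain t where t: "M - b = int t" using zero_le_imp_eq_int[of "M - b"] by auto
  have "(\<Sum>u\<in>I. q powi ((u - b) * (u - c)) * iqfac (u - b) * iqfac (u - c) * iqfac (n - u) * iqfac (M - u)) =
        (\<Sum>u\<in>{b..n}. q powi ((u - b) * (u - c)) * iqfac (u - b) * iqfac (u - c) * iqfac (n - u) * iqfac (M - u))"
    by (rule sum.mono_neutral_right) (use assms in \<open>auto simp: not_le\<close>)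
  also have "\<dots> = vdm (n - b) (M - b) (c - b)"
    unfolding vdm_def
    by (rule sum.reindex_bij_witness[of _ "\<lambda>S. S + b" "\<lambda>r. r - b"]) (auto simp: algebra_simps)
  also have "\<dots> = qfac (nat (n + M - b - c)) * iqfac (n - b) * iqfac (n - c) * iqfac (M - b) * iqfac (M - c)"
    unfolding t vdm_eq by (simp add: t[symmetric] algebra_simps)
  finally show ?thesis .
next
  case False
  hence "q powi ((u - b) * (u - c)) * iqfac (u - b) * iqfac (u - c) * iqfac (n - u) * iqfac (M - u) = 0" for u
    by (cases "u < b") auto
  hence "(\<Sum>u\<in>I. q powi ((u - b) * (u - c)) * iqfac (u - b) * iqfac (u - c) * iqfac (n - u) * iqfac (M - u)) = 0"
    by (intro sum.neutral) blast
  thus ?thesis using False by simp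
qed

lemma sum_rotate:
  "(\<Sum>a\<in>A. \<Sum>b\<in>B. \<Sum>c\<in>C. f a b c) = (\<Sum>c\<in>C. \<Sum>a\<in>A. \<Sum>b\<in>B. f a b c)"
  for f :: "'b \<Rightarrow> 'c \<Rightarrow> 'd \<Rightarrow> 'e :: comm_monoid_add"
proof -
  have "(\<Sum>a\<in>A. \<Sum>b\<in>B. \<Sum>c\<in>C. f a b c) = (\<Sum>a\<in>A. \<Sum>c\<in>C. \<Sum>b\<in>B. f a b c)"
    by (rule sum.cong[OF refl], rule sum.swap)
  also have "\<dots> = (\<Sum>c\<in>C. \<Sum>a\<in>A. \<Sum>b\<in>B. f a b c)" by (rule sum.swap)
  finally show ?thesis .
qed

text \<open>With N = n + m this is (q)_N^-2 times the product of the three q-binomials [N; n - y_i],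
  the form in which the seed identity produces it.\<close>

definition Psi :: "int \<Rightarrow> int \<Rightarrow> int \<Rightarrow> int \<Rightarrow> int \<Rightarrow> 'a" where
  "Psi n m y1 y2 y3 = qfac (nat (n + m)) *
     (iqfac (n - y1) * iqfac (n - y2) * iqfac (n - y3) * iqfac (m + y1) * iqfac (m + y2) * iqfac (m + y3))"

text \<open>The Vandermonde sum with parameters y1, y2 and M = m - y3. The condition y1 + y2 + y3 =
  0 turns its numerator (q)_(n+M-y1-y2) into (q)_(n+m), and only the two factors with y3 stay
  outside.\<close>

lemma Psi_expand:
  assumes "y1 + y2 + y3 = 0" "finite I" "{y1..n} \<subseteq> I"
  shows "Psi n m y1 y2 y3 = iqfac (n - y3) * iqfac (m + y3) *
    (\<Sum>u\<in>I. q powi ((u - y1) * (u - y2)) * iqfac (u - y1) * iqfac (u - y2) * iqfac (n - u) * iqfac (m - y3 - u))"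
proof -
  have e: "n + (m - y3) - y1 - y2 = n + m" "m - y3 - y1 = m + y2" "m - y3 - y2 = m + y1"
    using assms(1) by auto
  show ?thesis
    using vandermonde[OF assms(2,3), of y2 "m - y3"] unfolding e
    by (simp add: Psi_def mult_ac)
qed

text \<open>
Expand \<open>Psi r s\<close> with the Vandermonde sum. The sum over \<open>r\<close> becomes a sum over a new variable \<open>v\<close> by
Heine's transformation; the sums over \<open>s\<close> and over \<open>u\<close> are then evaluated by the
Vandermonde sum, and what is left over \<open>v\<close> is again the expansion of \<open>Psi n m\<close>.
\<close>

lemma A2_bailey_lemma:
  fixes N :: int
  assumes y: "y1 + y2 + y3 = 0" and N: "\<bar>n\<bar> + \<bar>m\<bar> + \<bar>y1\<bar> + \<bar>y2\<bar> + \<bar>y3\<bar> \<le> N"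
  defines "I \<equiv> {-2 * N..2 * N}"
  shows "(\<Sum>r\<in>I. \<Sum>s\<in>I. q powi (r\<^sup>2 - r * s + s\<^sup>2) * iqfac (n - r) * iqfac (m - s) * Psi r s y1 y2 y3) =
    q powi (y1\<^sup>2 + y1 * y2 + y2\<^sup>2) * Psi n m y1 y2 y3"
proof -
  have fin: "finite I" by (simp add: I_def)
  define A where "A u = q powi ((u - y1) * (u - y2)) * iqfac (u - y1) * iqfac (u - y2)" for u
  have "(\<Sum>r\<in>I. \<Sum>s\<in>I. q powi (r\<^sup>2 - r * s + s\<^sup>2) * iqfac (n - r) * iqfac (m - s) * Psi r s y1 y2 y3) =
    (\<Sum>r\<in>I. \<Sum>s\<in>I. \<Sum>u\<in>I. q powi (r\<^sup>2 - r * s) * iqfac (n - r) * iqfac (r - y3) * iqfac (r - u) * iqfac (s - y3 - u) *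
       (q powi (s\<^sup>2) * iqfac (m - s) * iqfac (s + y3) * A u))"
  proof (rule sum.cong[OF refl], rule sum.cong[OF refl])
    fix r s assume "r \<in> I" "s \<in> I"
    hence *: "{y1..r} \<subseteq> I" using N by (auto simp: I_def)
    have "q powi (r\<^sup>2 - r * s + s\<^sup>2) = q powi (r\<^sup>2 - r * s) * q powi (s\<^sup>2)"
      by (rule powi_add)
    thus "q powi (r\<^sup>2 - r * s + s\<^sup>2) * iqfac (n - r) * iqfac (m - s) * Psi r s y1 y2 y3 =
      (\<Sum>u\<in>I. q powi (r\<^sup>2 - r * s) * iqfac (n - r) * iqfac (r - y3) * iqfac (r - u) * iqfac (s - y3 - u) *
       (q powi (s\<^sup>2) * iqfac (m - s) * iqfac (s + y3) * A u))"
      unfolding Psi_expand[OF y fin *] sum_distrib_left by (auto intro!: sum.cong simp: A_def mult_ac)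
  qed
  also have "\<dots> = (\<Sum>u\<in>I. \<Sum>s\<in>I. (\<Sum>r\<in>I. q powi (r\<^sup>2 - r * s) * iqfac (n - r) * iqfac (r - y3) * iqfac (r - u) * iqfac (s - y3 - u)) *
       (q powi (s\<^sup>2) * iqfac (m - s) * iqfac (s + y3) * A u))"
    unfolding sum_distrib_right by (subst sum_rotate) (rule sum.cong[OF refl], rule sum.swap)
  also have "\<dots> = (\<Sum>u\<in>I. \<Sum>s\<in>I. (\<Sum>v\<in>I. q powi (y3\<^sup>2 - y3 * s + (s - v) * (2 * y3 - v)) * iqfac (s - v) *
        iqfac (v - y3 - u) * iqfac (n - v + y3) * iqfac (n - y3)) * (q powi (s\<^sup>2) * iqfac (m - s) * iqfac (s + y3) * A u))"
  proof (rule sum.cong[OF refl], rule sum.cong[OF refl])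
    fix u s assume "u \<in> I" "s \<in> I"
    show "(\<Sum>r\<in>I. q powi (r\<^sup>2 - r * s) * iqfac (n - r) * iqfac (r - y3) * iqfac (r - u) * iqfac (s - y3 - u)) *
       (q powi (s\<^sup>2) * iqfac (m - s) * iqfac (s + y3) * A u) =
      (\<Sum>v\<in>I. q powi (y3\<^sup>2 - y3 * s + (s - v) * (2 * y3 - v)) * iqfac (s - v) *
        iqfac (v - y3 - u) * iqfac (n - v + y3) * iqfac (n - y3)) * (q powi (s\<^sup>2) * iqfac (m - s) * iqfac (s + y3) * A u)"
    \<comment> \<open>Below y1 or y2 the factor \<open>A u\<close> vanishes. Otherwise y3 + u is
      bounded below, so that \<open>I\<close> contains the whole range of \<open>v\<close>.\<close>
    proof (cases "u < y1 \<or> u < y2")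
      case True
      hence "A u = 0" by (auto simp: A_def)
      thus ?thesis by simp
    next
      case False
      have "{y3..n} \<subseteq> I" "{y3 + u..s} \<subseteq> I"
        using N False \<open>s \<in> I\<close> by (auto simp: I_def)
      thus ?thesis using heine_transform[of I y3 n I u s] fin by simp
    qed
  qed
  also have "\<dots> = (\<Sum>v\<in>I. \<Sum>u\<in>I. (\<Sum>s\<in>I. q powi (s\<^sup>2 + y3\<^sup>2 - y3 * s + (s - v) * (2 * y3 - v)) *
        iqfac (m - s) * iqfac (s - v) * iqfac (s + y3)) * (A u * iqfac (v - y3 - u) * iqfac (n - v + y3) * iqfac (n - y3)))"
  proof -
    have e: "q powi (y3\<^sup>2 - y3 * s + (s - v) * (2 * y3 - v)) * q powi (s\<^sup>2) =
        q powi (s\<^sup>2 + y3\<^sup>2 - y3 * s + (s - v) * (2 * y3 - v))" for s v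
      by (simp add: algebra_simps flip: powi_add)
    show ?thesis
      unfolding sum_distrib_right by (subst sum_rotate) (intro sum.cong refl, subst e[symmetric], simp only: mult_ac)
  qed
  also have "\<dots> = (\<Sum>v\<in>I. (\<Sum>u\<in>I. A u * iqfac (v - y3 - u)) * (q powi (y3\<^sup>2 + v\<^sup>2 - v * y3) *
     iqfac (m - v) * iqfac (m + y3) * iqfac (n - v + y3) * iqfac (n - y3)))"
  proof (rule sum.cong[OF refl])
    fix v assume v: "v \<in> I"
    have "{v..m} \<subseteq> I" using v N by (auto simp: I_def)
    note V = limit_vandermonde[OF fin this, of "- y3"]
    \<comment> \<open>Heine's transformation has turned the exponent into (s - v)(s + y3) plus a
      term free of s; this factorisation is what makes the sum over s evaluable.\<close>
    have "q powi (s\<^sup>2 + y3\<^sup>2 - y3 * s + (s - v) * (2 * y3 - v)) =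
      q powi (y3\<^sup>2 + v\<^sup>2 - v * y3) * q powi ((s - v) * (s - - y3))" for s
      by (simp add: algebra_simps power2_eq_square flip: powi_add)
    hence "(\<Sum>s\<in>I. q powi (s\<^sup>2 + y3\<^sup>2 - y3 * s + (s - v) * (2 * y3 - v)) * iqfac (m - s) * iqfac (s - v) * iqfac (s + y3)) =
      q powi (y3\<^sup>2 + v\<^sup>2 - v * y3) * (\<Sum>s\<in>I. q powi ((s - v) * (s - - y3)) * iqfac (m - s) * iqfac (s - v) * iqfac (s - - y3))"
      by (simp add: sum_distrib_left mult_ac)
    also have "\<dots> = q powi (y3\<^sup>2 + v\<^sup>2 - v * y3) * (iqfac (m - v) * iqfac (m + y3))"
      unfolding V by simp
    finally show "(\<Sum>u\<in>I. (\<Sum>s\<in>I. q powi (s\<^sup>2 + y3\<^sup>2 - y3 * s + (s - v) * (2 * y3 - v)) *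
        iqfac (m - s) * iqfac (s - v) * iqfac (s + y3)) * (A u * iqfac (v - y3 - u) * iqfac (n - v + y3) * iqfac (n - y3))) =
      (\<Sum>u\<in>I. A u * iqfac (v - y3 - u)) * (q powi (y3\<^sup>2 + v\<^sup>2 - v * y3) *
     iqfac (m - v) * iqfac (m + y3) * iqfac (n - v + y3) * iqfac (n - y3))"
      by (simp add: sum_distrib_left sum_distrib_right mult_ac)
  qed
  also have "\<dots> = (\<Sum>v\<in>I. q powi (y3\<^sup>2 - y1 * y2) * (iqfac (m + y3) * iqfac (n - y3)) *
     (q powi ((v - - y1) * (v - - y2)) * iqfac (v - - y1) * iqfac (v - - y2) * iqfac (n + y3 - v) * iqfac (m - v)))"
  proof (rule sum.cong[OF refl])
    fix v assume v: "v \<in> I"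
    have y3: "y3 = - y1 - y2" using y by simp
    \<comment> \<open>For v <= m the range of u is known to lie in \<open>I\<close>; larger v are
      killed by \<open>iqfac (m - v)\<close>.\<close>
    have *: "(\<Sum>u\<in>I. A u * iqfac (v - y3 - u)) = iqfac (v - - y2) * iqfac (v - - y1)" if "v \<le> m"
    proof -
      have "{y1..v - y3} \<subseteq> I" using v N that by (auto simp: I_def)
      note V = limit_vandermonde[OF fin this, of y2]
      have "v - y3 - y1 = v - - y2" "v - y3 - y2 = v - - y1" using y3 by auto
      with V show ?thesis by (simp add: A_def mult_ac)
    qed
    have "q powi (y3\<^sup>2 + v\<^sup>2 - v * y3) = q powi (y3\<^sup>2 - y1 * y2) * q powi ((v - - y1) * (v - - y2))"
      by (simp add: y3 algebra_simps power2_eq_square flip: powi_add)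
    moreover have "n - v + y3 = n + y3 - v" by simp
    ultimately show "(\<Sum>u\<in>I. A u * iqfac (v - y3 - u)) * (q powi (y3\<^sup>2 + v\<^sup>2 - v * y3) *
        iqfac (m - v) * iqfac (m + y3) * iqfac (n - v + y3) * iqfac (n - y3)) =
      q powi (y3\<^sup>2 - y1 * y2) * (iqfac (m + y3) * iqfac (n - y3)) *
     (q powi ((v - - y1) * (v - - y2)) * iqfac (v - - y1) * iqfac (v - - y2) * iqfac (n + y3 - v) * iqfac (m - v))"
      by (cases "v \<le> m") (simp_all only: * mult_ac, simp_all)
  qed
  also have "\<dots> = q powi (y1\<^sup>2 + y1 * y2 + y2\<^sup>2) * Psi n m y1 y2 y3"
  proof -
    have y3: "y3 = - y1 - y2" using y by simp
    have "{- y1..n + y3} \<subseteq> I" using N by (auto simp: I_def)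
    note V = vandermonde[OF fin this]
    have e: "y3\<^sup>2 - y1 * y2 = y1\<^sup>2 + y1 * y2 + y2\<^sup>2" "n + y3 + m - - y1 - - y2 = n + m"
      "n + y3 - - y1 = n - y2" "n + y3 - - y2 = n - y1"
      "m - - y1 = m + y1" "m - - y2 = m + y2"
      by (simp_all add: y3 algebra_simps power2_eq_square)
    thus ?thesis
      unfolding sum_distrib_left[symmetric] V Psi_def e by (simp only: mult_ac)
  qed
  finally show ?thesis .
qed

end

section \<open>The seed identity\<close>

text \<open>
With \<open>c = - a - b\<close>, \<open>cas a b\<close> stands for $(a^2 + b^2 + c^2 - 2)/6$. The division is exact only where
\<open>chi3 (a - b)\<close> does not vanish, that is, where \<open>a\<close>, \<open>b\<close>, \<open>c\<close> are distinct modulo 3; the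
character is then the sign of the permutation of the residues. The vectors $y$ of the Bailey
lemma are $(a, b, c) - \rho$ with $\rho = (1, 0, -1)$.
\<close>

definition chi3 :: "int \<Rightarrow> 'a::ring_1" where
  "chi3 d = (if d mod 3 = 1 then 1 else if d mod 3 = 2 then - 1 else 0)"

definition cas :: "int \<Rightarrow> int \<Rightarrow> int" where
  "cas a b = (a\<^sup>2 + a * b + b\<^sup>2 - 1) div 3"

lemma chi3_minus: "chi3 (- d) = - chi3 d"
proof -
  have "d mod 3 = 0 \<or> d mod 3 = 1 \<or> d mod 3 = 2" by presburger
  moreover have "d mod 3 = 0 \<Longrightarrow> - d mod 3 = 0" "d mod 3 = 1 \<Longrightarrow> - d mod 3 = 2"
    "d mod 3 = 2 \<Longrightarrow> - d mod 3 = 1" by presburger+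
  ultimately show ?thesis by (auto simp: chi3_def)
qed

lemma chi3_add3: "chi3 (d + 3 * k) = chi3 d"
  by (simp add: chi3_def)

lemma chi3_cong: "d mod 3 = d' mod 3 \<Longrightarrow> chi3 d = chi3 d'"
  by (simp add: chi3_def)

lemma cas_comm: "cas a b = cas b a" by (simp add: cas_def algebra_simps)
lemma cas_flip: "cas a (- a - b) = cas a b"
  by (simp add: cas_def algebra_simps power2_eq_square)
lemma cas_shift: "cas (a + 2) (b - 1) = cas a b + a + 1"
proof -
  have "(a + 2)\<^sup>2 + (a + 2) * (b - 1) + (b - 1)\<^sup>2 - 1 = (a\<^sup>2 + a * b + b\<^sup>2 - 1) + 3 * (a + 1)"
    by (simp add: algebra_simps power2_eq_square)
  thus ?thesis by (simp add: cas_def)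
qed

text \<open>Modulo 3 the form a^2 + ab + b^2 equals (a - b)^2, which is 1 as soon as a and b are
  incongruent.\<close>

lemma three_cas:
  assumes "chi3 (a - b) \<noteq> (0::'a::ring_1)"
  shows "3 * cas a b = a\<^sup>2 + a * b + b\<^sup>2 - 1"
proof -
  have "(a - b) mod 3 = 1 \<or> (a - b) mod 3 = 2" using assms by (auto simp: chi3_def split: if_splits)
  hence "((a - b) mod 3)\<^sup>2 mod 3 = 1" by auto
  hence "(a - b)\<^sup>2 mod 3 = 1" by (simp add: power_mod)
  moreover have "(a - b)\<^sup>2 + 3 * (a * b) = a\<^sup>2 + a * b + b\<^sup>2"
    by (simp add: algebra_simps power2_eq_square)
  ultimately have "(a\<^sup>2 + a * b + b\<^sup>2) mod 3 = 1"
    by (metis mod_mult_self2)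
  hence "3 dvd a\<^sup>2 + a * b + b\<^sup>2 - 1" by presburger
  thus ?thesis by (simp add: cas_def)
qed

definition tri :: "int \<Rightarrow> int" where "tri k = k * (k - 1) div 2"

lemma two_tri: "2 * tri k = k * (k - 1)"
  by (simp add: tri_def)

lemma tri_pred: "tri k = tri (k - 1) + k - 1"
proof -
  have "2 * tri k = 2 * (tri (k - 1) + k - 1)"
    unfolding distrib_left right_diff_distrib two_tri by (simp add: algebra_simps)
  thus ?thesis by simp
qed

context generic_q begin

text \<open>The pairing of f(x_1) g(x_2) h(x_3) with the affine A_2 Weyl denominator: the triples
  (a, b, -a-b) with \<open>chi3\<close> nonzero are the vectors w(rho) + 3 v with w a permutation
  and v in the root lattice, and \<open>chi3\<close> is the sign of w. Since a and b determine the
  third coordinate, finite support of two of the functions suffices for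
  \<open>Sum_any\<close>.\<close>

definition alt_sum :: "(int \<Rightarrow> 'a) \<Rightarrow> (int \<Rightarrow> 'a) \<Rightarrow> (int \<Rightarrow> 'a) \<Rightarrow> 'a" where
  "alt_sum f g h = Sum_any (\<lambda>x. case x of (a, b) \<Rightarrow> chi3 (a - b) * q powi cas a b * f a * g b * h (- a - b))"

definition fin_supp :: "(int \<Rightarrow> 'a) \<Rightarrow> bool" where "fin_supp f \<longleftrightarrow> finite {x. f x \<noteq> 0}"

lemma alt_sum_finite:
  assumes "fin_supp f" "fin_supp g"
  shows "finite {x. (case x of (a, b) \<Rightarrow> chi3 (a - b) * q powi cas a b * f a * g b * h (- a - b)) \<noteq> 0}"
  by (rule finite_subset[of _ "{x. f x \<noteq> 0} \<times> {x. g x \<noteq> 0}"]) (use assms in \<open>auto simp: fin_supp_def\<close>)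

lemma Sum_any_neg: "Sum_any (\<lambda>x. - F x) = - Sum_any (F :: 'b \<Rightarrow> 'a)"
  by (simp add: Sum_any.expand_set sum_negf)

lemma alt_sum_swap12: "alt_sum g f h = - alt_sum f g h"
  unfolding alt_sum_def Sum_any_neg[symmetric]
proof (rule Sum_any.reindex_cong[of prod.swap])
  show "bij (prod.swap :: int \<times> int \<Rightarrow> _)" by (simp add: bij_swap)
  have "chi3 (b - a) * q powi cas b a * g b * f a * h (- b - a) =
        - (chi3 (a - b) * q powi cas a b * f a * g b * h (- a - b))" for a b :: int
  proof -
    have c: "chi3 (b - a) = - (chi3 (a - b) :: 'a)" using chi3_minus[of "a - b"] by simp
    have e: "- b - a = - a - b" by simp
    show ?thesis unfolding c e cas_comm[of b a] by (simp add: mult_ac)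
  qed
  thus "(\<lambda>(a, b). chi3 (a - b) * q powi cas a b * g a * f b * h (- a - b)) \<circ> prod.swap =
    (\<lambda>x. - (case x of (a, b) \<Rightarrow> chi3 (a - b) * q powi cas a b * f a * g b * h (- a - b)))"
    by (auto simp: fun_eq_iff)
qed

lemma alt_sum_swap23: "alt_sum f h g = - alt_sum f g h"
  unfolding alt_sum_def Sum_any_neg[symmetric]
proof (rule Sum_any.reindex_cong[of "\<lambda>(a, b). (a, - a - b)"])
  show "bij (\<lambda>(a :: int, b :: int). (a, - a - b))"
    by (rule o_bij[of "\<lambda>(a :: int, b :: int). (a, - a - b)"]) auto
  have "chi3 (a - (- a - b)) * q powi cas a (- a - b) * f a * h (- a - b) * g (- a - (- a - b)) =
        - (chi3 (a - b) * q powi cas a b * f a * g b * h (- a - b))" for a b :: int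
  proof -
    have "(a - (- a - b)) mod 3 = (- (a - b)) mod 3" by presburger
    hence c: "chi3 (a - (- a - b)) = - (chi3 (a - b) :: 'a)" using chi3_minus[of "a - b"] chi3_cong by metis
    have e: "- a - (- a - b) = b" by simp
    show ?thesis unfolding c e cas_flip by (simp add: mult_ac)
  qed
  thus "(\<lambda>(a, b). chi3 (a - b) * q powi cas a b * f a * h b * g (- a - b)) \<circ> (\<lambda>(a, b). (a, - a - b)) =
    (\<lambda>x. - (case x of (a, b) \<Rightarrow> chi3 (a - b) * q powi cas a b * f a * g b * h (- a - b)))"
    by (auto simp: fun_eq_iff)
qed

lemma alt_sum_refl12: "alt_sum f f h = 0"
  using alt_sum_swap12[of f f h] by (simp add: eq_neg_iff_add_eq_0)

lemma alt_sum_refl23: "alt_sum f g g = 0"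
  using alt_sum_swap23[of f g g] by (simp add: eq_neg_iff_add_eq_0)

lemma alt_sum_refl13: "alt_sum f g f = 0"
  using alt_sum_swap23[of f f g] alt_sum_refl12[of f g] by simp

lemma alt_sum_add2: "fin_supp f \<Longrightarrow> fin_supp g \<Longrightarrow> fin_supp g' \<Longrightarrow> alt_sum f (\<lambda>x. g x + g' x) h = alt_sum f g h + alt_sum f g' h"
  unfolding alt_sum_def
  by (subst Sum_any.distrib[symmetric], erule (1) alt_sum_finite, erule (1) alt_sum_finite)
     (auto intro!: Sum_any.cong simp: algebra_simps)

lemma alt_sum_add3: "fin_supp f \<Longrightarrow> fin_supp g \<Longrightarrow> alt_sum f g (\<lambda>x. h x + h' x) = alt_sum f g h + alt_sum f g h'"
  unfolding alt_sum_def
  by (subst Sum_any.distrib[symmetric], erule (1) alt_sum_finite, erule (1) alt_sum_finite)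
     (auto intro!: Sum_any.cong simp: algebra_simps)

lemma alt_sum_lin1: "fin_supp f \<Longrightarrow> fin_supp f' \<Longrightarrow> fin_supp g \<Longrightarrow> alt_sum (\<lambda>x. f x - c * f' x) g h = alt_sum f g h - c * alt_sum f' g h"
proof -
  assume a: "fin_supp f" "fin_supp f'" "fin_supp g"
  have fin: "finite {x. (case x of (a, b) \<Rightarrow> (- c) * (chi3 (a - b) * q powi cas a b * f' a * g b * h (- a - b))) \<noteq> 0}"
    by (rule finite_subset[OF _ alt_sum_finite[OF a(2,3), of h]]) auto
  have "alt_sum f g h - c * alt_sum f' g h = alt_sum f g h + (- c) * alt_sum f' g h" by simp
  also have "\<dots> = alt_sum (\<lambda>x. f x - c * f' x) g h"
    unfolding alt_sum_def
    by (subst Sum_any_right_distrib[OF alt_sum_finite[OF a(2,3)]],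
        subst Sum_any.distrib[symmetric], rule alt_sum_finite[OF a(1,3)],
        use fin in \<open>simp add: case_prod_unfold\<close>)
       (auto intro!: Sum_any.cong simp: algebra_simps)
  finally show ?thesis by simp
qed

lemma alt_sum_scale: "alt_sum (\<lambda>a. c1 * f a) (\<lambda>a. c2 * g a) (\<lambda>a. c3 * h a) = c1 * c2 * c3 * alt_sum f g h"
proof (cases "c1 * c2 * c3 = 0")
  case True
  hence "(case x of (a, b) \<Rightarrow> chi3 (a - b) * q powi cas a b * (c1 * f a) * (c2 * g b) * (c3 * h (- a - b))) = 0" for x
    by auto
  thus ?thesis using True unfolding alt_sum_def by (simp only: Sum_any.neutral) simp
next
  case False
  let ?F = "\<lambda>x. case x of (a, b) \<Rightarrow> chi3 (a - b) * q powi cas a b * f a * g b * h (- a - b)"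
  let ?G = "\<lambda>x. case x of (a, b) \<Rightarrow> chi3 (a - b) * q powi cas a b * (c1 * f a) * (c2 * g b) * (c3 * h (- a - b))"
  have *: "?G x = c1 * c2 * c3 * ?F x" for x by (cases x) (simp add: mult_ac)
  hence **: "{x. ?G x \<noteq> 0} = {x. ?F x \<noteq> 0}" using False by auto
  show ?thesis unfolding alt_sum_def Sum_any.expand_set ** unfolding * sum_distrib_left ..
qed

text \<open>Translation by (2, -1, -1), three times a fundamental weight, lowers all three residues
  modulo 3 by one. So the sign is kept, and \<open>cas\<close> changes only by the linear term a +
  1.\<close>

lemma alt_sum_shift:
  "alt_sum f g h = alt_sum (\<lambda>a. q powi (a + 1) * f (a + 2)) (\<lambda>b. g (b - 1)) (\<lambda>c. h (c - 1))"
  unfolding alt_sum_def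
proof (rule Sum_any.reindex_cong[of "\<lambda>(a, b). (a + 2, b - 1)"])
  show "bij (\<lambda>(a :: int, b :: int). (a + 2, b - 1))"
    by (rule o_bij[of "\<lambda>(a :: int, b :: int). (a - 2, b + 1)"]) auto
  have "chi3 (a + 2 - (b - 1)) * q powi cas (a + 2) (b - 1) * f (a + 2) * g (b - 1) * h (- (a + 2) - (b - 1)) =
    chi3 (a - b) * q powi cas a b * (q powi (a + 1) * f (a + 2)) * g (b - 1) * h (- a - b - 1)" for a b :: int
  proof -
    have c: "chi3 (a + 2 - (b - 1)) = (chi3 (a - b) :: 'a)" using chi3_add3[of "a - b" 1] by (simp add: algebra_simps)
    have e: "- (a + 2) - (b - 1) = - a - b - 1" by simp
    have p: "q powi (cas a b + a + 1) = q powi cas a b * q powi (a + 1)"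
      by (simp only: add.assoc powi_add[symmetric])
    show ?thesis unfolding c e cas_shift p by (simp add: mult_ac)
  qed
  thus "(\<lambda>(a, b). chi3 (a - b) * q powi cas a b * f a * g b * h (- a - b)) \<circ> (\<lambda>(a, b). (a + 2, b - 1)) =
    (\<lambda>x. case x of (a, b) \<Rightarrow> chi3 (a - b) * q powi cas a b * (q powi (a + 1) * f (a + 2)) * g (b - 1) * h (- a - b - 1))"
    by (auto simp: fun_eq_iff)
qed

text \<open>
\<open>esym N k\<close> is the elementary symmetric polynomial $e_k(1, q, \dots, q^{N-1})$ and \<open>esym_q N k\<close> is
$e_k(q, \dots, q^N)$.
\<close>

definition esym :: "nat \<Rightarrow> int \<Rightarrow> 'a" where
  "esym N k = q powi tri k * (qfac N * iqfac k * iqfac (int N - k))"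

definition esym_q :: "nat \<Rightarrow> int \<Rightarrow> 'a" where "esym_q N k = q powi k * esym N k"

lemma esym_support: "esym N k \<noteq> 0 \<Longrightarrow> k \<in> {0..int N}"
  by (auto simp: esym_def)

lemma fin_supp_esym: "fin_supp (\<lambda>a. esym N (n - a))"
  unfolding fin_supp_def by (rule finite_subset[of _ "{n - int N..n}"]) (auto dest: esym_support)

lemma fin_supp_esym_q: "fin_supp (\<lambda>a. esym_q N (n - a))"
  unfolding fin_supp_def by (rule finite_subset[of _ "{n - int N..n}"]) (auto simp: esym_q_def dest: esym_support)

lemma esym_q_pred: "esym_q N (k - 1) = q powi tri k * (qfac N * iqfac (k - 1) * iqfac (int N + 1 - k))"
proof -
  have p: "q powi tri k = q powi (k - 1) * q powi tri (k - 1)"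
    unfolding powi_add[symmetric] tri_pred[of k] by (simp add: algebra_simps)
  have e: "int N - (k - 1) = int N + 1 - k" by simp
  show ?thesis unfolding esym_q_def esym_def p e by (simp only: mult_ac)
qed

text \<open>Separate the variable 1 from q, ..., q^N.\<close>

lemma esym_Suc: "esym (Suc N) k = esym_q N k + esym_q N (k - 1)"
proof -
  have "esym_q N k = q powi tri k * (q powi k * qfac N * iqfac k * iqfac (int N + 1 - k - 1))"
    by (simp add: esym_q_def esym_def algebra_simps)
  hence "esym_q N k + esym_q N (k - 1) = q powi tri k * qfac N * iqfac k * iqfac (int N + 1 - k) *
    (q powi k * (1 - q powi (int N + 1 - k)) + (1 - q powi k))"
    unfolding esym_q_pred iqfac_rec[symmetric] by (simp add: algebra_simps)
  also have "q powi k * (1 - q powi (int N + 1 - k)) + (1 - q powi k) = 1 - q powi (int N + 1)"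
    by (simp add: algebra_simps flip: powi_add)
  finally show ?thesis by (simp add: esym_def qfac_Suc add.commute mult_ac)
qed

text \<open>The left-hand side is e_k(q, ..., q^(N+1)). Compared with e_k(1, ..., q^N), the variable
  1 is replaced by q^(N+1), which affects only the monomials containing it.\<close>

lemma esym_q_shift: "q powi k * esym (Suc N) k = esym (Suc N) k - (1 - q powi (int N + 1)) * esym_q N (k - 1)"
  unfolding esym_q_pred iqfac_rec[symmetric] by (simp add: esym_def qfac_Suc algebra_simps)

text \<open>The offsets 1, 0, -1 are rho: the three indices are n - y_i for y = (a, b, c) -
  rho.\<close>

definition alt_esym :: "nat \<Rightarrow> int \<Rightarrow> 'a" where
  "alt_esym N n = alt_sum (\<lambda>a. esym N (n + 1 - a)) (\<lambda>b. esym N (n - b)) (\<lambda>c. esym N (n - 1 - c))"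

text \<open>After the translation the three indices reappear cyclically permuted, and a cyclic
  permutation is even.\<close>

lemma alt_esym_shift:
  "alt_sum (\<lambda>a. q powi (n + 1 - a) * esym N (n + 1 - a)) (\<lambda>b. esym N (n - b)) (\<lambda>c. esym N (n - 1 - c)) =
   q powi n * alt_esym N n"
proof -
  have "alt_sum (\<lambda>a. q powi (n + 1 - a) * esym N (n + 1 - a)) (\<lambda>b. esym N (n - b)) (\<lambda>c. esym N (n - 1 - c)) =
    alt_sum (\<lambda>a. q powi n * esym N (n - 1 - a)) (\<lambda>b. 1 * esym N (n + 1 - b)) (\<lambda>c. 1 * esym N (n - c))"
  proof -
    have e: "q powi (a + 1) * (q powi (n + 1 - (a + 2)) * esym N (n + 1 - (a + 2))) = q powi n * esym N (n - 1 - a)"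
      "n - (b - 1) = n + 1 - b" "n - 1 - (b - 1) = n - b" for a b
      by (simp_all add: algebra_simps mult.assoc[symmetric] flip: powi_add)
    thus ?thesis
      by (subst alt_sum_shift) (simp only: e mult_1)
  qed
  also have "\<dots> = q powi n * alt_sum (\<lambda>a. esym N (n - 1 - a)) (\<lambda>b. esym N (n + 1 - b)) (\<lambda>c. esym N (n - c))"
    unfolding alt_sum_scale by simp
  also have "\<dots> = q powi n * alt_esym N n"
    unfolding alt_esym_def by (subst alt_sum_swap12, subst alt_sum_swap23) simp
  finally show ?thesis .
qed

text \<open>
The weight $q^{n+1-a}$ of \<open>alt_esym_shift\<close> is absorbed by a translation of the lattice. On the other hand
it replaces one \<open>esym (Suc N)\<close> by a difference; expanding the other two in \<open>esym_q N\<close>, all terms but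
one vanish by antisymmetry.
\<close>

lemma alt_esym_rec:
  "(1 - q powi n) * alt_esym (Suc N) n = (1 - q powi (int N + 1)) * q powi (3 * (n - 1)) * alt_esym N (n - 1)"
proof -
  define r where "r i = (\<lambda>a. esym_q N (n - i - a))" for i :: int
  have fsr: "fin_supp (r i)" for i unfolding r_def by (rule fin_supp_esym_q)
  have e: "(\<lambda>b. esym (Suc N) (n - b)) = (\<lambda>b. r 0 b + r 1 b)"
    "(\<lambda>b. esym (Suc N) (n - 1 - b)) = (\<lambda>b. r 1 b + r 2 b)"
    by (auto simp: fun_eq_iff esym_Suc r_def algebra_simps)
  have fse: "fin_supp (\<lambda>b. r 0 b + r 1 b)" unfolding e(1)[symmetric] by (rule fin_supp_esym)
  have "q powi n * alt_esym (Suc N) n = alt_sum (\<lambda>a. esym (Suc N) (n + 1 - a) - (1 - q powi (int N + 1)) * r 0 a)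
     (\<lambda>b. esym (Suc N) (n - b)) (\<lambda>c. esym (Suc N) (n - 1 - c))"
    unfolding alt_esym_shift[symmetric] esym_q_shift r_def by (simp add: algebra_simps)
  also have "\<dots> = alt_esym (Suc N) n - (1 - q powi (int N + 1)) *
     alt_sum (r 0) (\<lambda>b. esym (Suc N) (n - b)) (\<lambda>c. esym (Suc N) (n - 1 - c))"
    by (subst alt_sum_lin1) (auto simp: fin_supp_esym fsr alt_esym_def)
  also have "alt_sum (r 0) (\<lambda>b. esym (Suc N) (n - b)) (\<lambda>c. esym (Suc N) (n - 1 - c)) = alt_sum (r 0) (r 1) (r 2)"
    unfolding e by (simp add: alt_sum_add2 alt_sum_add3 fsr fse alt_sum_refl12 alt_sum_refl23 alt_sum_refl13)
  also have "alt_sum (r 0) (r 1) (r 2) = q powi (3 * (n - 1)) * alt_esym N (n - 1)"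
  proof -
    have alt_esym_def': "alt_esym N (n - 1) = alt_sum (\<lambda>a. esym N (n - a)) (\<lambda>b. esym N (n - 1 - b)) (\<lambda>c. esym N (n - 2 - c))"
      by (simp add: alt_esym_def algebra_simps)
    have "q powi (3 * (n - 1)) * alt_esym N (n - 1) =
      Sum_any (\<lambda>x. case x of (a, b) \<Rightarrow> q powi (3 * (n - 1)) * (chi3 (a - b) * q powi cas a b * esym N (n - a) * esym N (n - 1 - b) * esym N (n - 2 - (- a - b))))"
      unfolding alt_esym_def' alt_sum_def
      by (subst Sum_any_right_distrib)
         (rule alt_sum_finite[OF fin_supp_esym fin_supp_esym], rule Sum_any.cong, auto simp: algebra_simps)
    also have "\<dots> = alt_sum (r 0) (r 1) (r 2)"
      unfolding alt_sum_def
    proof (rule Sum_any.cong, safe)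
      fix a b
      \<comment> \<open>The three weights of \<open>esym_q\<close> multiply to a constant because
        the coordinates sum to 0.\<close>
      have "q powi (3 * (n - 1)) = q powi (n - a) * (q powi (n - 1 - b) * q powi (n - 2 - (- a - b)))"
        by (simp flip: powi_add)
      thus "q powi (3 * (n - 1)) * (chi3 (a - b) * q powi cas a b * esym N (n - a) * esym N (n - 1 - b) * esym N (n - 2 - (- a - b))) =
         chi3 (a - b) * q powi cas a b * r 0 a * r 1 b * r 2 (- a - b)"
        by (simp add: r_def esym_q_def mult_ac)
    qed
    finally show ?thesis by simp
  qed
  finally show ?thesis by (simp add: algebra_simps)
qed

text \<open>The supports force a <= 1, b <= 0 and c <= -1; as a + b + c = 0, only the vector rho
  contributes.\<close>

lemma alt_esym_0: "alt_esym N 0 = 1"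
proof -
  have "alt_esym N 0 = (\<Sum>x\<in>{(1, 0)}. case x of (a, b) \<Rightarrow> chi3 (a - b) * q powi cas a b * esym N (0 + 1 - a) *
     esym N (0 - b) * esym N (0 - 1 - (- a - b)))"
    unfolding alt_esym_def alt_sum_def
  proof (rule Sum_any.expand_superset)
    show "{x. (case x of (a, b) \<Rightarrow> chi3 (a - b) * q powi cas a b * esym N (0 + 1 - a) *
     esym N (0 - b) * esym N (0 - 1 - (- a - b))) \<noteq> 0} \<subseteq> {(1, 0)}"
    proof safe
      fix a b assume "chi3 (a - b) * q powi cas a b * esym N (0 + 1 - a) * esym N (0 - b) * esym N (0 - 1 - (- a - b)) \<noteq> 0"
      hence "esym N (0 + 1 - a) \<noteq> 0" "esym N (0 - b) \<noteq> 0" "esym N (0 - 1 - (- a - b)) \<noteq> 0"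
        by (simp_all only: mult_eq_0_iff de_Morgan_disj not_False_eq_True)
      note this[THEN esym_support]
      thus "a = 1" "b = 0" by auto
    qed
  qed auto
  also have "\<dots> = 1"
    by (simp add: chi3_def cas_def esym_def tri_def iqfac_nat)
  finally show ?thesis .
qed

lemma alt_esym_eq: "alt_esym N (int n) = q powi (3 * tri (int n)) * (qfac N * iqfac (int n) * iqfac (int N - int n))"
proof (induction n arbitrary: N)
  case 0 show ?case by (simp add: alt_esym_0 tri_def iqfac_nat)
next
  case (Suc n)
  define k where "k = int (Suc n)"
  have k: "k - 1 = int n" "k > 0" by (simp_all add: k_def)
  show ?case unfolding k_def[symmetric]
  proof (cases N)
    \<comment> \<open>Without variables all three indices must be 0, so a, b, c would be k + 1, k, k
      - 1, whose sum 3k is not 0.\<close>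
    case 0
    have "alt_esym 0 k = 0" unfolding alt_esym_def alt_sum_def
    proof -
      have "esym 0 (k + 1 - a) * esym 0 (k - b) * esym 0 (k - 1 - (- a - b)) = 0" for a b
      proof (rule ccontr)
        assume "esym 0 (k + 1 - a) * esym 0 (k - b) * esym 0 (k - 1 - (- a - b)) \<noteq> 0"
        hence "esym 0 (k + 1 - a) \<noteq> 0" "esym 0 (k - b) \<noteq> 0" "esym 0 (k - 1 - (- a - b)) \<noteq> 0"
          by (simp_all only: mult_eq_0_iff de_Morgan_disj not_False_eq_True)
        note this[THEN esym_support]
        thus False using k by auto
      qed
      hence "(case x of (a, b) \<Rightarrow> chi3 (a - b) * q powi cas a b * esym 0 (k + 1 - a) *
         esym 0 (k - b) * esym 0 (k - 1 - (- a - b))) = 0" for x by (cases x) (simp only: case_prod_conv mult.assoc mult_zero_right)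
      thus "Sum_any (\<lambda>x. case x of (a, b) \<Rightarrow> chi3 (a - b) * q powi cas a b * esym 0 (k + 1 - a) *
         esym 0 (k - b) * esym 0 (k - 1 - (- a - b))) = 0" by simp
    qed
    thus "alt_esym N k = q powi (3 * tri k) * (qfac N * iqfac k * iqfac (int N - k))" using 0 k by simp
  next
    case (Suc M)
    have "(1 - q powi k) * alt_esym N k = (1 - q powi (int M + 1)) * q powi (3 * (k - 1)) *
       (q powi (3 * tri (k - 1)) * (qfac M * iqfac (k - 1) * iqfac (int M - (k - 1))))"
      unfolding Suc alt_esym_rec unfolding k Suc.IH ..
    also have "\<dots> = (1 - q powi k) * (q powi (3 * tri k) * (qfac N * iqfac k * iqfac (int N - k)))"
    proof -
      have "q powi (3 * (k - 1)) * q powi (3 * tri (k - 1)) = q powi (3 * tri k)"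
        unfolding powi_add[symmetric] tri_pred[of k] by (simp add: algebra_simps)
      moreover have e: "int M - (k - 1) = int N - k" using Suc by simp
      have "qfac N = qfac M * (1 - q powi (int M + 1))" unfolding Suc qfac_Suc ..
      ultimately show ?thesis
        unfolding iqfac_rec[symmetric] e by (simp add: mult_ac)
    qed
    finally show "alt_esym N k = q powi (3 * tri k) * (qfac N * iqfac k * iqfac (int N - k))"
      using powi_ne_1[of k] k by simp
  qed
qed

text \<open>\<open>alt_esym_eq\<close> at N = n + m, with each product of \<open>esym\<close> and
  its mirrored reciprocals regrouped into \<open>Psi\<close>; the triangular exponents add |y|^2/2
  to \<open>cas\<close>.\<close>

lemma seed_a:
  "Sum_any (\<lambda>(a, b). chi3 (a - b) * q powi (4 * cas a b + 2 - 2 * a - b) * Psi (int n) (int m) (a - 1) b (1 - a - b)) =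
   iqfac (int n) * iqfac (int m) * iqfac (int (n + m))"
proof -
  define N where "N = n + m"
  have "alt_esym N (int n) = Sum_any (\<lambda>x. q powi (3 * tri (int n)) * (qfac N)\<^sup>2 * (case x of (a, b) \<Rightarrow>
    chi3 (a - b) * q powi (4 * cas a b + 2 - 2 * a - b) * Psi (int n) (int m) (a - 1) b (1 - a - b)))"
    unfolding alt_esym_def alt_sum_def
  proof (rule Sum_any.cong, safe)
    fix a b :: int
    show "chi3 (a - b) * q powi cas a b * esym N (int n + 1 - a) * esym N (int n - b) * esym N (int n - 1 - (- a - b)) =
      q powi (3 * tri (int n)) * (qfac N)\<^sup>2 * (chi3 (a - b) * q powi (4 * cas a b + 2 - 2 * a - b) *
        Psi (int n) (int m) (a - 1) b (1 - a - b))"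
    proof (cases "chi3 (a - b) = (0::'a)")
      case False
      \<comment> \<open>Doubling clears the halves in \<open>tri\<close>. The division by 3 in
        \<open>cas\<close> is exact because \<open>chi3\<close> is nonzero here.\<close>
      have "2 * (cas a b + tri (int n + 1 - a) + tri (int n - b) + tri (int n - 1 - (- a - b))) =
            2 * (3 * tri (int n) + (4 * cas a b + 2 - 2 * a - b))"
        using three_cas[OF False]
          two_tri[of "int n + 1 - a"] two_tri[of "int n - b"] two_tri[of "int n - 1 - (- a - b)"] two_tri[of "int n"]
        by algebra
      hence E: "cas a b + (tri (int n + 1 - a) + (tri (int n - b) + tri (int n - 1 - (- a - b)))) =
            3 * tri (int n) + (4 * cas a b + 2 - 2 * a - b)"
        by (simp only: mult_cancel_left add.assoc) simp
      define x where "x = int n + 1 - a"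
      define y where "y = int n - b"
      define z where "z = int n - 1 - (- a - b)"
      have p: "q powi cas a b * (q powi tri x * (q powi tri y * q powi tri z)) =
        q powi (3 * tri (int n)) * q powi (4 * cas a b + 2 - 2 * a - b)"
        unfolding powi_add[symmetric] x_def y_def z_def E ..
      have e: "int m + (a - 1) = int N - x" "int m + b = int N - y"
        "int m + (1 - a - b) = int N - z" "int n - (a - 1) = x"
        "int n - b = y" "int n - (1 - a - b) = z" "nat (int n + int m) = N"
        by (simp_all add: N_def nat_int_add x_def y_def z_def)
      have "chi3 (a - b) * q powi cas a b * esym N x * esym N y * esym N z =
        (q powi cas a b * (q powi tri x * (q powi tri y * q powi tri z))) * (chi3 (a - b) * (qfac N)\<^sup>2 *
          (qfac N * (iqfac x * iqfac y * iqfac z * iqfac (int N - x) * iqfac (int N - y) * iqfac (int N - z))))"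
        unfolding esym_def by (simp only: mult_ac power2_eq_square)
      also have "\<dots> = q powi (3 * tri (int n)) * (qfac N)\<^sup>2 * (chi3 (a - b) * q powi (4 * cas a b + 2 - 2 * a - b) *
        Psi (int n) (int m) (a - 1) b (1 - a - b))"
        unfolding p Psi_def e by (simp only: mult_ac)
      finally show ?thesis unfolding x_def y_def z_def .
    qed simp
  qed
  also have "\<dots> = q powi (3 * tri (int n)) * (qfac N)\<^sup>2 * Sum_any (\<lambda>(a, b). 
    chi3 (a - b) * q powi (4 * cas a b + 2 - 2 * a - b) * Psi (int n) (int m) (a - 1) b (1 - a - b))"
  proof (rule Sum_any_right_distrib[symmetric], rule finite_subset)
    show "{x. (case x of (a, b) \<Rightarrow> chi3 (a - b) * q powi (4 * cas a b + 2 - 2 * a - b) *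
      Psi (int n) (int m) (a - 1) b (1 - a - b)) \<noteq> 0} \<subseteq> {- int m..int n + 1} \<times> {- int m..int n + 1}"
      by (auto simp: Psi_def)
  qed auto
  finally have "q powi (3 * tri (int n)) * (qfac N)\<^sup>2 * Sum_any (\<lambda>(a, b). 
    chi3 (a - b) * q powi (4 * cas a b + 2 - 2 * a - b) * Psi (int n) (int m) (a - 1) b (1 - a - b)) =
    q powi (3 * tri (int n)) * (qfac N)\<^sup>2 * (iqfac (int n) * iqfac (int m) * iqfac (int N))"
  proof -
    assume *: "alt_esym N (int n) = q powi (3 * tri (int n)) * (qfac N)\<^sup>2 * Sum_any (\<lambda>(a, b). 
      chi3 (a - b) * q powi (4 * cas a b + 2 - 2 * a - b) * Psi (int n) (int m) (a - 1) b (1 - a - b))"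
    have e: "int N - int n = int m" and h: "(qfac N)\<^sup>2 * iqfac (int N) = qfac N"
      by (simp_all add: iqfac_nat power2_eq_square) (simp add: N_def)
    show ?thesis unfolding *[symmetric] alt_esym_eq e by (subst h[symmetric]) (simp only: mult_ac)
  qed
  hence "Sum_any (\<lambda>(a, b). chi3 (a - b) * q powi (4 * cas a b + 2 - 2 * a - b) *
      Psi (int n) (int m) (a - 1) b (1 - a - b)) = iqfac (int n) * iqfac (int m) * iqfac (int N)"
    by (subst (asm) mult_cancel_left) simp
  thus ?thesis by (simp only: N_def)
qed

end

section \<open>The inverted seed identity\<close>

lemma minus_one_powi_even: "(-1 :: 'a::field) powi (2 * k) = 1"
  by (simp add: power_int_mult)

lemma minus_one_powi_add: "(-1 :: 'a::field) powi (a + b) = (-1) powi a * (-1) powi b"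
  by (rule power_int_add) simp

context generic_q begin

text \<open>The locale does not distinguish q from 1/q, so every identity proved so far also holds
  at the inverse base.\<close>

interpretation inv: generic_q "inverse q"
  by unfold_locales (use q_nz q_pow_ne_1 in \<open>auto simp: power_inverse inverse_eq_1_iff\<close>)

lemma inv_powi: "inverse q powi k = q powi (- k)"
  by (simp add: power_int_inverse power_int_minus)

lemma inv_qfac: "inv.qfac n = (-1) powi int n * q powi (- tri (int n + 1)) * qfac n"
proof (induction n)
  case (Suc n)
  have "1 - inverse q powi (int n + 1) = - (q powi (- (int n + 1))) * (1 - q powi (int n + 1))"
    unfolding inv_powi by (simp add: algebra_simps flip: powi_add)
  moreover have "q powi (- tri (int (Suc n) + 1)) = q powi (- tri (int n + 1)) * q powi (- (int n + 1))"
    using tri_pred[of "int (Suc n) + 1"] unfolding powi_add[symmetric] by (simp add: algebra_simps)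
  moreover have "(-1) powi int (Suc n) = - ((-1 :: 'a) powi int n)"
    unfolding of_nat_Suc minus_one_powi_add by simp
  ultimately show ?case
    unfolding inv.qfac_Suc Suc.IH qfac_Suc by (simp only: mult_minus_left mult_minus_right mult_ac)
qed (simp add: tri_def)

lemma inv_iqfac: "inv.iqfac k = (-1) powi k * q powi (tri (k + 1)) * iqfac k"
proof (cases "k < 0")
  case False
  hence k: "k = int (nat k)" by simp
  have "inv.iqfac k = 1 / inv.qfac (nat k)" using False by (simp add: inv.iqfac_def)
  also have "\<dots> = (-1) powi k * q powi (tri (k + 1)) * iqfac k"
    unfolding inv_qfac using False by (simp add: iqfac_def power_int_minus field_simps flip: power_mult_distrib)
  finally show ?thesis .
qed simp

text \<open>This is \<open>seed_a\<close> at 1/q. Inverting q in \<open>Psi\<close> produces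
  q^(|y|^2) times a power \<open>c\<close> that does not depend on y, so the weight -cas - |y|^2/2
  turns into -cas + |y|^2/2.\<close>

lemma seed_b:
  "Sum_any (\<lambda>(a, b). chi3 (a - b) * q powi (2 * cas a b + 2 - 2 * a - b) * Psi (int n) (int m) (a - 1) b (1 - a - b)) =
   q powi (2 * int n * int m) * (iqfac (int n) * iqfac (int m) * iqfac (int (n + m)))"
proof -
  define N where "N = int (n + m)"
  define c where "c = tri (int n + 1) + tri (int m + 1) + tri (N + 1) - 2 * int n * int m"
  have "Sum_any (\<lambda>(a, b). chi3 (a - b) * inverse q powi (4 * cas a b + 2 - 2 * a - b) * inv.Psi (int n) (int m) (a - 1) b (1 - a - b)) =
    Sum_any (\<lambda>x. q powi c * (case x of (a, b) \<Rightarrow> chi3 (a - b) * q powi (2 * cas a b + 2 - 2 * a - b) * Psi (int n) (int m) (a - 1) b (1 - a - b)))"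
  proof (rule Sum_any.cong, safe)
    fix a b :: int
    show "chi3 (a - b) * inverse q powi (4 * cas a b + 2 - 2 * a - b) * inv.Psi (int n) (int m) (a - 1) b (1 - a - b) =
      q powi c * (chi3 (a - b) * q powi (2 * cas a b + 2 - 2 * a - b) * Psi (int n) (int m) (a - 1) b (1 - a - b))"
    proof (cases "chi3 (a - b) = (0::'a)")
      case False
      define x1 x2 x3 where "x1 = int n - (a - 1)" and "x2 = int n - b" and "x3 = int n - (1 - a - b)"
      define z1 z2 z3 where "z1 = int m + (a - 1)" and "z2 = int m + b" and "z3 = int m + (1 - a - b)"
      \<comment> \<open>One sign comes from (q)_N and six from the reciprocals; their exponents add
        up to 4 N.\<close>
      have s: "(-1 :: 'a) powi N * ((-1) powi x1 * ((-1) powi x2 * ((-1) powi x3 * ((-1) powi z1 * ((-1) powi z2 * (-1) powi z3))))) = 1"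
      proof -
        have "(-1 :: 'a) powi N * ((-1) powi x1 * ((-1) powi x2 * ((-1) powi x3 * ((-1) powi z1 * ((-1) powi z2 * (-1) powi z3))))) =
          (-1) powi (N + (x1 + (x2 + (x3 + (z1 + (z2 + z3))))))"
          by (simp only: minus_one_powi_add)
        also have "N + (x1 + (x2 + (x3 + (z1 + (z2 + z3))))) = 2 * (2 * N)"
          by (simp add: N_def x1_def x2_def x3_def z1_def z2_def z3_def)
        finally show ?thesis by (simp only: minus_one_powi_even)
      qed
      have "2 * (- (4 * cas a b + 2 - 2 * a - b) + (- tri (N + 1) + (tri (x1 + 1) + (tri (x2 + 1) + (tri (x3 + 1) +
         (tri (z1 + 1) + (tri (z2 + 1) + tri (z3 + 1)))))))) = 2 * (c + (2 * cas a b + 2 - 2 * a - b))"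
        using three_cas[OF False] two_tri[of "N + 1"] two_tri[of "x1 + 1"] two_tri[of "x2 + 1"] two_tri[of "x3 + 1"]
          two_tri[of "z1 + 1"] two_tri[of "z2 + 1"] two_tri[of "z3 + 1"] two_tri[of "int n + 1"] two_tri[of "int m + 1"]
        unfolding c_def N_def x1_def x2_def x3_def z1_def z2_def z3_def of_nat_add by algebra
      hence E: "- (4 * cas a b + 2 - 2 * a - b) + (- tri (N + 1) + (tri (x1 + 1) + (tri (x2 + 1) + (tri (x3 + 1) +
         (tri (z1 + 1) + (tri (z2 + 1) + tri (z3 + 1))))))) = c + (2 * cas a b + 2 - 2 * a - b)"
        by (simp only: mult_cancel_left) simp
      have p: "q powi (- (4 * cas a b + 2 - 2 * a - b)) * (q powi (- tri (N + 1)) * (q powi (tri (x1 + 1)) * (q powi (tri (x2 + 1)) *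
         (q powi (tri (x3 + 1)) * (q powi (tri (z1 + 1)) * (q powi (tri (z2 + 1)) * q powi (tri (z3 + 1)))))))) =
        q powi c * q powi (2 * cas a b + 2 - 2 * a - b)"
        unfolding powi_add[symmetric] E ..
      have "nat (int n + int m) = n + m" by (simp add: nat_int_add)
      hence P: "inv.Psi (int n) (int m) (a - 1) b (1 - a - b) = (-1) powi N * q powi (- tri (N + 1)) * qfac (n + m) *
        (inv.iqfac x1 * inv.iqfac x2 * inv.iqfac x3 * inv.iqfac z1 * inv.iqfac z2 * inv.iqfac z3)"
        "Psi (int n) (int m) (a - 1) b (1 - a - b) = qfac (n + m) *
        (iqfac x1 * iqfac x2 * iqfac x3 * iqfac z1 * iqfac z2 * iqfac z3)"
        by (simp_all only: inv.Psi_def Psi_def inv_qfac N_def x1_def x2_def x3_def z1_def z2_def z3_def)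
      have "chi3 (a - b) * inverse q powi (4 * cas a b + 2 - 2 * a - b) * inv.Psi (int n) (int m) (a - 1) b (1 - a - b) =
        ((-1 :: 'a) powi N * ((-1) powi x1 * ((-1) powi x2 * ((-1) powi x3 * ((-1) powi z1 * ((-1) powi z2 * (-1) powi z3)))))) *
        (q powi (- (4 * cas a b + 2 - 2 * a - b)) * (q powi (- tri (N + 1)) * (q powi (tri (x1 + 1)) * (q powi (tri (x2 + 1)) *
         (q powi (tri (x3 + 1)) * (q powi (tri (z1 + 1)) * (q powi (tri (z2 + 1)) * q powi (tri (z3 + 1))))))))) *
        (chi3 (a - b) * Psi (int n) (int m) (a - 1) b (1 - a - b))"
        unfolding P inv_iqfac inv_powi by (simp only: mult_ac)
      also have "\<dots> = q powi c * (chi3 (a - b) * q powi (2 * cas a b + 2 - 2 * a - b) * Psi (int n) (int m) (a - 1) b (1 - a - b))"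
        unfolding p s by (simp only: mult_ac mult_1)
      finally show ?thesis .
    qed simp
  qed
  also have "\<dots> = q powi c * Sum_any (\<lambda>(a, b). 
    chi3 (a - b) * q powi (2 * cas a b + 2 - 2 * a - b) * Psi (int n) (int m) (a - 1) b (1 - a - b))"
  proof (rule Sum_any_right_distrib[symmetric], rule finite_subset)
    show "{x. (case x of (a, b) \<Rightarrow> chi3 (a - b) * q powi (2 * cas a b + 2 - 2 * a - b) *
      Psi (int n) (int m) (a - 1) b (1 - a - b)) \<noteq> 0} \<subseteq> {- int m..int n + 1} \<times> {- int m..int n + 1}"
      by (auto simp: Psi_def)
  qed auto
  finally have *: "inv.iqfac (int n) * inv.iqfac (int m) * inv.iqfac N = q powi c * Sum_any (\<lambda>(a, b). 
    chi3 (a - b) * q powi (2 * cas a b + 2 - 2 * a - b) * Psi (int n) (int m) (a - 1) b (1 - a - b))"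
    unfolding inv.seed_a N_def .
  have "q powi c * (q powi (2 * int n * int m) * (iqfac (int n) * iqfac (int m) * iqfac N)) = 
    inv.iqfac (int n) * inv.iqfac (int m) * inv.iqfac N"
  proof -
    have s: "(-1 :: 'a) powi int n * ((-1) powi int m * (-1) powi N) = 1"
    proof -
      have "(-1 :: 'a) powi int n * ((-1) powi int m * (-1) powi N) = (-1) powi (int n + (int m + N))"
        by (simp only: minus_one_powi_add)
      also have "int n + (int m + N) = 2 * N" by (simp add: N_def)
      finally show ?thesis by (simp only: minus_one_powi_even)
    qed
    have p: "q powi c * q powi (2 * int n * int m) = q powi (tri (int n + 1)) * (q powi (tri (int m + 1)) * q powi (tri (N + 1)))"
      unfolding powi_add[symmetric] by (simp add: c_def add.assoc)
    have "inv.iqfac (int n) * inv.iqfac (int m) * inv.iqfac N = ((-1 :: 'a) powi int n * ((-1) powi int m * (-1) powi N)) *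
      (q powi (tri (int n + 1)) * (q powi (tri (int m + 1)) * q powi (tri (N + 1)))) * (iqfac (int n) * iqfac (int m) * iqfac N)"
      unfolding inv_iqfac by (simp only: mult_ac)
    thus ?thesis unfolding s p[symmetric] by (simp only: mult_ac mult_1)
  qed
  from trans[OF this *] show ?thesis
    unfolding N_def[symmetric] mult_cancel_left by simp
qed

end

section \<open>Iterating the Bailey lemma\<close>

context generic_q begin

definition bailey_sum :: "(int \<Rightarrow> int \<Rightarrow> 'a) \<Rightarrow> int \<Rightarrow> int \<Rightarrow> 'a" where
  "bailey_sum w n m = Sum_any (\<lambda>(a, b). w a b * Psi n m (a - 1) b (1 - a - b))"

definition half_norm :: "int \<Rightarrow> int \<Rightarrow> int" where
  "half_norm a b = (a - 1)\<^sup>2 + (a - 1) * b + b\<^sup>2"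

lemma Psi_nonzeroD:
  assumes "Psi n m y1 y2 y3 \<noteq> 0"
  shows "- m \<le> y1" "y1 \<le> n" "- m \<le> y2" "y2 \<le> n" "- m \<le> y3" "y3 \<le> n"
  using assms by (auto simp: Psi_def)

lemma bailey_sum_eq_sum:
  assumes "\<bar>n\<bar> + \<bar>m\<bar> < M"
  shows "bailey_sum w n m = (\<Sum>(a, b)\<in>{-M..M} \<times> {-M..M}. w a b * Psi n m (a - 1) b (1 - a - b))"
  unfolding bailey_sum_def
proof (rule Sum_any.expand_superset)
  show "{x. (case x of (a, b) \<Rightarrow> w a b * Psi n m (a - 1) b (1 - a - b)) \<noteq> 0} \<subseteq> {-M..M} \<times> {-M..M}"
  proof safe
    fix a b assume "w a b * Psi n m (a - 1) b (1 - a - b) \<noteq> 0"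
    hence "Psi n m (a - 1) b (1 - a - b) \<noteq> 0" by auto
    from Psi_nonzeroD[OF this] assms show "a \<in> {-M..M}" "b \<in> {-M..M}" by auto
  qed
qed auto

lemma bailey_sum_iterate:
  "(\<Sum>r\<in>{0..n}. \<Sum>s\<in>{0..m}. q powi (r\<^sup>2 - r * s + s\<^sup>2) * iqfac (n - r) * iqfac (m - s) * bailey_sum w r s) =
   bailey_sum (\<lambda>a b. w a b * q powi half_norm a b) n m"
proof -
  define M where "M = \<bar>n\<bar> + \<bar>m\<bar> + 1"
  define D where "D = {-M..M} \<times> {-M..M}"
  have "(\<Sum>r\<in>{0..n}. \<Sum>s\<in>{0..m}. q powi (r\<^sup>2 - r * s + s\<^sup>2) * iqfac (n - r) * iqfac (m - s) * bailey_sum w r s) =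
    (\<Sum>r\<in>{0..n}. \<Sum>s\<in>{0..m}. \<Sum>x\<in>D. q powi (r\<^sup>2 - r * s + s\<^sup>2) * iqfac (n - r) * iqfac (m - s) *
      (case x of (a, b) \<Rightarrow> w a b * Psi r s (a - 1) b (1 - a - b)))"
    unfolding sum_distrib_left[symmetric] D_def
    by (intro sum.cong refl, subst bailey_sum_eq_sum[of _ _ M]) (auto simp: M_def)
  also have "\<dots> = (\<Sum>x\<in>D. \<Sum>r\<in>{0..n}. \<Sum>s\<in>{0..m}. q powi (r\<^sup>2 - r * s + s\<^sup>2) * iqfac (n - r) * iqfac (m - s) *
      (case x of (a, b) \<Rightarrow> w a b * Psi r s (a - 1) b (1 - a - b)))"
    by (rule sum_rotate)
  also have "\<dots> = (\<Sum>x\<in>D. case x of (a, b) \<Rightarrow> w a b * q powi half_norm a b * Psi n m (a - 1) b (1 - a - b))"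
  proof (rule sum.cong[OF refl], safe)
    fix a b assume "(a, b) \<in> D"
    define N where "N = \<bar>n\<bar> + \<bar>m\<bar> + \<bar>a - 1\<bar> + \<bar>b\<bar> + \<bar>1 - a - b\<bar>"
    have N: "\<bar>n\<bar> + \<bar>m\<bar> \<le> N" by (simp add: N_def)
    define F where "F r s = q powi (r\<^sup>2 - r * s + s\<^sup>2) * iqfac (n - r) * iqfac (m - s) * Psi r s (a - 1) b (1 - a - b)" for r s
    \<comment> \<open>A nonzero \<open>Psi r s\<close> has -s <= y_i <= r for all i, and the y_i sum
      to 0, so r and s are nonnegative. This cuts the box of the Bailey lemma down to the natural
      ranges.\<close>
    have F0: "F r s = 0" if "\<not> (0 \<le> r \<and> r \<le> n \<and> 0 \<le> s \<and> s \<le> m)" for r s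
    proof (rule ccontr)
      assume "F r s \<noteq> 0"
      hence "Psi r s (a - 1) b (1 - a - b) \<noteq> 0" "r \<le> n" "s \<le> m" by (auto simp: F_def)
      from Psi_nonzeroD[OF this(1)] this(2,3) that show False by auto
    qed
    have "(\<Sum>r\<in>{0..n}. \<Sum>s\<in>{0..m}. F r s) = (\<Sum>r\<in>{0..n}. \<Sum>s\<in>{-2*N..2*N}. F r s)"
      by (rule sum.cong[OF refl], rule sum.mono_neutral_left) (use N in \<open>auto intro!: F0\<close>)
    also have "\<dots> = (\<Sum>r\<in>{-2*N..2*N}. \<Sum>s\<in>{-2*N..2*N}. F r s)"
      by (rule sum.mono_neutral_left) (use N in \<open>auto intro!: F0 sum.neutral\<close>)
    also have "\<dots> = q powi half_norm a b * Psi n m (a - 1) b (1 - a - b)"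
      unfolding F_def half_norm_def by (rule A2_bailey_lemma) (auto simp: N_def)
    finally have *: "w a b * (\<Sum>r\<in>{0..n}. \<Sum>s\<in>{0..m}. F r s) = w a b * (q powi half_norm a b * Psi n m (a - 1) b (1 - a - b))"
      by simp
    show "(\<Sum>r\<in>{0..n}. \<Sum>s\<in>{0..m}. q powi (r\<^sup>2 - r * s + s\<^sup>2) * iqfac (n - r) * iqfac (m - s) *
      (w a b * Psi r s (a - 1) b (1 - a - b))) = w a b * q powi half_norm a b * Psi n m (a - 1) b (1 - a - b)"
      unfolding mult.assoc[of "w a b"] *[symmetric] F_def sum_distrib_left by (simp only: mult_ac)
  qed
  also have "\<dots> = bailey_sum (\<lambda>a b. w a b * q powi half_norm a b) n m"
    unfolding D_def by (rule bailey_sum_eq_sum[symmetric]) (simp add: M_def)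
  finally show ?thesis .
qed

lemma sum_int_nat: "(\<Sum>x\<in>{0..int n}. f x) = (\<Sum>x\<le>n. f (int x))"
  by (rule sum.reindex_bij_witness[of _ int nat]) auto

definition qform :: "nat \<Rightarrow> nat \<Rightarrow> int" where
  "qform r s = (int r)\<^sup>2 - int r * int s + (int s)\<^sup>2"

lemma bailey_sum_iterate_nat:
  "bailey_sum (\<lambda>a b. w a b * q powi half_norm a b) (int n) (int m) =
   (\<Sum>r\<le>n. \<Sum>s\<le>m. q powi qform r s * iqfac (int n - int r) * iqfac (int m - int s) * bailey_sum w (int r) (int s))"
  unfolding bailey_sum_iterate[symmetric] sum_int_nat qform_def ..

section \<open>Replacing the second chain by q-binomials\<close>

definition gbin :: "nat \<Rightarrow> nat \<Rightarrow> 'a" where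
  "gbin n m = qfac n * iqfac (int m) * iqfac (int n - int m)"

lemma gbin_eq_0: "m > n \<Longrightarrow> gbin n m = 0" by (simp add: gbin_def)

lemma heine_gbin: "heine R (int T) (int U) = (\<Sum>M\<le>U. q powi (int M * (int M - R)) * gbin U M * iqfac (int T) * iqfac (int T + int M - R))"
proof -
  have "heine R (int T) (int U) = qfac U * (iqfac (int U) * heine R (int T) (int U))"
    by (simp add: iqfac_nat)
  also have "\<dots> = (\<Sum>M\<le>U. q powi (int M * (int M - R)) * gbin U M * iqfac (int T) * iqfac (int T + int M - R))"
    unfolding heine_sym unfolding heine_def sum_int_nat sum_distrib_left
    by (intro sum.cong refl) (simp add: gbin_def add.commute mult_ac)
  finally show ?thesis .
qed

lemma heine_nat: "heine R (int T) U = (\<Sum>S\<le>T. q powi (int S * (int S - R)) * iqfac (int T - int S) * iqfac (int S) * iqfac (int S + U - R))"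
  unfolding heine_def sum_int_nat by (simp add: mult_ac)

text \<open>\<open>heine_sym\<close> exchanges the sum over the second chain for a sum over M. The
  two reciprocals on the right have the shape of those that carry S on the left, so the step can be
  repeated in the next sum outwards. The bound 2 R does not depend on \<open>U\<close>, which allows
  the sums to be interchanged later.\<close>

lemma chain_step:
  assumes "U \<le> 2 * R"
  shows "(\<Sum>S\<le>T. q powi qform R S * iqfac (int T - int S) * iqfac (int S) * iqfac (int S + int U - int R)) =
    (\<Sum>M\<le>2 * R. q powi qform R M * gbin U M * iqfac (int T) * iqfac (int T + int M - int R))"
proof -
  have Q: "q powi qform R S = q powi ((int R)\<^sup>2) * q powi (int S * (int S - int R))" for S
    unfolding powi_add[symmetric] qform_def by (simp add: algebra_simps power2_eq_square)
  have "(\<Sum>S\<le>T. q powi qform R S * iqfac (int T - int S) * iqfac (int S) * iqfac (int S + int U - int R)) =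
    q powi ((int R)\<^sup>2) * heine (int R) (int T) (int U)"
    unfolding heine_nat Q sum_distrib_left by (simp add: mult_ac)
  also have "\<dots> = (\<Sum>M\<le>U. q powi qform R M * gbin U M * iqfac (int T) * iqfac (int T + int M - int R))"
    unfolding heine_gbin Q sum_distrib_left by (simp add: mult_ac)
  also have "\<dots> = (\<Sum>M\<le>2 * R. q powi qform R M * gbin U M * iqfac (int T) * iqfac (int T + int M - int R))"
    by (rule sum.mono_neutral_left) (use assms in \<open>auto simp: gbin_eq_0\<close>)
  finally show ?thesis .
qed

text \<open>The inner \<open>j\<close> positions of the multiple sum, seen from a position with the
  values (n, m); \<open>V\<close> closes the chain.\<close>

fun chain_sum :: "(nat \<Rightarrow> nat \<Rightarrow> 'a) \<Rightarrow> nat \<Rightarrow> nat \<Rightarrow> nat \<Rightarrow> 'a" where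
  "chain_sum V 0 n m = V n m"
| "chain_sum V (Suc j) n m = (\<Sum>R\<le>n. \<Sum>M\<le>2 * R. iqfac (int n - int R) * q powi qform R M * gbin (n - R + M) m * chain_sum V j R M)"

text \<open>The hypothesis describes a Bailey sum whose second chain has already been removed. A
  Bailey step preserves this shape by \<open>chain_step\<close> with U = R - R' + M', where R', M'
  belong to the next inner position: this is the top entry n_i - n_(i+1) + m_(i+1).\<close>

lemma bailey_sum_chain:
  assumes "\<And>n T. bailey_sum w (int n) (int T) = (\<Sum>R\<le>n. \<Sum>M\<le>2 * R. iqfac (int n - int R) * q powi qform R M * V R M *
     iqfac (int T) * iqfac (int T + int M - int R))"
  shows "bailey_sum (\<lambda>a b. w a b * q powi (int j * half_norm a b)) (int n) (int T) =
    (\<Sum>R\<le>n. \<Sum>M\<le>2 * R. iqfac (int n - int R) * q powi qform R M * chain_sum V j R M * iqfac (int T) * iqfac (int T + int M - int R))"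
proof (induction j arbitrary: n T)
  case 0 show ?case using assms by simp
next
  case (Suc j)
  have "(\<lambda>a b. w a b * q powi (int (Suc j) * half_norm a b)) = (\<lambda>a b. w a b * q powi (int j * half_norm a b) * q powi half_norm a b)"
    by (simp add: fun_eq_iff mult.assoc distrib_right add.commute flip: powi_add)
  hence "bailey_sum (\<lambda>a b. w a b * q powi (int (Suc j) * half_norm a b)) (int n) (int T) =
    (\<Sum>R\<le>n. \<Sum>S\<le>T. q powi qform R S * iqfac (int n - int R) * iqfac (int T - int S) *
     (\<Sum>R'\<le>R. \<Sum>M'\<le>2 * R'. iqfac (int R - int R') * q powi qform R' M' * chain_sum V j R' M' * iqfac (int S) * iqfac (int S + int M' - int R')))"
    by (simp only: bailey_sum_iterate_nat Suc.IH)
  also have "\<dots> = (\<Sum>R\<le>n. \<Sum>M\<le>2 * R. iqfac (int n - int R) * q powi qform R M * chain_sum V (Suc j) R M * iqfac (int T) * iqfac (int T + int M - int R))"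
  proof (rule sum.cong[OF refl])
    fix R
    define c where "c R' M' = iqfac (int n - int R) * (iqfac (int R - int R') * q powi qform R' M' * chain_sum V j R' M')" for R' M'
    have "(\<Sum>S\<le>T. q powi qform R S * iqfac (int n - int R) * iqfac (int T - int S) *
     (\<Sum>R'\<le>R. \<Sum>M'\<le>2 * R'. iqfac (int R - int R') * q powi qform R' M' * chain_sum V j R' M' * iqfac (int S) * iqfac (int S + int M' - int R'))) =
      (\<Sum>S\<le>T. \<Sum>R'\<le>R. \<Sum>M'\<le>2 * R'. c R' M' * (q powi qform R S * iqfac (int T - int S) * iqfac (int S) * iqfac (int S + int M' - int R')))"
      unfolding sum_distrib_left c_def by (simp only: mult_ac)
    also have "\<dots> = (\<Sum>R'\<le>R. \<Sum>M'\<le>2 * R'. \<Sum>S\<le>T. c R' M' * (q powi qform R S * iqfac (int T - int S) * iqfac (int S) * iqfac (int S + int M' - int R')))"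
      by (subst sum.swap) (rule sum.cong[OF refl], rule sum.swap)
    also have "\<dots> = (\<Sum>R'\<le>R. \<Sum>M'\<le>2 * R'. c R' M' * (\<Sum>M\<le>2 * R. q powi qform R M * gbin (R - R' + M') M * iqfac (int T) * iqfac (int T + int M - int R)))"
    proof (intro sum.cong refl)
      fix R' M' assume "R' \<in> {..R}" "M' \<in> {..2 * R'}"
      hence U: "R - R' + M' \<le> 2 * R" and e: "int S + int M' - int R' = int S + int (R - R' + M') - int R" for S
        by auto
      show "(\<Sum>S\<le>T. c R' M' * (q powi qform R S * iqfac (int T - int S) * iqfac (int S) * iqfac (int S + int M' - int R'))) =
        c R' M' * (\<Sum>M\<le>2 * R. q powi qform R M * gbin (R - R' + M') M * iqfac (int T) * iqfac (int T + int M - int R))"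
        unfolding sum_distrib_left[symmetric] e chain_step[OF U] ..
    qed
    also have "\<dots> = (\<Sum>R'\<le>R. \<Sum>M\<le>2 * R. \<Sum>M'\<le>2 * R'. c R' M' * (q powi qform R M * gbin (R - R' + M') M * iqfac (int T) * iqfac (int T + int M - int R)))"
      unfolding sum_distrib_left by (rule sum.cong[OF refl], rule sum.swap)
    also have "\<dots> = (\<Sum>M\<le>2 * R. \<Sum>R'\<le>R. \<Sum>M'\<le>2 * R'. c R' M' * (q powi qform R M * gbin (R - R' + M') M * iqfac (int T) * iqfac (int T + int M - int R)))"
      by (rule sum.swap)
    also have "\<dots> = (\<Sum>M\<le>2 * R. iqfac (int n - int R) * q powi qform R M * chain_sum V (Suc j) R M * iqfac (int T) * iqfac (int T + int M - int R))"
      unfolding chain_sum.simps c_def sum_distrib_left sum_distrib_right by (intro sum.cong refl) (simp only: mult_ac)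
    finally show "(\<Sum>S\<le>T. q powi qform R S * iqfac (int n - int R) * iqfac (int T - int S) *
     (\<Sum>R'\<le>R. \<Sum>M'\<le>2 * R'. iqfac (int R - int R') * q powi qform R' M' * chain_sum V j R' M' * iqfac (int S) * iqfac (int S + int M' - int R'))) =
     (\<Sum>M\<le>2 * R. iqfac (int n - int R) * q powi qform R M * chain_sum V (Suc j) R M * iqfac (int T) * iqfac (int T + int M - int R))" .
  qed
  finally show ?case .
qed

lemma chain_sum_support:
  assumes "\<And>n m. m > 2 * n \<Longrightarrow> V n m = 0" "m > 2 * n"
  shows "chain_sum V j n m = 0"
  using assms(2)
proof (cases j)
  case (Suc i)
  have "gbin (n - R + M) m = 0" if "R \<le> n" "M \<le> 2 * R" for R M
    using assms(2) that by (intro gbin_eq_0) auto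
  thus ?thesis using Suc by (auto intro!: sum.neutral)
qed (use assms in auto)

definition seed_a_weight :: "int \<Rightarrow> int \<Rightarrow> 'a" where "seed_a_weight a b = chi3 (a - b) * q powi (4 * cas a b + 2 - 2 * a - b)"
definition seed_b_weight :: "int \<Rightarrow> int \<Rightarrow> 'a" where "seed_b_weight a b = chi3 (a - b) * q powi (2 * cas a b + 2 - 2 * a - b)"

lemma bailey_sum_a: "bailey_sum seed_a_weight (int n) (int m) = iqfac (int n) * iqfac (int m) * iqfac (int n + int m)"
  unfolding bailey_sum_def seed_a_weight_def seed_a by simp

lemma bailey_sum_b: "bailey_sum seed_b_weight (int n) (int m) = q powi (2 * int n * int m) * (iqfac (int n) * iqfac (int m) * iqfac (int n + int m))"
  unfolding bailey_sum_def seed_b_weight_def seed_b by simp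

definition start_a :: "nat \<Rightarrow> nat \<Rightarrow> 'a" where "start_a n m = iqfac (int n) * gbin (2 * n) m"
definition start_b :: "nat \<Rightarrow> nat \<Rightarrow> 'a" where
  "start_b n m = (\<Sum>r\<le>n. q ^ (r\<^sup>2) * iqfac (int n - int r) * iqfac (int r) * gbin (n + r) m)"

text \<open>The factor 1/(q)_(R+S) of the seed is \<open>iqfac (S + U - R)\<close> with U = 2 R,
  which produces the q-binomial with top entry 2 n_(k-1).\<close>

lemma bailey_sum_a_1:
  "bailey_sum (\<lambda>a b. seed_a_weight a b * q powi half_norm a b) (int n) (int T) = (\<Sum>R\<le>n. \<Sum>M\<le>2 * R. iqfac (int n - int R) * q powi qform R M * start_a R M *
     iqfac (int T) * iqfac (int T + int M - int R))"
  unfolding bailey_sum_iterate_nat bailey_sum_a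
proof (rule sum.cong[OF refl])
  fix R
  have "(\<Sum>S\<le>T. q powi qform R S * iqfac (int n - int R) * iqfac (int T - int S) * (iqfac (int R) * iqfac (int S) * iqfac (int R + int S))) =
    iqfac (int n - int R) * iqfac (int R) * (\<Sum>S\<le>T. q powi qform R S * iqfac (int T - int S) * iqfac (int S) * iqfac (int S + int (2 * R) - int R))"
    unfolding sum_distrib_left by (intro sum.cong refl) (simp add: add.commute mult_ac)
  also have "\<dots> = (\<Sum>M\<le>2 * R. iqfac (int n - int R) * q powi qform R M * start_a R M * iqfac (int T) * iqfac (int T + int M - int R))"
    unfolding chain_step[OF order.refl] sum_distrib_left start_a_def by (simp only: mult_ac)
  finally show "(\<Sum>S\<le>T. q powi qform R S * iqfac (int n - int R) * iqfac (int T - int S) * (iqfac (int R) * iqfac (int S) * iqfac (int R + int S))) =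
    (\<Sum>M\<le>2 * R. iqfac (int n - int R) * q powi qform R M * start_a R M * iqfac (int T) * iqfac (int T + int M - int R))" .
qed

text \<open>The factor q^(2rs) turns the exponent into r^2 + s (s + r), so the sum over s is the
  summable case \<open>heine_0\<close>; the first step leaves a single sum without a
  q-binomial.\<close>

lemma bailey_sum_b_1:
  "bailey_sum (\<lambda>a b. seed_b_weight a b * q powi half_norm a b) (int n) (int T) =
   (\<Sum>r\<le>n. q ^ (r\<^sup>2) * iqfac (int n - int r) * iqfac (int r) * iqfac (int T) * iqfac (int T + int r))"
  unfolding bailey_sum_iterate_nat bailey_sum_b
proof (rule sum.cong[OF refl])
  fix r
  have Q: "q powi qform r s * q powi (2 * int r * int s) = q ^ (r\<^sup>2) * q powi (int s * (int s - (- int r)))" for s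
  proof -
    have "q ^ (r\<^sup>2) = q powi ((int r)\<^sup>2)" by (metis of_nat_power power_int_of_nat)
    thus ?thesis by (simp add: qform_def algebra_simps power2_eq_square flip: powi_add)
  qed
  have "(\<Sum>s\<le>T. q powi qform r s * iqfac (int n - int r) * iqfac (int T - int s) *
     (q powi (2 * int r * int s) * (iqfac (int r) * iqfac (int s) * iqfac (int r + int s)))) =
     (\<Sum>s\<le>T. (q powi qform r s * q powi (2 * int r * int s)) * (iqfac (int n - int r) * iqfac (int T - int s) *
     ((iqfac (int r) * iqfac (int s) * iqfac (int s + 0 - (- int r))))))"
    by (intro sum.cong refl) (simp add: add.commute mult_ac)
  also have "\<dots> = q ^ (r\<^sup>2) * iqfac (int n - int r) * iqfac (int r) * heine (- int r) (int T) 0"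
    unfolding Q heine_nat sum_distrib_left by (simp only: mult_ac)
  also have "\<dots> = q ^ (r\<^sup>2) * iqfac (int n - int r) * iqfac (int r) * iqfac (int T) * iqfac (int T + int r)"
    unfolding heine_0 by simp
  finally show "(\<Sum>s\<le>T. q powi qform r s * iqfac (int n - int r) * iqfac (int T - int s) *
     (q powi (2 * int r * int s) * (iqfac (int r) * iqfac (int s) * iqfac (int r + int s)))) =
     q ^ (r\<^sup>2) * iqfac (int n - int r) * iqfac (int r) * iqfac (int T) * iqfac (int T + int r)" .
qed

text \<open>A second step gives the shape that \<open>bailey_sum_chain\<close> asks for, now with U
  = R + r. With r = n_k this is n_(k-1) - n_k + m_k for m_k = 2 n_k.\<close>

lemma bailey_sum_b_2:
  "bailey_sum (\<lambda>a b. seed_b_weight a b * q powi half_norm a b * q powi half_norm a b) (int n) (int T) = (\<Sum>R\<le>n. \<Sum>M\<le>2 * R. iqfac (int n - int R) * q powi qform R M * start_b R M *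
     iqfac (int T) * iqfac (int T + int M - int R))"
  unfolding bailey_sum_iterate_nat[of "\<lambda>a b. seed_b_weight a b * q powi half_norm a b"] bailey_sum_b_1
proof (rule sum.cong[OF refl])
  fix R
  define c where "c r = q ^ (r\<^sup>2) * iqfac (int R - int r) * iqfac (int r)" for r
  have "(\<Sum>S\<le>T. q powi qform R S * iqfac (int n - int R) * iqfac (int T - int S) *
      (\<Sum>r\<le>R. q ^ (r\<^sup>2) * iqfac (int R - int r) * iqfac (int r) * iqfac (int S) * iqfac (int S + int r))) =
    (\<Sum>S\<le>T. \<Sum>r\<le>R. iqfac (int n - int R) * c r * (q powi qform R S * iqfac (int T - int S) * iqfac (int S) * iqfac (int S + int (R + r) - int R)))"
    unfolding sum_distrib_left c_def by (intro sum.cong refl) (simp add: mult_ac)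
  also have "\<dots> = (\<Sum>r\<le>R. iqfac (int n - int R) * c r * (\<Sum>S\<le>T. (q powi qform R S * iqfac (int T - int S) * iqfac (int S) * iqfac (int S + int (R + r) - int R))))"
    unfolding sum_distrib_left by (rule sum.swap)
  also have "\<dots> = (\<Sum>r\<le>R. iqfac (int n - int R) * c r * (\<Sum>M\<le>2 * R. q powi qform R M * gbin (R + r) M * iqfac (int T) * iqfac (int T + int M - int R)))"
    by (intro sum.cong refl, subst chain_step) auto
  also have "\<dots> = (\<Sum>M\<le>2 * R. \<Sum>r\<le>R. iqfac (int n - int R) * c r * (q powi qform R M * gbin (R + r) M * iqfac (int T) * iqfac (int T + int M - int R)))"
    unfolding sum_distrib_left by (rule sum.swap)
  also have "\<dots> = (\<Sum>M\<le>2 * R. iqfac (int n - int R) * q powi qform R M * start_b R M * iqfac (int T) * iqfac (int T + int M - int R))"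
    unfolding start_b_def sum_distrib_left sum_distrib_right c_def by (simp only: mult_ac)
  finally show "(\<Sum>S\<le>T. q powi qform R S * iqfac (int n - int R) * iqfac (int T - int S) *
      (\<Sum>r\<le>R. q ^ (r\<^sup>2) * iqfac (int R - int r) * iqfac (int r) * iqfac (int S) * iqfac (int S + int r))) =
    (\<Sum>M\<le>2 * R. iqfac (int n - int R) * q powi qform R M * start_b R M * iqfac (int T) * iqfac (int T + int M - int R))" .
qed

end

section \<open>Infinite sums of formal power series\<close>

text \<open>Summability of power series means that each coefficient receives only finitely many
  nonzero contributions, so every coefficient of the sum is a finite sum over any large enough
  finite set.\<close>

lemma has_sum_fps_nth_superset:
  fixes F :: "'a \<Rightarrow> 'b::ab_group_add fps"
  assumes "(F has_sum S) A" "finite B" "B \<subseteq> A" "{x\<in>A. fps_nth (F x) n \<noteq> 0} \<subseteq> B"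
  shows "fps_nth S n = (\<Sum>x\<in>B. fps_nth (F x) n)"
  unfolding has_sum_fpsD(2)[OF assms(1), of n]
  by (rule sum.mono_neutral_left) (use assms in auto)

lemma has_sum_fpsI_superset:
  fixes F :: "'a \<Rightarrow> 'b::ab_group_add fps"
  assumes "\<And>n. finite (B n)" "\<And>n. B n \<subseteq> A" "\<And>n. {x\<in>A. fps_nth (F x) n \<noteq> 0} \<subseteq> B n"
    "\<And>n. fps_nth S n = (\<Sum>x\<in>B n. fps_nth (F x) n)"
  shows "(F has_sum S) A"
proof (rule has_sum_fpsI)
  fix n
  show "finite {x \<in> A. fps_nth (F x) n \<noteq> 0}" by (rule finite_subset[OF assms(3,1)])
  show "fps_nth S n = (\<Sum>x | x \<in> A \<and> fps_nth (F x) n \<noteq> 0. fps_nth (F x) n)"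
    unfolding assms(4) by (rule sum.mono_neutral_right) (use assms(1-3) in auto)
qed

lemma fps_locally_finite_has_sum:
  fixes F :: "'a \<Rightarrow> 'b::ab_group_add fps"
  assumes "\<And>n. finite {x\<in>A. fps_nth (F x) n \<noteq> 0}"
  obtains S where "(F has_sum S) A"
  using has_sum_fpsI[OF assms, of "Abs_fps (\<lambda>n. \<Sum>x | x \<in> A \<and> fps_nth (F x) n \<noteq> 0. fps_nth (F x) n)"]
  by simp

lemma fps_nth_power_X_mult_eq_0: "k < e \<Longrightarrow> fps_nth (fps_X ^ e * f) k = 0"
  for f :: "'a::comm_ring_1 fps"
  by (simp add: fps_X_power_mult_nth)

lemma fps_dominated_has_sum:
  fixes F :: "'a \<Rightarrow> 'b::ab_group_add fps"
  assumes "\<And>k. finite {x\<in>A. E x \<le> k}" "\<And>x k. x \<in> A \<Longrightarrow> k < E x \<Longrightarrow> fps_nth (F x) k = 0"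
  obtains S where "(F has_sum S) A"
proof (rule fps_locally_finite_has_sum)
  fix n
  show "finite {x\<in>A. fps_nth (F x) n \<noteq> 0}"
    by (rule finite_subset[OF _ assms(1)[of n]]) (use assms(2) in \<open>force simp: not_less[symmetric]\<close>)
qed

lemma has_sum_fps_unique: "(F has_sum S) A \<Longrightarrow> (F has_sum T) A \<Longrightarrow> S = T"
  for F :: "'a \<Rightarrow> 'b::ab_group_add fps"
  by (drule infsumI, drule infsumI) simp

lemma has_sum_fps_mult:
  fixes F :: "'a \<Rightarrow> 'c::comm_ring_1 fps" and G :: "'b \<Rightarrow> 'c fps"
  assumes "(F has_sum S) A" "(G has_sum T) B"
  shows "((\<lambda>(a, b). F a * G b) has_sum S * T) (A \<times> B)"
proof -
  define A' where "A' n = (\<Union>k\<le>n. {x\<in>A. fps_nth (F x) k \<noteq> 0})" for n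
  define B' where "B' n = (\<Union>k\<le>n. {x\<in>B. fps_nth (G x) k \<noteq> 0})" for n
  show ?thesis
  proof (rule has_sum_fpsI_superset[of "\<lambda>n. A' n \<times> B' n"])
    fix n
    have fin: "finite (A' n)" "finite (B' n)"
      unfolding A'_def B'_def using has_sum_fpsD(1)[OF assms(1)] has_sum_fpsD(1)[OF assms(2)] by auto
    thus "finite (A' n \<times> B' n)" by simp
    show "A' n \<times> B' n \<subseteq> A \<times> B" by (auto simp: A'_def B'_def)
    show "{x \<in> A \<times> B. fps_nth (case x of (a, b) \<Rightarrow> F a * G b) n \<noteq> 0} \<subseteq> A' n \<times> B' n"
    proof safe
      fix a b assume ab: "a \<in> A" "b \<in> B" "fps_nth (F a * G b) n \<noteq> 0"
      then obtain i where "i \<le> n" "fps_nth (F a) i * fps_nth (G b) (n - i) \<noteq> 0"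
        unfolding fps_mult_nth by (auto elim!: sum.not_neutral_contains_not_neutral)
      hence "i \<le> n" "n - i \<le> n" "fps_nth (F a) i \<noteq> 0" "fps_nth (G b) (n - i) \<noteq> 0" by auto
      thus "a \<in> A' n" "b \<in> B' n" using ab(1,2) unfolding A'_def B'_def by blast+
    qed
    have S: "fps_nth S i = (\<Sum>a\<in>A' n. fps_nth (F a) i)" and T: "fps_nth T i = (\<Sum>b\<in>B' n. fps_nth (G b) i)"
      if "i \<le> n" for i
      by (rule has_sum_fps_nth_superset[OF assms(1)] has_sum_fps_nth_superset[OF assms(2)]; use fin that in \<open>auto simp: A'_def B'_def\<close>)+
    have "fps_nth (S * T) n = (\<Sum>i=0..n. (\<Sum>a\<in>A' n. fps_nth (F a) i) * (\<Sum>b\<in>B' n. fps_nth (G b) (n - i)))"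
      unfolding fps_mult_nth by (rule sum.cong) (auto simp: S T)
    also have "\<dots> = (\<Sum>i=0..n. \<Sum>x\<in>A' n \<times> B' n. fps_nth (F (fst x)) i * fps_nth (G (snd x)) (n - i))"
      by (simp add: sum_product sum.cartesian_product case_prod_unfold)
    also have "\<dots> = (\<Sum>x\<in>A' n \<times> B' n. fps_nth (F (fst x) * G (snd x)) n)"
      unfolding fps_mult_nth by (rule sum.swap)
    finally show "fps_nth (S * T) n = (\<Sum>x\<in>A' n \<times> B' n. fps_nth (case x of (a, b) \<Rightarrow> F a * G b) n)"
      by (simp add: case_prod_unfold)
  qed
qed

lemma has_sum_fps_cmult:
  fixes F :: "'a \<Rightarrow> 'c::comm_ring_1 fps"
  assumes "(F has_sum S) A"
  shows "((\<lambda>x. c * F x) has_sum c * S) A"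
proof -
  have "((\<lambda>_. c) has_sum c) {()}" using has_sum_finite[of "{()}" "\<lambda>_. c"] by simp
  from has_sum_fps_mult[OF this assms]
  have "((\<lambda>(a, b). c * F b) has_sum c * S) ({()} \<times> A)" .
  moreover have "bij_betw (Pair ()) A ({()} \<times> A)" by (rule bij_betwI[of _ _ _ snd]) auto
  ultimately show ?thesis
    using has_sum_reindex_bij_betw[of "Pair ()" A "{()} \<times> A" "\<lambda>(a, b). c * F b"] by simp
qed

lemma has_sum_fps_Sigma:
  fixes F :: "'a \<times> 'b \<Rightarrow> 'c::ab_group_add fps"
  assumes "(F has_sum S) (A \<times> B)" "\<And>a. a \<in> A \<Longrightarrow> ((\<lambda>b. F (a, b)) has_sum G a) B"
  shows "(G has_sum S) A"
proof -
  define Z where "Z n = {x\<in>A \<times> B. fps_nth (F x) n \<noteq> 0}" for n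
  have fin: "finite (Z n)" for n unfolding Z_def by (rule has_sum_fpsD(1)[OF assms(1)])
  have G: "fps_nth (G a) n = (\<Sum>b\<in>snd ` Z n. fps_nth (F (a, b)) n)" if "a \<in> A" for a n
    by (rule has_sum_fps_nth_superset[OF assms(2)]) (use fin that in \<open>force simp: Z_def\<close>)+
  show ?thesis
  proof (rule has_sum_fpsI_superset[of "\<lambda>n. fst ` Z n"])
    fix n
    show "finite (fst ` Z n)" using fin by simp
    show "fst ` Z n \<subseteq> A" by (auto simp: Z_def)
    show "{x \<in> A. fps_nth (G x) n \<noteq> 0} \<subseteq> fst ` Z n"
    proof safe
      fix a assume a: "a \<in> A" "fps_nth (G a) n \<noteq> 0"
      then obtain b where "b \<in> snd ` Z n" "fps_nth (F (a, b)) n \<noteq> 0"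
        unfolding G[OF a(1)] by (auto elim!: sum.not_neutral_contains_not_neutral)
      hence "(a, b) \<in> Z n" using a by (auto simp: Z_def)
      thus "a \<in> fst ` Z n" by force
    qed
    have "fps_nth S n = (\<Sum>x\<in>fst ` Z n \<times> snd ` Z n. fps_nth (F x) n)"
      by (rule has_sum_fps_nth_superset[OF assms(1)]) (use fin in \<open>force simp: Z_def\<close>)+
    also have "\<dots> = (\<Sum>a\<in>fst ` Z n. \<Sum>b\<in>snd ` Z n. fps_nth (F (a, b)) n)"
      by (simp add: sum.cartesian_product)
    also have "\<dots> = (\<Sum>a\<in>fst ` Z n. fps_nth (G a) n)"
      by (rule sum.cong) (auto simp: G Z_def)
    finally show "fps_nth S n = (\<Sum>a\<in>fst ` Z n. fps_nth (G a) n)" .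
  qed
qed

text \<open>Dominated convergence: coefficient k involves only the finitely many x with E x <= k,
  whatever n is, and at each of these x the coefficient is eventually equal to its limit.\<close>

lemma fps_tannery:
  fixes F :: "nat \<Rightarrow> 'a \<Rightarrow> 'c::ab_group_add fps"
  assumes fin: "\<And>k. finite {x\<in>A. E x \<le> k}"
    and dom: "\<And>n x k. x \<in> A \<Longrightarrow> k < E x \<Longrightarrow> fps_nth (F n x) k = 0"
    and lim: "\<And>x. x \<in> A \<Longrightarrow> (\<lambda>n. F n x) \<longlonglongrightarrow> L x"
    and sums: "\<And>n. (F n has_sum S n) A"
  obtains T where "(L has_sum T) A" "S \<longlonglongrightarrow> T"
proof -
  have L0: "fps_nth (L x) k = 0" if "x \<in> A" "k < E x" for x k
  proof -
    have "eventually (\<lambda>n. fps_nth (F n x) k = fps_nth (L x) k) sequentially"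
      using lim[OF that(1)] by (simp add: tendsto_fps_iff)
    hence "eventually (\<lambda>n. 0 = fps_nth (L x) k) sequentially"
      by eventually_elim (use dom that in auto)
    thus ?thesis by simp
  qed
  obtain T where T: "(L has_sum T) A" by (rule fps_dominated_has_sum[OF fin L0])
  have "S \<longlonglongrightarrow> T"
  proof (rule tendsto_fpsI)
    fix k
    have "eventually (\<lambda>n. \<forall>x\<in>{x\<in>A. E x \<le> k}. fps_nth (F n x) k = fps_nth (L x) k) sequentially"
      by (subst eventually_ball_finite_distrib) (use fin lim in \<open>auto simp: tendsto_fps_iff\<close>)
    thus "eventually (\<lambda>n. fps_nth (S n) k = fps_nth T k) sequentially"
    proof eventually_elim
      case (elim n)
      have "fps_nth (S n) k = (\<Sum>x\<in>{x\<in>A. E x \<le> k}. fps_nth (F n x) k)"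
        by (rule has_sum_fps_nth_superset[OF sums]) (use fin dom in \<open>force simp: not_less[symmetric]\<close>)+
      also have "\<dots> = (\<Sum>x\<in>{x\<in>A. E x \<le> k}. fps_nth (L x) k)" using elim by simp
      also have "\<dots> = fps_nth T k"
        by (rule has_sum_fps_nth_superset[OF T, symmetric]) (use fin L0 in \<open>force simp: not_less[symmetric]\<close>)+
      finally show ?case .
    qed
  qed
  with T show ?thesis by (rule that)
qed

lemma tendsto_mult_fps:
  fixes f g :: "'i \<Rightarrow> 'a::comm_ring_1 fps"
  assumes "(f \<longlongrightarrow> a) F" "(g \<longlongrightarrow> b) F"
  shows "((\<lambda>x. f x * g x) \<longlongrightarrow> a * b) F"
proof (rule tendsto_fpsI)
  fix n
  have "eventually (\<lambda>x. \<forall>k\<in>{..n}. fps_nth (f x) k = fps_nth a k) F"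
    "eventually (\<lambda>x. \<forall>k\<in>{..n}. fps_nth (g x) k = fps_nth b k) F"
    by (subst eventually_ball_finite_distrib; use assms in \<open>simp add: tendsto_fps_iff\<close>)+
  thus "eventually (\<lambda>x. fps_nth (f x * g x) n = fps_nth (a * b) n) F"
    by eventually_elim (auto simp: fps_mult_nth intro!: sum.cong)
qed


section \<open>Convergence of the infinite q-products\<close>

lemma qpoch_Suc: "qpoch a p (Suc n) = qpoch a p n * (1 - a * p ^ n)"
  by (simp add: qpoch_def)

lemma qpoch_nth_0 [simp]: "s > 0 \<Longrightarrow> fps_nth (qpoch (fps_X ^ s) p n) 0 = 1"
  by (induction n) (simp_all add: qpoch_Suc qpoch_def)

lemma qpoch_nth_stable:
  assumes "s > 0" "K > 0" "k \<le> n" "n \<le> n'"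
  shows "fps_nth (qpoch (fps_X ^ s) (fps_X ^ K) n') k = fps_nth (qpoch (fps_X ^ s) (fps_X ^ K) n) k"
  using assms(4)
proof (induction n' rule: dec_induct)
  case (step m)
  have "qpoch (fps_X ^ s) (fps_X ^ K) (Suc m) = qpoch (fps_X ^ s) (fps_X ^ K) m -
     fps_X ^ (s + K * m) * qpoch (fps_X ^ s) (fps_X ^ K) m"
    by (simp add: qpoch_Suc algebra_simps power_add power_mult)
  moreover have "k < s + K * m"
  proof -
    have "m \<le> K * m" using assms(2) by simp
    thus ?thesis using assms(1,3) step.hyps by linarith
  qed
  ultimately show ?case using step.IH by (simp add: fps_X_power_mult_nth)
qed simp

lemma qpoch_tendsto:
  assumes "s > 0" "K > 0"
  shows "(\<lambda>n. qpoch (fps_X ^ s) (fps_X ^ K) n) \<longlonglongrightarrow> qpoch_inf (fps_X ^ s) (fps_X ^ K)"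
    and "fps_nth (qpoch_inf (fps_X ^ s) (fps_X ^ K)) 0 = 1"
proof -
  define L where "L = Abs_fps (\<lambda>k. fps_nth (qpoch (fps_X ^ s) (fps_X ^ K) k) k)"
  have lim: "(\<lambda>n. qpoch (fps_X ^ s) (fps_X ^ K) n) \<longlonglongrightarrow> L"
  proof (rule tendsto_fpsI)
    fix k
    show "eventually (\<lambda>n. fps_nth (qpoch (fps_X ^ s) (fps_X ^ K) n) k = fps_nth L k) sequentially"
      using eventually_ge_at_top[of k]
    proof eventually_elim
      case (elim n)
      from qpoch_nth_stable[OF assms order.refl elim] show ?case by (simp add: L_def)
    qed
  qed
  have L0: "fps_nth L 0 = 1" using assms by (simp add: L_def)
  have "(\<lambda>n. \<Prod>i\<le>n. 1 - fps_X ^ s * (fps_X ^ K) ^ i) \<longlonglongrightarrow> L"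
    using LIMSEQ_Suc[OF lim] by (simp add: qpoch_def lessThan_Suc_atMost)
  \<comment> \<open>\<open>has_prod\<close> demands a nonzero limit; the constant coefficient 1
    provides it.\<close>
  moreover have "L \<noteq> 0" using L0 by auto
  ultimately have "(\<lambda>i. 1 - fps_X ^ s * (fps_X ^ K) ^ i) has_prod L"
    by (simp add: has_prod_def raw_has_prod_def)
  hence "qpoch_inf (fps_X ^ s) (fps_X ^ K) = L"
    unfolding qpoch_inf_def by (rule has_prod_unique[symmetric])
  with lim L0 show "(\<lambda>n. qpoch (fps_X ^ s) (fps_X ^ K) n) \<longlonglongrightarrow> qpoch_inf (fps_X ^ s) (fps_X ^ K)"
    "fps_nth (qpoch_inf (fps_X ^ s) (fps_X ^ K)) 0 = 1" by simp_all
qed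

section \<open>Passage to the limit\<close>

lemma fps_to_fls_sum: "fps_to_fls (\<Sum>x\<in>A. f x) = (\<Sum>x\<in>A. fps_to_fls (f x))"
  for f :: "'i \<Rightarrow> 'a::comm_monoid_add fps"
  by (induction A rule: infinite_finite_induct) simp_all

lemma fps_to_fls_chi3: "fps_to_fls (chi3 d :: complex fps) = chi3 d"
  by (simp add: chi3_def)

lemmas to_fls = fps_to_fls_sum fps_to_fls_chi3 fls_times_fps_to_fls fps_to_fls_power

text \<open>Laurent series form a field with negative powers of q, and \<open>fps_to_fls\<close> is
  injective, so a finite identity whose two sides are power series descends.\<close>

interpretation G: generic_q "fls_X :: complex fls"
proof
  fix n :: nat assume "n > 0"
  have "fps_to_fls (fps_X ^ n :: complex fps) \<noteq> fps_to_fls 1"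
    unfolding fps_to_fls_eq_iff using \<open>n > 0\<close> by (metis fps_X_power_nth fps_one_nth less_numeral_extra(3) one_neq_zero)
  thus "fls_X ^ n \<noteq> (1 :: complex fls)" by (simp add: fps_to_fls_power)
qed simp

abbreviation "xfac n \<equiv> qpoch fps_X fps_X n"

definition ixfac :: "int \<Rightarrow> complex fps" where
  "ixfac k = (if k < 0 then 0 else inverse (xfac (nat k)))"

lemma xfac_nth_0 [simp]: "fps_nth (xfac n) 0 = 1"
  using qpoch_nth_0[of 1 fps_X n] by simp

lemma xfac_fls: "fps_to_fls (xfac n) = G.qfac n"
  by (induction n) (simp_all add: qpoch_Suc G.qfac_def qpoch_def to_fls)

lemma ixfac_fls: "fps_to_fls (ixfac k) = G.iqfac k"
proof (cases "k < 0")
  case False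
  have "subdegree (xfac (nat k)) = 0" by (simp add: subdegree_eq_0_iff)
  thus ?thesis using False
    by (simp add: ixfac_def G.iqfac_def fls_inverse_fps_to_fls[symmetric] xfac_fls field_simps)
qed (simp add: ixfac_def)

lemma qbinom_fls: "fps_to_fls (qbinom (int n) (int m)) = G.gbin n m"
proof (cases "m \<le> n")
  case True
  have "qbinom (int n) (int m) = xfac n * (ixfac (int m) * ixfac (int n - int m))"
    using True by (simp add: qbinom_def ixfac_def fps_divide_unit fps_inverse_mult)
  thus ?thesis by (simp add: to_fls xfac_fls ixfac_fls G.gbin_def)
qed (simp add: qbinom_def G.gbin_def)

lemma int_quad_form: "int (quad_form n m) = G.qform n m"
proof -
  have "4 * ((int n)\<^sup>2 - int n * int m + (int m)\<^sup>2) = (2 * int n - int m)\<^sup>2 + 3 * (int m)\<^sup>2"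
    by (simp add: algebra_simps power2_eq_square)
  also have "\<dots> \<ge> 0" by simp
  finally show ?thesis by (simp add: quad_form_def G.qform_def)
qed

lemma quad_form_fls: "fps_to_fls (fps_X ^ quad_form n m) = fls_X powi G.qform n m"
  unfolding int_quad_form[symmetric] by (simp add: fps_to_fls_power)

lemma powi_fls: "k \<ge> 0 \<Longrightarrow> fps_to_fls (fps_X ^ nat k) = fls_X powi k"
  by (simp add: fps_to_fls_power power_int_def)

text \<open>For m >= 1 use n^2 - nm + m^2 = n + (n - m)^2 + n (m - 1). The bounds leave finitely
  many index pairs below any given exponent.\<close>

lemma quad_form_ge: "n \<le> quad_form n m" "m \<le> quad_form n m"
proof -
  have *: "n \<le> quad_form n m" for n m
  proof (cases "m = 0")
    case True
    have "quad_form n 0 = n\<^sup>2" by (simp add: quad_form_def nat_power_eq)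
    thus ?thesis using True by (simp add: power2_nat_le_imp_le)
  next
    case False
    have "(int n - int m)\<^sup>2 + int n * (int m - 1) \<ge> 0" using False by simp
    hence "int n \<le> int (quad_form n m)"
      unfolding int_quad_form G.qform_def by (simp add: algebra_simps power2_eq_square) 
    thus ?thesis by simp
  qed
  have "quad_form n m = quad_form m n" by (simp add: quad_form_def algebra_simps)
  thus "n \<le> quad_form n m" "m \<le> quad_form n m" using *[of n m] *[of m n] by simp_all
qed

lemma finite_quad_form: "finite {x. quad_form (fst x) (snd x) \<le> k}"
proof (rule finite_subset)
  show "{x. quad_form (fst x) (snd x) \<le> k} \<subseteq> {..k} \<times> {..k}"
  proof (rule subsetI)
    fix x assume "x \<in> {x. quad_form (fst x) (snd x) \<le> k}"
    with quad_form_ge(1)[of "fst x" "snd x"] quad_form_ge(2)[of "snd x" "fst x"]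
    show "x \<in> {..k} \<times> {..k}" by (simp add: mem_Times_iff)
  qed
qed simp

definition xPsi :: "int \<Rightarrow> int \<Rightarrow> int \<Rightarrow> int \<Rightarrow> int \<Rightarrow> complex fps" where
  "xPsi n m y1 y2 y3 = xfac (nat (n + m)) *
     (ixfac (n - y1) * ixfac (n - y2) * ixfac (n - y3) * ixfac (m + y1) * ixfac (m + y2) * ixfac (m + y3))"

lemma xPsi_fls: "fps_to_fls (xPsi n m y1 y2 y3) = G.Psi n m y1 y2 y3"
  by (simp add: xPsi_def G.Psi_def to_fls xfac_fls ixfac_fls)

fun xchain_sum :: "(nat \<Rightarrow> nat \<Rightarrow> complex fps) \<Rightarrow> nat \<Rightarrow> nat \<Rightarrow> nat \<Rightarrow> complex fps" where
  "xchain_sum V 0 n m = V n m"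
| "xchain_sum V (Suc j) n m = (\<Sum>R\<le>n. \<Sum>M\<le>2 * R. ixfac (int n - int R) * fps_X ^ quad_form R M *
     qbinom (int n - int R + int M) (int m) * xchain_sum V j R M)"

lemma xchain_sum_fls:
  assumes "\<And>n m. fps_to_fls (V' n m) = V n m"
  shows "fps_to_fls (xchain_sum V' j n m) = G.chain_sum V j n m"
proof (induction j arbitrary: n m)
  case (Suc j)
  have "fps_to_fls (qbinom (int n - int R + int M) (int m)) = G.gbin (n - R + M) m" if "R \<le> n" for R M
  proof -
    have "int n - int R + int M = int (n - R + M)" using that by simp
    thus ?thesis by (simp only: qbinom_fls)
  qed
  thus ?case by (simp add: to_fls Suc.IH ixfac_fls quad_form_fls flip: fps_to_fls_power)
qed (simp add: assms)

definition xstart_a :: "nat \<Rightarrow> nat \<Rightarrow> complex fps" where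
  "xstart_a n m = ixfac (int n) * qbinom (2 * int n) (int m)"

definition xstart_b :: "nat \<Rightarrow> nat \<Rightarrow> complex fps" where
  "xstart_b n m = (\<Sum>r\<le>n. fps_X ^ (r\<^sup>2) * ixfac (int n - int r) * ixfac (int r) * qbinom (int n + int r) (int m))"

lemma xstart_a_fls: "fps_to_fls (xstart_a n m) = G.start_a n m"
  using qbinom_fls[of "2 * n" m] by (simp add: xstart_a_def G.start_a_def to_fls ixfac_fls)

lemma xstart_b_fls: "fps_to_fls (xstart_b n m) = G.start_b n m"
  using qbinom_fls[of "n + _" m] by (simp add: xstart_b_def G.start_b_def to_fls ixfac_fls)

section \<open>Limits of the two sides of a Bailey sum\<close>

abbreviation "euler \<equiv> qpoch_inf fps_X fps_X"

lemma euler_nth_0 [simp]: "fps_nth euler 0 = 1"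
  using qpoch_tendsto(2)[of 1 1] by simp

lemma xfac_tendsto: "xfac \<longlonglongrightarrow> euler"
  using qpoch_tendsto(1)[of 1 1] by simp

lemma ixfac_tendsto: "(\<lambda>n. ixfac (int n + c)) \<longlonglongrightarrow> inverse euler"
proof -
  have *: "(\<lambda>n. inverse (xfac n)) \<longlonglongrightarrow> inverse euler"
    by (rule tendsto_inverse_fps[OF xfac_tendsto]) simp
  have lim: "filterlim (\<lambda>n. nat (int n + c)) at_top sequentially"
    by (rule filterlim_at_top_mono[OF filterlim_minus_const_nat_at_top[of "nat (- c)"]])
       (auto intro!: always_eventually)
  have "(\<lambda>n. inverse (xfac (nat (int n + c)))) \<longlonglongrightarrow> inverse euler"
    by (rule filterlim_compose[OF * lim])
  moreover have "eventually (\<lambda>n. inverse (xfac (nat (int n + c))) = ixfac (int n + c)) sequentially"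
    using eventually_ge_at_top[of "nat (- c)"]
    by eventually_elim (auto simp: ixfac_def)
  ultimately show ?thesis by (rule Lim_transform_eventually)
qed

definition norm_bound :: "int \<Rightarrow> int \<Rightarrow> nat" where "norm_bound a b = nat (G.half_norm a b)"

lemma half_norm_ge: "\<bar>a - 1\<bar> \<le> G.half_norm a b" "\<bar>b\<bar> \<le> G.half_norm a b"
proof -
  have *: "\<bar>x\<bar> \<le> x\<^sup>2 + x * y + y\<^sup>2" for x y :: int
  proof (cases "\<bar>x\<bar> \<ge> 2")
    case True
    define Z where "Z = x\<^sup>2 + x * y + y\<^sup>2"
    have "4 * Z = (2 * y + x)\<^sup>2 + 3 * x\<^sup>2"
      by (simp add: Z_def algebra_simps power2_eq_square)
    moreover have "x\<^sup>2 \<ge> 2 * \<bar>x\<bar>"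
      using mult_right_mono[OF True, of "\<bar>x\<bar>"] by (simp add: power2_eq_square abs_mult_self_eq)
    moreover have "(2 * y + x)\<^sup>2 \<ge> 0" by simp
    ultimately have "\<bar>x\<bar> \<le> Z" by linarith
    thus ?thesis by (simp only: Z_def)
  next
    case False
    hence "x = 0 \<or> x = 1 \<or> x = -1" by auto
    moreover have "(y + 1) * y \<ge> 0" "(y - 1) * y \<ge> 0"
      by (cases "y \<ge> 1"; cases "y \<le> - 1"; simp add: zero_le_mult_iff)+
    ultimately show ?thesis by (auto simp: algebra_simps power2_eq_square)
  qed
  show "\<bar>a - 1\<bar> \<le> G.half_norm a b" using *[of "a - 1" b] by (simp add: G.half_norm_def)
  show "\<bar>b\<bar> \<le> G.half_norm a b" using *[of b "a - 1"] by (simp add: G.half_norm_def algebra_simps)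
qed

lemma finite_norm_bound: "finite {x. norm_bound (fst x) (snd x) \<le> k}"
proof (rule finite_subset)
  show "{x. norm_bound (fst x) (snd x) \<le> k} \<subseteq> {- int k..int k + 2} \<times> {- int k..int k}"
  proof safe
    fix a b assume "norm_bound (fst (a, b)) (snd (a, b)) \<le> k"
    hence "G.half_norm a b \<le> int k" by (simp add: norm_bound_def)
    with half_norm_ge(1)[of a b] half_norm_ge(2)[of b a] show "a \<in> {- int k..int k + 2}" "b \<in> {- int k..int k}" by auto
  qed
qed simp

text \<open>\<open>E\<close> may be negative where \<open>chi3\<close> vanishes; there the
  truncation by \<open>nat\<close> is harmless.\<close>

lemma bailey_sum_fls:
  assumes "\<And>a b. chi3 (a - b) \<noteq> (0 :: complex fls) \<Longrightarrow> E a b \<ge> 0"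
  shows "G.bailey_sum (\<lambda>a b. chi3 (a - b) * fls_X powi E a b) (int n) (int n) =
    fps_to_fls (\<Sum>(a, b)\<in>{-int (2*n+1)..int (2*n+1)} \<times> {-int (2*n+1)..int (2*n+1)}.
      chi3 (a - b) * fps_X ^ nat (E a b) * xPsi (int n) (int n) (a - 1) b (1 - a - b))"
proof -
  have "chi3 (a - b) * (fls_X :: complex fls) powi E a b = fps_to_fls (chi3 (a - b) * fps_X ^ nat (E a b))" for a b
  proof (cases "chi3 (a - b) = (0 :: complex fls)")
    case False
    show ?thesis unfolding fls_times_fps_to_fls fps_to_fls_chi3 powi_fls[OF assms[OF False]] ..
  qed (simp add: to_fls)
  thus ?thesis
    by (subst G.bailey_sum_eq_sum[of _ _ "int (2 * n + 1)"])
       (auto simp: fps_to_fls_sum fls_times_fps_to_fls xPsi_fls[symmetric] case_prod_unfold simp del: of_nat_add intro!: sum.cong)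
qed

lemma chi3_nth_0: "fps_nth (chi3 d * f) k = 0" if "fps_nth f k = 0" for f :: "complex fps"
  using that by (simp add: chi3_def)

text \<open>For fixed y the factor (q)_(2n) and the six reciprocals in \<open>Psi\<close> tend to
  the Euler product and to its inverses; the bound by |y|^2/2 justifies the termwise limit.\<close>

lemma theta_limit:
  assumes "\<And>a b. chi3 (a - b) \<noteq> (0 :: complex fps) \<Longrightarrow> G.half_norm a b \<le> E a b"
    and "((\<lambda>(a, b). chi3 (a - b) * fps_X ^ nat (E a b)) has_sum \<Theta>) UNIV"
  shows "(\<lambda>n. \<Sum>(a, b)\<in>{-int (2*n+1)..int (2*n+1)} \<times> {-int (2*n+1)..int (2*n+1)}.
      chi3 (a - b) * fps_X ^ nat (E a b) * xPsi (int n) (int n) (a - 1) b (1 - a - b))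
    \<longlonglongrightarrow> euler * inverse euler ^ 6 * \<Theta>"
proof -
  define F where "F n = (\<lambda>(a, b). chi3 (a - b) * fps_X ^ nat (E a b) * xPsi (int n) (int n) (a - 1) b (1 - a - b))" for n
  define L where "L = (\<lambda>(a, b). euler * inverse euler ^ 6 * (chi3 (a - b) * fps_X ^ nat (E a b)))"
  define S where "S n = (\<Sum>x\<in>{-int (2*n+1)..int (2*n+1)} \<times> {-int (2*n+1)..int (2*n+1)}. F n x)" for n
  have F0: "F n x = 0" if "x \<notin> {-int (2*n+1)..int (2*n+1)} \<times> {-int (2*n+1)..int (2*n+1)}" for n x
  proof (rule ccontr)
    assume "F n x \<noteq> 0"
    moreover obtain a b where x: "x = (a, b)" by (cases x)
    ultimately have "xPsi (int n) (int n) (a - 1) b (1 - a - b) \<noteq> 0" by (auto simp: F_def)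
    hence "G.Psi (int n) (int n) (a - 1) b (1 - a - b) \<noteq> 0"
      unfolding xPsi_fls[symmetric] by simp
    from G.Psi_nonzeroD[OF this] that show False by (auto simp: x)
  qed
  obtain T where T: "(L has_sum T) UNIV" "S \<longlonglongrightarrow> T"
  proof (rule fps_tannery[of UNIV "\<lambda>x. norm_bound (fst x) (snd x)" F L S])
    show "finite {x \<in> UNIV. norm_bound (fst x) (snd x) \<le> k}" for k using finite_norm_bound by simp
    show "fps_nth (F n x) k = 0" if "k < norm_bound (fst x) (snd x)" for n x k
    proof (cases x)
      case (Pair a b)
      show ?thesis
      proof (cases "chi3 (a - b) = (0 :: complex fps)")
        case False
        have "k < nat (E a b)" using that assms(1)[OF False] Pair by (auto simp: norm_bound_def)
        hence "fps_nth (fps_X ^ nat (E a b) * (xPsi (int n) (int n) (a - 1) b (1 - a - b))) k = 0"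
          by (rule fps_nth_power_X_mult_eq_0)
        from chi3_nth_0[OF this] show ?thesis by (simp add: F_def Pair mult.assoc)
      qed (simp add: F_def Pair)
    qed
    show "(\<lambda>n. F n x) \<longlonglongrightarrow> L x" for x
    proof (cases x)
      case (Pair a b)
      have "filterlim (\<lambda>n::nat. n + n) at_top sequentially"
        by (rule filterlim_at_top_mono[OF filterlim_ident]) simp
      from filterlim_compose[OF xfac_tendsto this]
      have 1: "(\<lambda>n. xfac (nat (int n + int n))) \<longlonglongrightarrow> euler" by (simp only: of_nat_add[symmetric] nat_int)
      have 2: "(\<lambda>n. ixfac (int n - c)) \<longlonglongrightarrow> inverse euler" for c
        using ixfac_tendsto[of "- c"] by simp
      have "(\<lambda>n. chi3 (a - b) * fps_X ^ nat (E a b) * xPsi (int n) (int n) (a - 1) b (1 - a - b)) \<longlonglongrightarrow>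
         chi3 (a - b) * fps_X ^ nat (E a b) * (euler * (inverse euler * inverse euler * inverse euler * inverse euler * inverse euler * inverse euler))"
        unfolding xPsi_def by (intro tendsto_mult_fps tendsto_const 1 2 ixfac_tendsto)
      thus ?thesis by (simp add: F_def L_def Pair mult_ac power_numeral_reduce)
    qed
    show "(F n has_sum S n) UNIV" for n
      by (rule has_sum_finite_neutralI[of "{-int (2*n+1)..int (2*n+1)} \<times> {-int (2*n+1)..int (2*n+1)}"])
         (use F0 in \<open>auto simp: S_def\<close>)
  qed
  have "(L has_sum euler * inverse euler ^ 6 * \<Theta>) UNIV"
    using has_sum_fps_cmult[OF assms(2), of "euler * inverse euler ^ 6"] by (simp add: L_def case_prod_unfold)
  from has_sum_fps_unique[OF T(1) this] have "T = euler * inverse euler ^ 6 * \<Theta>" .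
  with T(2) show ?thesis unfolding S_def F_def by simp
qed

lemma chi3_fls_iff: "chi3 d \<noteq> (0 :: complex fls) \<longleftrightarrow> chi3 d \<noteq> (0 :: complex fps)"
  by (simp add: chi3_def)

text \<open>Both arguments of the Bailey sum are n -> infinity. The side with \<open>c\<close>
  acquires three factors 1/(q)_infinity, the side with y acquires (q)_infinity^(1-6), and the
  quotient is (q)_infinity^-2. Keeping \<open>c\<close> abstract covers both chains and the case k =
  1.\<close>

lemma seed_limit:
  fixes c :: "'x \<Rightarrow> complex fps" and \<alpha> \<beta> :: "'x \<Rightarrow> int"
  assumes fin: "\<And>k. finite {x. e x \<le> (k::nat)}" and dom: "\<And>x k. k < e x \<Longrightarrow> fps_nth (c x) k = 0"
    and B: "\<And>n. finite (B n)" "\<And>n x. x \<notin> B n \<Longrightarrow> ixfac (int n - \<alpha> x) * c x = 0"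
    and id: "\<And>n. G.bailey_sum (\<lambda>a b. chi3 (a - b) * fls_X powi E a b) (int n) (int n) =
      fps_to_fls (\<Sum>x\<in>B n. ixfac (int n - \<alpha> x) * c x * ixfac (int n) * ixfac (int n + \<beta> x))"
    and E: "\<And>a b. chi3 (a - b) \<noteq> (0 :: complex fps) \<Longrightarrow> G.half_norm a b \<le> E a b"
    and \<Theta>: "((\<lambda>(a, b). chi3 (a - b) * fps_X ^ nat (E a b)) has_sum \<Theta>) UNIV"
  shows "(c has_sum \<Theta> / euler\<^sup>2) UNIV"
proof -
  define F where "F n x = ixfac (int n - \<alpha> x) * c x * ixfac (int n) * ixfac (int n + \<beta> x)" for n x
  define L where "L x = inverse euler ^ 3 * c x" for x
  define S where "S n = (\<Sum>x\<in>B n. F n x)" for n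
  have E0: "E a b \<ge> 0" if "chi3 (a - b) \<noteq> (0 :: complex fls)" for a b
    using E[of a b] that half_norm_ge(1)[of a b] unfolding chi3_fls_iff by simp
  have "S = (\<lambda>n. \<Sum>(a, b)\<in>{-int (2*n+1)..int (2*n+1)} \<times> {-int (2*n+1)..int (2*n+1)}.
      chi3 (a - b) * fps_X ^ nat (E a b) * xPsi (int n) (int n) (a - 1) b (1 - a - b))"
  proof
    fix n
    show "S n = (\<Sum>(a, b)\<in>{-int (2*n+1)..int (2*n+1)} \<times> {-int (2*n+1)..int (2*n+1)}.
      chi3 (a - b) * fps_X ^ nat (E a b) * xPsi (int n) (int n) (a - 1) b (1 - a - b))"
      using trans[OF id[of n, symmetric] bailey_sum_fls[of E n, OF E0]]
      unfolding fps_to_fls_eq_iff S_def F_def .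
  qed
  hence S: "S \<longlonglongrightarrow> euler * inverse euler ^ 6 * \<Theta>" using theta_limit[OF E \<Theta>] by simp
  obtain T where T: "(L has_sum T) UNIV" "S \<longlonglongrightarrow> T"
  proof (rule fps_tannery[of UNIV e F L S])
    show "finite {x \<in> UNIV. e x \<le> k}" for k using fin by simp
    show "fps_nth (F n x) k = 0" if "k < e x" for n x k
    proof -
      have "fps_nth (c x * (ixfac (int n - \<alpha> x) * ixfac (int n) * ixfac (int n + \<beta> x))) k = 0"
        unfolding fps_mult_nth by (rule sum.neutral) (use dom that in auto)
      thus ?thesis by (simp add: F_def mult_ac)
    qed
    show "(\<lambda>n. F n x) \<longlonglongrightarrow> L x" for x
    proof -
      have 2: "(\<lambda>n. ixfac (int n - a)) \<longlonglongrightarrow> inverse euler" "(\<lambda>n. ixfac (int n)) \<longlonglongrightarrow> inverse euler" for a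
        using ixfac_tendsto[of "- a"] ixfac_tendsto[of 0] by simp_all
      have "(\<lambda>n. F n x) \<longlonglongrightarrow> inverse euler * c x * inverse euler * inverse euler"
        unfolding F_def by (intro tendsto_mult_fps tendsto_const 2 ixfac_tendsto)
      thus ?thesis by (simp add: L_def mult_ac power_numeral_reduce)
    qed
    show "(F n has_sum S n) UNIV" for n
      by (rule has_sum_finite_neutralI[of "B n"]) (use B in \<open>auto simp: F_def S_def\<close>)
  qed
  have "T = euler * inverse euler ^ 6 * \<Theta>" by (rule LIMSEQ_unique[OF T(2) S])
  with has_sum_fps_cmult[OF T(1), of "euler ^ 3"]
  have "((\<lambda>x. euler ^ 3 * L x) has_sum euler ^ 3 * (euler * inverse euler ^ 6 * \<Theta>)) UNIV" by simp
  moreover have I: "euler * inverse euler = 1" by (simp add: inverse_mult_eq_1')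
  have "euler ^ 3 * (inverse euler ^ 3 * x) = x" for x
    using arg_cong[OF I, of "\<lambda>x. x ^ 3"] by (simp add: power_mult_distrib flip: mult.assoc)
  hence "(\<lambda>x. euler ^ 3 * L x) = c"
    by (auto simp: fun_eq_iff L_def)
  moreover have "euler ^ 3 * (euler * inverse euler ^ 6 * \<Theta>) = \<Theta> / euler\<^sup>2"
  proof -
    have "euler ^ 3 * (euler * inverse euler ^ 6 * \<Theta>) = (euler * inverse euler) ^ 4 * (inverse euler ^ 2 * \<Theta>)"
      by (simp add: power_mult_distrib mult_ac power_numeral_reduce)
    thus ?thesis by (simp add: I fps_divide_unit fps_inverse_power mult.commute)
  qed
  ultimately show ?thesis by simp
qed

lemma xchain_sum_support:
  assumes "\<And>n m. m > 2 * n \<Longrightarrow> V' n m = 0" "M > 2 * R"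
  shows "xchain_sum V' j R M = 0"
proof -
  have "G.chain_sum (\<lambda>n m. fps_to_fls (V' n m)) j R M = 0"
    by (rule G.chain_sum_support[OF _ assms(2)]) (simp add: assms(1))
  thus ?thesis using xchain_sum_fls[of V' "\<lambda>n m. fps_to_fls (V' n m)" j R M] by simp
qed

lemma chain_limit:
  assumes V: "\<And>n m. m > 2 * n \<Longrightarrow> V' n m = 0"
    and fin: "\<And>n T. G.bailey_sum w (int n) (int T) = (\<Sum>R\<le>n. \<Sum>M\<le>2 * R. G.iqfac (int n - int R) * fls_X powi G.qform R M *
     fps_to_fls (V' R M) * G.iqfac (int T) * G.iqfac (int T + int M - int R))"
    and w: "(\<lambda>a b. w a b * fls_X powi (int j * G.half_norm a b)) = (\<lambda>a b. chi3 (a - b) * fls_X powi E a b)"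
    and E: "\<And>a b. chi3 (a - b) \<noteq> (0 :: complex fps) \<Longrightarrow> G.half_norm a b \<le> E a b"
    and \<Theta>: "((\<lambda>(a, b). chi3 (a - b) * fps_X ^ nat (E a b)) has_sum \<Theta>) UNIV"
  shows "((\<lambda>x. fps_X ^ quad_form (fst x) (snd x) * xchain_sum V' j (fst x) (snd x)) has_sum \<Theta> / euler\<^sup>2) UNIV"
proof (rule seed_limit[OF finite_quad_form, of _ "\<lambda>n. Sigma {..n} (\<lambda>R. {..2 * R})" "\<lambda>x. int (fst x)" E "\<lambda>x. int (snd x) - int (fst x)"])
  fix n
  show "G.bailey_sum (\<lambda>a b. chi3 (a - b) * fls_X powi E a b) (int n) (int n) = fps_to_fls
    (\<Sum>x\<in>Sigma {..n} (\<lambda>R. {..2 * R}). ixfac (int n - int (fst x)) * (fps_X ^ quad_form (fst x) (snd x) * xchain_sum V' j (fst x) (snd x)) *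
      ixfac (int n) * ixfac (int n + (int (snd x) - int (fst x))))"
  proof -
    have "(\<Sum>x\<in>Sigma {..n} (\<lambda>R. {..2 * R}). ixfac (int n - int (fst x)) * (fps_X ^ quad_form (fst x) (snd x) * xchain_sum V' j (fst x) (snd x)) *
      ixfac (int n) * ixfac (int n + (int (snd x) - int (fst x)))) =
      (\<Sum>R\<le>n. \<Sum>M\<le>2 * R. ixfac (int n - int R) * fps_X ^ quad_form R M * xchain_sum V' j R M * ixfac (int n) * ixfac (int n + int M - int R))"
      by (subst sum.Sigma) (auto intro!: sum.cong simp: mult.assoc add_diff_eq)
    thus ?thesis
      unfolding w[symmetric] G.bailey_sum_chain[OF fin]
      by (simp only: fps_to_fls_sum fls_times_fps_to_fls ixfac_fls quad_form_fls xchain_sum_fls[of V' "\<lambda>n m. fps_to_fls (V' n m)"])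
  qed
next
  show "ixfac (int n - int (fst x)) * (fps_X ^ quad_form (fst x) (snd x) * xchain_sum V' j (fst x) (snd x)) = 0"
    if "x \<notin> Sigma {..n} (\<lambda>R. {..2 * R})" for n x
    using that xchain_sum_support[of V' "fst x" "snd x" j] V by (cases x) (auto simp: ixfac_def)
qed (use E \<Theta> in \<open>auto simp: fps_nth_power_X_mult_eq_0\<close>)

section \<open>The Jacobi triple product and the $A_2$ Macdonald identity\<close>

definition alt_sign :: "int \<Rightarrow> 'a::ring_1" where "alt_sign i = (if even i then 1 else - 1)"

lemma alt_sign_add: "alt_sign (i + j) = alt_sign i * alt_sign j" by (simp add: alt_sign_def)
lemma alt_sign_neg: "alt_sign (- i) = alt_sign i" by (simp add: alt_sign_def)

context generic_q begin

text \<open>A term of Cauchy's finite form of the triple product; the last factor is the q-binomial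
  [m + n; n + j].\<close>

definition jtp_term :: "'a \<Rightarrow> nat \<Rightarrow> nat \<Rightarrow> int \<Rightarrow> 'a" where
  "jtp_term z m n j = alt_sign j * (q powi tri j * z powi j) * (qfac (m + n) * iqfac (int m - j) * iqfac (int n + j))"

lemma finite_jtp_term: "finite {j. jtp_term z m n j \<noteq> 0}"
  by (rule finite_subset[of _ "{- int n..int m}"]) (auto simp: jtp_term_def)

lemma finite_jtp_term': "finite {j. c * jtp_term z m n (l + j) \<noteq> 0}"
  by (rule finite_subset[of _ "{- int n - l..int m - l}"]) (auto simp: jtp_term_def)

lemma qfac_Suc_int: "qfac (Suc m + n) = qfac (m + n) * (1 - q powi (int m + int n + 1))"
  "qfac (m + Suc n) = qfac (m + n) * (1 - q powi (int m + int n + 1))"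
  by (simp_all add: qfac_Suc)

text \<open>One of the two q-Pascal rules: increasing m by one multiplies the product by 1 - q^m z,
  that is, it subtracts q^m z times a copy shifted by one in j. \<open>jtp_term_Suc2\<close> does
  the same for the factors with 1/z.\<close>

lemma jtp_term_Suc1:
  assumes "z \<noteq> 0"
  shows "jtp_term z (Suc m) n j = jtp_term z m n j + (- (q ^ m * z)) * jtp_term z m n (- 1 + j)"
proof -
  have t: "q powi tri j * z powi j = q powi (j - 1) * z * (q powi tri (j - 1) * z powi (j - 1))"
  proof -
    have "q powi tri j = q powi (j - 1) * q powi tri (j - 1)"
      unfolding powi_add[symmetric] tri_pred[of j] by (simp add: algebra_simps)
    moreover have "z powi j = z * z powi (j - 1)"
      using assms by (simp add: power_int_diff)
    ultimately show ?thesis by (simp add: mult_ac)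
  qed
  have p: "q ^ m = q powi int m" by simp
  have sg1: "alt_sign (- 1 + j) = (- alt_sign j :: 'a)" by (simp add: alt_sign_def)
  have i1: "iqfac (int m - j) = (1 - q powi (int m + 1 - j)) * iqfac (int m + 1 - j)"
    using iqfac_rec[of "int m + 1 - j"] by (simp add: algebra_simps)
  have i2: "iqfac (int n + (- 1 + j)) = (1 - q powi (int n + j)) * iqfac (int n + j)"
    using iqfac_rec[of "int n + j"] by (simp add: algebra_simps)
  have e: "1 - q powi (int m + int n + 1) = (1 - q powi (int m + 1 - j)) + q powi (int m) * q powi (- (j - 1)) * (1 - q powi (int n + j))"
    by (simp add: algebra_simps del: power_int_of_nat flip: powi_add)
  have k: "q powi (- (j - 1)) * q powi (j - 1) = 1" by (simp flip: powi_add)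
  have a: "int (Suc m) - j = int m + 1 - j" "int m - (- 1 + j) = int m + 1 - j" "- 1 + j = j - 1" by simp_all
  define B where "B = q powi tri (j - 1) * z powi (j - 1)"
  define D where "D = qfac (m + n) * iqfac (int m + 1 - j) * iqfac (int n + j)"
  have "jtp_term z (Suc m) n j = alt_sign j * (q powi (j - 1) * z * B) * (1 - q powi (int m + int n + 1)) * D"
    unfolding jtp_term_def t qfac_Suc_int a B_def D_def by (simp only: mult_ac)
  also have "\<dots> = alt_sign j * (q powi (j - 1) * z * B) * ((1 - q powi (int m + 1 - j)) * D) +
     alt_sign j * q powi (int m) * z * B * (q powi (- (j - 1)) * q powi (j - 1)) * (1 - q powi (int n + j)) * D"
    unfolding e by (simp add: algebra_simps)
  also have "alt_sign j * (q powi (j - 1) * z * B) * ((1 - q powi (int m + 1 - j)) * D) = jtp_term z m n j"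
    unfolding jtp_term_def t i1 B_def D_def by (simp only: mult_ac)
  also have "alt_sign j * q powi (int m) * z * B * (q powi (- (j - 1)) * q powi (j - 1)) * (1 - q powi (int n + j)) * D =
     (- (q ^ m * z)) * jtp_term z m n (- 1 + j)"
    unfolding jtp_term_def k sg1 i2 a(2) B_def D_def p unfolding a(3) by (simp add: mult_ac)
  finally show ?thesis .
qed

lemma jtp_term_Suc2:
  assumes "z \<noteq> 0"
  shows "jtp_term z m (Suc n) j = jtp_term z m n j + (- (q ^ Suc n / z)) * jtp_term z m n (1 + j)"
proof -
  have t: "q powi tri (1 + j) * z powi (1 + j) = q powi j * z * (q powi tri j * z powi j)"
  proof -
    have "q powi tri (1 + j) = q powi j * q powi tri j"
      unfolding powi_add[symmetric] tri_pred[of "1 + j"] by (simp add: algebra_simps)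
    moreover have "z powi (1 + j) = z * z powi j"
      using assms by (simp add: power_int_add)
    ultimately show ?thesis by (simp add: mult_ac)
  qed
  have p: "q ^ Suc n = q powi (int n + 1)" by (simp add: power_int_add)
  have sg1: "alt_sign (1 + j) = (- alt_sign j :: 'a)" by (simp add: alt_sign_def)
  have i1: "iqfac (int n + j) = (1 - q powi (int n + 1 + j)) * iqfac (int n + 1 + j)"
    using iqfac_rec[of "int n + 1 + j"] by (simp add: algebra_simps)
  have i2: "iqfac (int m - (1 + j)) = (1 - q powi (int m - j)) * iqfac (int m - j)"
    using iqfac_rec[of "int m - j"] by (simp add: algebra_simps)
  have e: "1 - q powi (int m + int n + 1) = (1 - q powi (int n + 1 + j)) + q powi (int n + 1) * q powi j * (1 - q powi (int m - j))"
    by (simp add: algebra_simps flip: powi_add)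
  have a: "int (Suc n) + j = int n + 1 + j" "int n + (1 + j) = int n + 1 + j" by simp_all
  define B where "B = q powi tri j * z powi j"
  define D where "D = qfac (m + n) * iqfac (int m - j) * iqfac (int n + 1 + j)"
  have "jtp_term z m (Suc n) j = alt_sign j * B * (1 - q powi (int m + int n + 1)) * D"
    unfolding jtp_term_def qfac_Suc_int a B_def D_def by (simp only: mult_ac)
  also have "\<dots> = alt_sign j * B * ((1 - q powi (int n + 1 + j)) * D) +
     alt_sign j * q powi (int n + 1) * q powi j * B * (1 - q powi (int m - j)) * D"
    unfolding e by (simp add: algebra_simps)
  also have "alt_sign j * B * ((1 - q powi (int n + 1 + j)) * D) = jtp_term z m n j"
    unfolding jtp_term_def i1 B_def D_def by (simp only: mult_ac)
  also have "alt_sign j * q powi (int n + 1) * q powi j * B * (1 - q powi (int m - j)) * D =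
     (- (q ^ Suc n / z)) * jtp_term z m n (1 + j)"
    unfolding jtp_term_def t sg1 i2 a(2) p B_def[symmetric] D_def using assms by (simp add: mult_ac)
  finally show ?thesis .
qed

lemma jtp_term_step: "Sum_any (\<lambda>j. jtp_term z m n j + c * jtp_term z m n (l + j)) = (1 + c) * Sum_any (jtp_term z m n)"
proof -
  have "Sum_any (\<lambda>j. jtp_term z m n (l + j)) = Sum_any (jtp_term z m n)"
    by (rule Sum_any.reindex_cong[symmetric, of "\<lambda>j. l + j"])
       (auto intro!: o_bij[of "\<lambda>j. j - l"] simp: fun_eq_iff)
  moreover have "finite {j. jtp_term z m n (l + j) \<noteq> 0}" using finite_jtp_term'[of 1] by simp
  ultimately show ?thesis
    by (simp add: Sum_any.distrib[OF finite_jtp_term finite_jtp_term'] Sum_any_right_distrib[symmetric] distrib_right)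
qed

lemma finite_jacobi:
  assumes "z \<noteq> 0"
  shows "Sum_any (jtp_term z m n) = (\<Prod>i<m. 1 - z * q ^ i) * (\<Prod>i<n. 1 - q ^ Suc i / z)"
proof (induction n)
  case 0
  show ?case
  proof (induction m)
    case 0
    have "Sum_any (jtp_term z 0 0) = (\<Sum>j\<in>{0}. jtp_term z 0 0 j)"
      by (rule Sum_any.expand_superset) (auto simp: jtp_term_def)
    also have "\<dots> = 1" by (simp add: jtp_term_def alt_sign_def tri_def)
    finally show ?case by simp
  next
    case (Suc m)
    show ?case unfolding jtp_term_Suc1[OF assms, abs_def] jtp_term_step Suc.IH by (simp add: algebra_simps)
  qed
next
  case (Suc n)
  show ?case
    unfolding jtp_term_Suc2[OF assms, abs_def] jtp_term_step Suc.IH by (simp add: algebra_simps)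
qed

end

lemma generic_q_power: "K > 0 \<Longrightarrow> generic_q (fls_X ^ K :: complex fls)"
proof
  fix n :: nat assume "K > 0" "n > 0"
  thus "(fls_X ^ K) ^ n \<noteq> (1 :: complex fls)"
    unfolding power_mult[symmetric] by (intro G.q_pow_ne_1) simp
qed simp

section \<open>The triple product and the pentagonal number theorem as identities of power
  series\<close>

definition jexp :: "nat \<Rightarrow> nat \<Rightarrow> int \<Rightarrow> int" where
  "jexp K s i = int K * tri i + int s * i"

lemma jexp_ge:
  assumes "0 < s" "s < K"
  shows "\<bar>i\<bar> \<le> jexp K s i"
proof (cases "i \<ge> 1")
  case True
  have "tri i \<ge> 0" using True by (simp add: tri_def zero_le_mult_iff pos_imp_zdiv_nonneg_iff)
  moreover have "int s * i \<ge> 1 * i" using assms True by (intro mult_right_mono) auto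
  ultimately show ?thesis using True by (simp add: jexp_def add_increasing)
next
  case False
  define n where "n = - i"
  have n: "n \<ge> 0" using False by (simp add: n_def)
  have 2: "2 * tri i = n * (n + 1)" unfolding two_tri by (simp add: n_def algebra_simps)
  have "n * (n - 1) \<ge> 0" using n by (cases "n = 0") auto
  hence "tri i \<ge> n" using 2 by (simp add: algebra_simps)
  hence "int K * tri i \<ge> int K * n" by (intro mult_left_mono) auto
  moreover have "(int K - int s) * n \<ge> 1 * n" using assms n by (intro mult_right_mono) auto
  ultimately show ?thesis using n by (simp add: jexp_def n_def algebra_simps)
qed

definition jterm :: "nat \<Rightarrow> nat \<Rightarrow> int \<Rightarrow> complex fps" where
  "jterm K s i = alt_sign i * fps_X ^ nat (jexp K s i)"

abbreviation "qprod s K \<equiv> qpoch_inf (fps_X ^ s) (fps_X ^ K)"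

lemma fps_to_fls_prod: "fps_to_fls (\<Prod>x\<in>A. f x) = (\<Prod>x\<in>A. fps_to_fls (f x))"
  for f :: "'i \<Rightarrow> 'a::comm_ring_1 fps"
  by (induction A rule: infinite_finite_induct) (simp_all add: fls_times_fps_to_fls)

lemma field_cancel_aux: "a = b * d \<Longrightarrow> d \<noteq> 0 \<Longrightarrow> b * c = a * c / d" for a :: "'a::field"
  by simp

text \<open>The finite form at base q^K with z = q^s and m = n -> infinity; the factors with q^K/z =
  q^(K-s) give the third product. The termwise limit carries 1/(q^K;q^K)_infinity, which is moved to
  the other side at the end.\<close>

lemma jacobi_triple_product:
  assumes s: "0 < s" "s < K"
  shows "(jterm K s has_sum qprod K K * qprod s K * qprod (K - s) K) UNIV"
proof -
  have K: "K > 0" using s by simp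
  interpret H: generic_q "fls_X ^ K :: complex fls" by (rule generic_q_power[OF K])
  define f where "f n = qpoch (fps_X ^ K) (fps_X ^ K) n" for n
  define g where "g k = (if k < 0 then 0 else inverse (f (nat k)))" for k :: int
  have f0: "fps_nth (f n) 0 = 1" for n using K by (simp add: f_def)
  have f_fls: "fps_to_fls (f n) = H.qfac n" for n
    by (simp add: f_def qpoch_def H.qfac_def fps_to_fls_prod to_fls)
  have g_fls: "fps_to_fls (g k) = H.iqfac k" for k
  proof (cases "k < 0")
    case False
    have "subdegree (f (nat k)) = 0" by (simp add: subdegree_eq_0_iff f0)
    thus ?thesis using False
      by (simp add: g_def H.iqfac_def fls_inverse_fps_to_fls[symmetric] f_fls field_simps)
  qed (simp add: g_def)
  define F where "F n j = jterm K s j * (f (n + n) * g (int n - j) * g (int n + j))" for n j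
  define L where "L j = inverse (qprod K K) * jterm K s j" for j
  define S where "S n = qpoch (fps_X ^ s) (fps_X ^ K) n * qpoch (fps_X ^ (K - s)) (fps_X ^ K) n" for n
  have F_fls: "fps_to_fls (F n j) = H.jtp_term (fls_X ^ s) n n j" for n j
  proof -
    have "jexp K s j \<ge> 0" using jexp_ge[OF s, of j] by linarith
    hence "fps_to_fls (fps_X ^ nat (jexp K s j)) = (fls_X :: complex fls) powi jexp K s j" by (rule powi_fls)
    also have "\<dots> = (fls_X ^ K) powi tri j * (fls_X ^ s) powi j"
      unfolding jexp_def G.powi_add power_int_mult power_int_of_nat ..
    finally show ?thesis
      by (simp add: F_def jterm_def H.jtp_term_def to_fls f_fls g_fls alt_sign_def flip: fps_to_fls_power)
  qed
  have S_fls: "fps_to_fls (S n) = (\<Prod>i<n. 1 - fls_X ^ s * (fls_X ^ K) ^ i) * (\<Prod>i<n. 1 - (fls_X ^ K) ^ Suc i / fls_X ^ s)" for n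
  proof -
    have "fls_X ^ (K - s) * (fls_X ^ K) ^ i = (fls_X ^ K) ^ Suc i / (fls_X ^ s :: complex fls)" for i
      unfolding power_Suc
    proof (rule field_cancel_aux)
      show "fls_X ^ K = fls_X ^ (K - s) * (fls_X ^ s :: complex fls)"
        unfolding power_add[symmetric] using s by simp
    qed simp
    thus ?thesis by (simp add: S_def qpoch_def to_fls fps_to_fls_prod)
  qed
  have sums: "(F n has_sum S n) UNIV" for n
  proof (rule has_sum_finite_neutralI[of "{- int n..int n}"])
    show "F n x = 0" if "x \<in> UNIV - {- int n..int n}" for x
      using that by (auto simp: F_def g_def)
    have "fps_to_fls (S n) = Sum_any (H.jtp_term (fls_X ^ s) n n)"
      unfolding S_fls by (rule H.finite_jacobi[symmetric]) simp
    also have "\<dots> = (\<Sum>j\<in>{- int n..int n}. H.jtp_term (fls_X ^ s) n n j)"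
      by (rule Sum_any.expand_superset) (auto simp: H.jtp_term_def)
    also have "\<dots> = fps_to_fls (\<Sum>j\<in>{- int n..int n}. F n j)"
      by (simp add: fps_to_fls_sum F_fls)
    finally show "S n = (\<Sum>j\<in>{- int n..int n}. F n j)" by (simp only: fps_to_fls_eq_iff)
  qed auto
  have lf: "f \<longlonglongrightarrow> qprod K K" unfolding f_def by (rule qpoch_tendsto[OF K K])
  have Q0: "fps_nth (qprod K K) 0 = 1" by (rule qpoch_tendsto[OF K K])
  have lg: "(\<lambda>n. g (int n + c)) \<longlonglongrightarrow> inverse (qprod K K)" for c
  proof -
    have *: "(\<lambda>n. inverse (f n)) \<longlonglongrightarrow> inverse (qprod K K)"
      by (rule tendsto_inverse_fps[OF lf]) (simp add: Q0)
    have lim: "filterlim (\<lambda>n. nat (int n + c)) at_top sequentially"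
      by (rule filterlim_at_top_mono[OF filterlim_minus_const_nat_at_top[of "nat (- c)"]])
         (auto intro!: always_eventually)
    have "(\<lambda>n. inverse (f (nat (int n + c)))) \<longlonglongrightarrow> inverse (qprod K K)"
      by (rule filterlim_compose[OF * lim])
    moreover have "eventually (\<lambda>n. inverse (f (nat (int n + c))) = g (int n + c)) sequentially"
      using eventually_ge_at_top[of "nat (- c)"]
      by eventually_elim (auto simp: g_def)
    ultimately show ?thesis by (rule Lim_transform_eventually)
  qed
  have I: "qprod K K * inverse (qprod K K) = 1" by (simp add: inverse_mult_eq_1' Q0)
  obtain T where T: "(L has_sum T) UNIV" "S \<longlonglongrightarrow> T"
  proof (rule fps_tannery[of UNIV "\<lambda>i. nat \<bar>i\<bar>" F L S])
    show "finite {x \<in> UNIV. nat \<bar>x\<bar> \<le> k}" for k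
      by (rule finite_subset[of _ "{- int k..int k}"]) auto
    show "fps_nth (F n j) k = 0" if "k < nat \<bar>j\<bar>" for n j k
    proof -
      have "k < nat (jexp K s j)" using that jexp_ge[OF s, of j] by linarith
      hence "fps_nth (fps_X ^ nat (jexp K s j) * (f (n + n) * g (int n - j) * g (int n + j))) k = 0"
        by (rule fps_nth_power_X_mult_eq_0)
      thus ?thesis by (simp add: F_def jterm_def alt_sign_def)
    qed
    show "(\<lambda>n. F n j) \<longlonglongrightarrow> L j" for j
    proof -
      have "filterlim (\<lambda>n::nat. n + n) at_top sequentially"
        by (rule filterlim_at_top_mono[OF filterlim_ident]) simp
      from filterlim_compose[OF lf this]
      have 1: "(\<lambda>n. f (n + n)) \<longlonglongrightarrow> qprod K K" .
      have 2: "(\<lambda>n. g (int n - j)) \<longlonglongrightarrow> inverse (qprod K K)"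
        using lg[of "- j"] by simp
      have "(\<lambda>n. F n j) \<longlonglongrightarrow> jterm K s j * (qprod K K * inverse (qprod K K) * inverse (qprod K K))"
        unfolding F_def by (intro tendsto_mult_fps tendsto_const 1 2 lg)
      thus ?thesis by (simp add: L_def I mult.commute)
    qed
  qed (rule sums)
  have "S \<longlonglongrightarrow> qprod s K * qprod (K - s) K"
    unfolding S_def by (intro tendsto_mult_fps qpoch_tendsto) (use s in auto)
  with T(2) have "T = qprod s K * qprod (K - s) K" by (rule LIMSEQ_unique)
  with has_sum_fps_cmult[OF T(1), of "qprod K K"]
  show ?thesis by (simp add: L_def mult.assoc[symmetric] I)
qed

lemma qpoch_triple: "qpoch (fps_X ^ K) (fps_X ^ K) (3 * n) =
  qpoch (fps_X ^ (3 * K)) (fps_X ^ (3 * K)) n * qpoch (fps_X ^ K) (fps_X ^ (3 * K)) n *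
  qpoch (fps_X ^ (2 * K)) (fps_X ^ (3 * K)) n"
proof (induction n)
  case (Suc n)
  have "3 * Suc n = Suc (Suc (Suc (3 * n)))" by simp
  hence "qpoch (fps_X ^ K) (fps_X ^ K) (3 * Suc n) = qpoch (fps_X ^ K) (fps_X ^ K) (3 * n) *
    (1 - fps_X ^ K * (fps_X ^ K) ^ (3 * n)) * (1 - fps_X ^ K * (fps_X ^ K) ^ Suc (3 * n)) *
    (1 - fps_X ^ K * (fps_X ^ K) ^ Suc (Suc (3 * n)))"
    by (simp only: qpoch_Suc)
  also have "fps_X ^ K * (fps_X ^ K) ^ (3 * n) = fps_X ^ K * (fps_X ^ (3 * K)) ^ n"
    by (simp add: power_mult[symmetric] mult_ac)
  also have "fps_X ^ K * (fps_X ^ K) ^ Suc (3 * n) = fps_X ^ (2 * K) * (fps_X ^ (3 * K)) ^ n"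
    by (simp add: power_mult[symmetric] power_add[symmetric] algebra_simps)
  also have "fps_X ^ K * (fps_X ^ K) ^ Suc (Suc (3 * n)) = fps_X ^ (3 * K) * (fps_X ^ (3 * K)) ^ n"
    by (simp add: power_mult[symmetric] power_add[symmetric] algebra_simps)
  finally show ?case unfolding Suc.IH qpoch_Suc by (simp only: mult_ac)
qed (simp add: qpoch_def)

text \<open>Sorting the factors of (q^K;q^K)_infinity by the exponent modulo 3K gives the product
  side of the triple product at base q^(3K) with z = q^K.\<close>

lemma pentagonal:
  assumes "K > 0"
  shows "((\<lambda>i. alt_sign i * fps_X ^ nat (jexp (3 * K) K i)) has_sum qprod K K) UNIV"
proof -
  have "filterlim (\<lambda>n::nat. 3 * n) at_top sequentially"
    by (rule filterlim_at_top_mono[OF filterlim_ident]) simp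
  from filterlim_compose[OF qpoch_tendsto(1)[OF assms assms] this]
  have "(\<lambda>n. qpoch (fps_X ^ K) (fps_X ^ K) (3 * n)) \<longlonglongrightarrow> qprod K K" .
  moreover have "(\<lambda>n. qpoch (fps_X ^ K) (fps_X ^ K) (3 * n)) \<longlonglongrightarrow> qprod (3 * K) (3 * K) * qprod K (3 * K) * qprod (2 * K) (3 * K)"
    unfolding qpoch_triple by (intro tendsto_mult_fps qpoch_tendsto) (use assms in auto)
  ultimately have "qprod K K = qprod (3 * K) (3 * K) * qprod K (3 * K) * qprod (2 * K) (3 * K)"
    by (rule LIMSEQ_unique)
  thus ?thesis using jacobi_triple_product[of K "3 * K"] assms
    by (simp add: jterm_def[abs_def])
qed


lemma pentagonal':
  assumes "K > 0"
  shows "((\<lambda>i. alt_sign i * fps_X ^ nat (jexp (3 * K) K (- i))) has_sum qprod K K) UNIV"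
proof -
  have "bij (uminus :: int \<Rightarrow> int)" by (rule o_bij[of uminus]) auto
  from has_sum_reindex_bij_betw[OF this, of "\<lambda>i. alt_sign i * fps_X ^ nat (jexp (3 * K) K i)"] pentagonal[OF assms]
  show ?thesis unfolding alt_sign_neg by blast
qed

text \<open>
In the product of the series with indices \<open>i\<close>, \<open>j\<close>, \<open>l\<close>, fix \<open>a = l - i + 1\<close> and \<open>b = i - j\<close>. The sum over
\<open>i\<close> is then pentagonal, or cancels in pairs if 3 divides \<open>a - b\<close>.
\<close>

lemma macdonald_A2:
  assumes c: "0 < c" "2 * c < K"
  defines "E \<equiv> (\<lambda>a b. int K * cas a b - int c * (2 * a + b - 2))"
  shows "((\<lambda>(a, b). chi3 (a - b) * fps_X ^ nat (E a b)) has_sum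
    (qprod K K)\<^sup>2 * (qprod c K * qprod (K - c) K) * (qprod c K * qprod (K - c) K) * (qprod (K - 2 * c) K * qprod (2 * c) K)) UNIV"
proof -
  have K: "K > 0" and c1: "c < K" and c2: "0 < K - 2 * c" "K - 2 * c < K" using c by auto
  \<comment> \<open>The three parameters satisfy c + c + D = K. Along a diagonal the coefficient of
    i in the exponent is then a multiple of K, so the inner sum involves c only through a
    prefactor.\<close>
  define D where "D = K - 2 * c"
  define \<Xi> where "\<Xi> = (qprod K K * qprod c K * qprod (K - c) K) * ((qprod K K * qprod c K * qprod (K - c) K) * (qprod K K * qprod D K * qprod (K - D) K))"
  define T where "T = (\<lambda>(i, j, l). jterm K c i * (jterm K c j * jterm K D l))"
  have T: "(T has_sum \<Xi>) UNIV"
    using has_sum_fps_mult[OF jacobi_triple_product[OF c(1) c1]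
      has_sum_fps_mult[OF jacobi_triple_product[OF c(1) c1] jacobi_triple_product[OF c2]]]
    by (simp add: T_def \<Xi>_def D_def case_prod_unfold)
  define h where "h = (\<lambda>((a, b), i). (i, i - b, i + a - 1) :: int \<times> int \<times> int)"
  have "bij h"
    unfolding h_def by (rule o_bij[of "\<lambda>(i, j, l). ((l - i + 1, i - j), i)"]) auto
  from has_sum_reindex_bij_betw[OF this, of T] T
  have T': "((\<lambda>x. T (h x)) has_sum \<Xi>) (UNIV \<times> UNIV)" by simp
  define e where "e a b i = jexp K c i + jexp K c (i - b) + jexp K D (i + a - 1)" for a b i
  have Th: "T (h ((a, b), i)) = alt_sign (i + (a - b) - 1) * fps_X ^ nat (e a b i)" for a b i
  proof -
    have "jexp K c i \<ge> 0" "jexp K c (i - b) \<ge> 0" "jexp K D (i + a - 1) \<ge> 0"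
      using jexp_ge[OF c(1) c1] jexp_ge[OF c2] unfolding D_def by (meson abs_ge_zero order_trans)+
    hence "nat (e a b i) = nat (jexp K c i) + (nat (jexp K c (i - b)) + nat (jexp K D (i + a - 1)))"
      by (simp add: e_def nat_add_distrib)
    moreover have "alt_sign (i + (a - b) - 1) = alt_sign i * (alt_sign (i - b) * alt_sign (i + a - 1) :: complex fps)"
      unfolding alt_sign_add[symmetric] by (simp add: alt_sign_def)
    ultimately show ?thesis by (simp add: T_def h_def jterm_def power_add mult_ac)
  qed
  have e2: "2 * e a b i = 2 * (int K * (3 * tri i + (a - b) * i)) + int K * (a\<^sup>2 - a + b\<^sup>2 + b) - 2 * int c * (2 * a + b - 2)" for a b i
  proof -
    have "int D = int K - 2 * int c" using c by (simp add: D_def)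
    thus ?thesis
      using two_tri[of i] two_tri[of "i - b"] two_tri[of "i + a - 1"] unfolding e_def jexp_def by algebra
  qed
  have e_ge: "e a b i \<ge> 0" for a b i
    using jexp_ge[OF c(1) c1] jexp_ge[OF c2] unfolding e_def D_def
    by (intro add_nonneg_nonneg) (meson abs_ge_zero order_trans)+
  have inner: "((\<lambda>i. T (h ((a, b), i))) has_sum chi3 (a - b) * fps_X ^ nat (E a b) * qprod K K) UNIV" for a b
  proof -
    define g where "g = (a - b) div 3"
    have "(a - b) mod 3 = 0 \<or> (a - b) mod 3 = 1 \<or> (a - b) mod 3 = 2" by presburger
    then consider "a - b = 3 * g" | "a - b = 3 * g + 1" | "a - b = 3 * g + 2"
      unfolding g_def using mult_div_mod_eq[of 3 "a - b"] by fastforce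
    thus ?thesis
    proof cases
      case 1
      have chi3: "chi3 (a - b) = (0 :: complex fps)" using 1 by (simp add: chi3_def)
      \<comment> \<open>The sum has to exist before S = -S can give S = 0.\<close>
      obtain S where S: "((\<lambda>i. T (h ((a, b), i))) has_sum S) UNIV"
      proof (rule fps_dominated_has_sum[of UNIV "\<lambda>i. nat \<bar>i\<bar>"])
        show "finite {x \<in> UNIV. nat \<bar>x\<bar> \<le> k}" for k
          by (rule finite_subset[of _ "{- int k..int k}"]) auto
        fix i k assume "k < nat \<bar>i\<bar>"
        moreover have "\<bar>i\<bar> \<le> e a b i"
          using jexp_ge[OF c(1) c1, of i] jexp_ge[OF c(1) c1, of "i - b"] jexp_ge[OF c2, of "i + a - 1"]
          unfolding e_def D_def by linarith
        ultimately have "k < nat (e a b i)" by linarith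
        from fps_nth_power_X_mult_eq_0[OF this, of "1 :: complex fps"]
        show "fps_nth (T (h ((a, b), i))) k = 0" unfolding Th by (simp add: alt_sign_def)
      qed
      \<comment> \<open>The exponent depends on i through tri i + g i = i (i - 1 + 2g)/2, which is
        invariant under this reflection, while the parity of i changes.\<close>
      define r where "r i = 1 - 2 * g - i" for i
      have r: "bij r" unfolding r_def by (rule o_bij[of "\<lambda>i. 1 - 2 * g - i"]) auto
      have "T (h ((a, b), r i)) = - 1 * T (h ((a, b), i))" for i
      proof -
        have "2 * e a b (r i) = 2 * e a b i"
          unfolding e2 using two_tri[of i] two_tri[of "r i"] 1 unfolding r_def by algebra
        moreover have "alt_sign (r i + (a - b) - 1) = (- alt_sign (i + (a - b) - 1) :: complex fps)"
          unfolding 1 r_def by (simp add: alt_sign_def)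
        ultimately show ?thesis unfolding Th by simp
      qed
      hence "((\<lambda>i. - 1 * T (h ((a, b), i))) has_sum S) UNIV"
        using has_sum_reindex_bij_betw[OF r, of "\<lambda>i. T (h ((a, b), i))" S] S by simp
      moreover have "((\<lambda>i. - 1 * T (h ((a, b), i))) has_sum - 1 * S) UNIV"
        by (rule has_sum_fps_cmult[OF S])
      ultimately have "S = - 1 * S" by (rule has_sum_fps_unique)
      hence "2 * S = 0" by simp
      hence "S = 0" by simp
      thus ?thesis using S chi3 by simp
    next
      case 2
      have chi3: "chi3 (a - b) = (1 :: complex fps)" using 2 by (simp add: chi3_def)
      have three: "3 * cas a b = a\<^sup>2 + a * b + b\<^sup>2 - 1" using three_cas[of a b, where 'a = "complex fps"] chi3 by simp
      have e': "e a b i = E a b + jexp (3 * K) K (i + g)" for i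
      proof -
        have "6 * e a b i = 6 * (E a b + jexp (3 * K) K (i + g))"
          using e2[of a b i] two_tri[of i] two_tri[of "i + g"] 2 three
          unfolding E_def jexp_def of_nat_mult of_nat_numeral by algebra
        thus ?thesis by simp
      qed
      \<comment> \<open>At i = -g the pentagonal exponent is 0, so \<open>E a b\<close> is a value
        of \<open>e\<close> and hence nonnegative.\<close>
      have E0: "E a b \<ge> 0" using e_ge[of a b "- g"] unfolding e' by (simp add: jexp_def tri_def)
      have Th': "T (h ((a, b), i)) = fps_X ^ nat (E a b) * (alt_sign (i + g) * fps_X ^ nat (jexp (3 * K) K (i + g)))" for i
      proof -
        have "jexp (3 * K) K (i + g) \<ge> 0"
          using jexp_ge[of K "3 * K" "i + g"] K by linarith
        moreover have "alt_sign (i + (a - b) - 1) = (alt_sign (i + g) :: complex fps)" unfolding 2 by (simp add: alt_sign_def)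
        ultimately show ?thesis unfolding Th e' using E0 by (simp add: nat_add_distrib power_add mult_ac)
      qed
      have "bij (\<lambda>i. i + g)" by (rule o_bij[of "\<lambda>i. i - g"]) auto
      from has_sum_reindex_bij_betw[OF this, of "\<lambda>i. alt_sign i * fps_X ^ nat (jexp (3 * K) K i)"] pentagonal[OF K]
      have "((\<lambda>i. alt_sign (i + g) * fps_X ^ nat (jexp (3 * K) K (i + g))) has_sum qprod K K) UNIV" by blast
      from has_sum_fps_cmult[OF this, of "fps_X ^ nat (E a b)"] show ?thesis unfolding Th' chi3 by simp
    next
      case 3
      have chi3: "chi3 (a - b) = (- 1 :: complex fps)" using 3 by (simp add: chi3_def)
      have three: "3 * cas a b = a\<^sup>2 + a * b + b\<^sup>2 - 1" using three_cas[of a b, where 'a = "complex fps"] chi3 by simp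
      have e': "e a b i = E a b + jexp (3 * K) K (- (i + g))" for i
      proof -
        have "6 * e a b i = 6 * (E a b + jexp (3 * K) K (- (i + g)))"
          using e2[of a b i] two_tri[of i] two_tri[of "- (i + g)"] 3 three
          unfolding E_def jexp_def of_nat_mult of_nat_numeral by algebra
        thus ?thesis by simp
      qed
      have E0: "E a b \<ge> 0" using e_ge[of a b "- g"] unfolding e' by (simp add: jexp_def tri_def)
      have Th': "T (h ((a, b), i)) = (- (fps_X ^ nat (E a b))) * (alt_sign (i + g) * fps_X ^ nat (jexp (3 * K) K (- (i + g))))" for i
      proof -
        have "jexp (3 * K) K (- (i + g)) \<ge> 0"
          using jexp_ge[of K "3 * K" "- (i + g)"] K by linarith
        moreover have "alt_sign (i + (a - b) - 1) = (- alt_sign (i + g) :: complex fps)" unfolding 3 by (simp add: alt_sign_def)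
        ultimately show ?thesis unfolding Th e' using E0 by (simp only: nat_add_distrib power_add mult_ac mult_minus_left mult_minus_right)
      qed
      have "bij (\<lambda>i. i + g)" by (rule o_bij[of "\<lambda>i. i - g"]) auto
      from has_sum_reindex_bij_betw[OF this, of "\<lambda>i. alt_sign i * fps_X ^ nat (jexp (3 * K) K (- i))"] pentagonal'[OF K]
      have "((\<lambda>i. alt_sign (i + g) * fps_X ^ nat (jexp (3 * K) K (- (i + g)))) has_sum qprod K K) UNIV" by blast
      from has_sum_fps_cmult[OF this, of "- (fps_X ^ nat (E a b))"] show ?thesis unfolding Th' chi3 by simp
    qed
  qed
  \<comment> \<open>Every inner sum contains the factor (q^K;q^K)_infinity; cancelling it leaves the
    square of that product in the result.\<close>
  have I: "qprod K K * inverse (qprod K K) = 1"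
    using qpoch_tendsto(2)[OF K K] by (simp add: inverse_mult_eq_1')
  have "((\<lambda>(a, b). chi3 (a - b) * fps_X ^ nat (E a b) * qprod K K) has_sum \<Xi>) UNIV"
    by (rule has_sum_fps_Sigma[OF T']) (use inner in auto)
  from has_sum_fps_cmult[OF this, of "inverse (qprod K K)"]
  have "((\<lambda>(a, b). chi3 (a - b) * fps_X ^ nat (E a b) * (qprod K K * inverse (qprod K K))) has_sum inverse (qprod K K) * \<Xi>) UNIV"
    by (simp add: case_prod_unfold mult_ac)
  moreover have "inverse (qprod K K) * \<Xi> = (qprod K K * inverse (qprod K K)) * ((qprod K K)\<^sup>2 * (qprod c K * qprod (K - c) K) * (qprod c K * qprod (K - c) K) * (qprod D K * qprod (K - D) K))"
    unfolding \<Xi>_def power2_eq_square by (simp only: mult_ac)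
  moreover have "K - D = 2 * c" using c by (simp add: D_def)
  ultimately show ?thesis unfolding I by (simp add: D_def)
qed

section \<open>Evaluation of the limits\<close>

text \<open>Expand |v - rho|^2/2 for v = (a, b, -a-b): |v|^2 = 6 cas + 2, |rho|^2 = 2 and <v, rho> =
  2a + b.\<close>

lemma half_norm_cas: "chi3 (a - b) \<noteq> (0 :: 'a::ring_1) \<Longrightarrow> G.half_norm a b = 3 * cas a b + 2 - 2 * a - b"
  using three_cas[of a b, where 'a = 'a] by (simp add: G.half_norm_def algebra_simps power2_eq_square)

lemma cas_nonneg: "cas a b \<ge> 0" if "chi3 (a - b) \<noteq> (0 :: 'a::ring_1)"
proof -
  have "4 * (a\<^sup>2 + a * b + b\<^sup>2) = (2 * a + b)\<^sup>2 + 3 * b\<^sup>2" by (simp add: algebra_simps power2_eq_square)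
  hence "a\<^sup>2 + a * b + b\<^sup>2 \<ge> 0" by (smt (verit) zero_le_power2)
  thus ?thesis using three_cas[OF that] by linarith
qed

text \<open>By \<open>half_norm_cas\<close> the claim amounts to <y, rho> <= |y|^2, which follows
  from t <= t^2 for integers t.\<close>

lemma half_norm_ge_cas: "cas a b \<le> G.half_norm a b" if "chi3 (a - b) \<noteq> (0 :: 'a::ring_1)"
proof -
  have sq: "x \<le> x\<^sup>2" for x :: int
    by (cases "x \<ge> 1") (auto simp: power2_eq_square intro: order_trans[of _ 0])
  have "2 * G.half_norm a b = (a - 1)\<^sup>2 + b\<^sup>2 + (a - 1 + b)\<^sup>2"
    by (simp add: G.half_norm_def algebra_simps power2_eq_square)
  hence "2 * G.half_norm a b \<ge> (a - 1) + (a - 1 + b)"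
    using sq[of "a - 1"] sq[of "a - 1 + b"] zero_le_power2[of b] by linarith
  thus ?thesis using half_norm_cas[OF that] by linarith
qed

definition theta_prod :: "nat \<Rightarrow> nat \<Rightarrow> complex fps" where
  "theta_prod c K = (qprod K K)\<^sup>2 * (qprod c K * qprod (K - c) K) * (qprod c K * qprod (K - c) K) * (qprod (K - 2 * c) K * qprod (2 * c) K)"

lemma xstart_a_support: "m > 2 * n \<Longrightarrow> xstart_a n m = 0"
  by (simp add: xstart_a_def qbinom_def)

lemma xstart_b_support: "m > 2 * n \<Longrightarrow> xstart_b n m = 0"
  by (auto simp: xstart_b_def qbinom_def intro!: sum.neutral)

text \<open>One |y|^2/2 is already in the seed and k - 1 Bailey steps follow.\<close>

lemma seed_exponent_a:
  fixes k :: nat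
  defines "E \<equiv> (\<lambda>a b. int (3 * k + 1) * cas a b - int k * (2 * a + b - 2))"
  shows "chi3 (a - b) * fls_X powi (4 * cas a b + 2 - 2 * a - b + (int k - 1) * G.half_norm a b) = chi3 (a - b) * (fls_X :: complex fls) powi E a b"
    and "k \<ge> 1 \<Longrightarrow> chi3 (a - b) \<noteq> (0 :: complex fps) \<Longrightarrow> G.half_norm a b \<le> E a b"
proof -
  have e: "E a b = cas a b + int k * G.half_norm a b" "4 * cas a b + 2 - 2 * a - b + (int k - 1) * G.half_norm a b = E a b"
    if "chi3 (a - b) \<noteq> (0 :: complex fps)"
    unfolding E_def half_norm_cas[OF that] by (simp_all add: algebra_simps)
  show "chi3 (a - b) * fls_X powi (4 * cas a b + 2 - 2 * a - b + (int k - 1) * G.half_norm a b) = chi3 (a - b) * (fls_X :: complex fls) powi E a b"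
    using e(2) chi3_fls_iff[of "a - b"] by (cases "chi3 (a - b) = (0 :: complex fls)") auto
  show "G.half_norm a b \<le> E a b" if "k \<ge> 1" "chi3 (a - b) \<noteq> (0 :: complex fps)"
  proof -
    have "1 * G.half_norm a b \<le> int k * G.half_norm a b"
      by (rule mult_right_mono) (use that(1) order_trans[OF abs_ge_zero half_norm_ge(1)] in auto)
    thus ?thesis using e(1)[OF that(2)] cas_nonneg[OF that(2)] by linarith
  qed
qed

text \<open>Here k Bailey steps follow the seed, which makes k + 1 copies of |y|^2/2. As
  \<open>cas\<close> enters negatively, the lower bound relies on
  \<open>half_norm_ge_cas\<close>.\<close>

lemma seed_exponent_b:
  fixes k :: nat
  defines "E \<equiv> (\<lambda>a b. int (3 * k + 2) * cas a b - int (k + 1) * (2 * a + b - 2))"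
  shows "chi3 (a - b) * fls_X powi (2 * cas a b + 2 - 2 * a - b + int k * G.half_norm a b) = chi3 (a - b) * (fls_X :: complex fls) powi E a b"
    and "k \<ge> 1 \<Longrightarrow> chi3 (a - b) \<noteq> (0 :: complex fps) \<Longrightarrow> G.half_norm a b \<le> E a b"
proof -
  have e: "E a b = (G.half_norm a b - cas a b) + int k * G.half_norm a b" "2 * cas a b + 2 - 2 * a - b + int k * G.half_norm a b = E a b"
    if "chi3 (a - b) \<noteq> (0 :: complex fps)"
    unfolding E_def half_norm_cas[OF that] by (simp_all add: algebra_simps)
  show "chi3 (a - b) * fls_X powi (2 * cas a b + 2 - 2 * a - b + int k * G.half_norm a b) = chi3 (a - b) * (fls_X :: complex fls) powi E a b"
    using e(2) chi3_fls_iff[of "a - b"] by (cases "chi3 (a - b) = (0 :: complex fls)") auto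
  show "G.half_norm a b \<le> E a b" if "k \<ge> 1" "chi3 (a - b) \<noteq> (0 :: complex fps)"
  proof -
    have "1 * G.half_norm a b \<le> int k * G.half_norm a b"
      by (rule mult_right_mono) (use that(1) order_trans[OF abs_ge_zero half_norm_ge(1)] in auto)
    thus ?thesis using e(1)[OF that(2)] half_norm_ge_cas[OF that(2)] by linarith
  qed
qed

lemma chain_value_a:
  assumes "k \<ge> 2"
  shows "((\<lambda>x. fps_X ^ quad_form (fst x) (snd x) * xchain_sum xstart_a (k - 2) (fst x) (snd x)) has_sum
    theta_prod k (3 * k + 1) / euler\<^sup>2) UNIV"
proof (rule chain_limit[OF xstart_a_support])
  show "G.bailey_sum (\<lambda>a b. G.seed_a_weight a b * fls_X powi G.half_norm a b) (int n) (int T) = (\<Sum>R\<le>n. \<Sum>M\<le>2 * R. G.iqfac (int n - int R) * fls_X powi G.qform R M *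
     fps_to_fls (xstart_a R M) * G.iqfac (int T) * G.iqfac (int T + int M - int R))" for n T
    unfolding xstart_a_fls by (rule G.bailey_sum_a_1)
  have j: "int (k - 2) = int k - 2" using assms by simp
  have "G.seed_a_weight a b * fls_X powi G.half_norm a b * fls_X powi (int (k - 2) * G.half_norm a b) =
    chi3 (a - b) * fls_X powi (int (3 * k + 1) * cas a b - int k * (2 * a + b - 2))" for a b
    unfolding seed_exponent_a(1)[symmetric] G.seed_a_weight_def mult.assoc G.powi_add[symmetric] j by (simp add: algebra_simps)
  thus "(\<lambda>a b. G.seed_a_weight a b * fls_X powi G.half_norm a b * fls_X powi (int (k - 2) * G.half_norm a b)) =
    (\<lambda>a b. chi3 (a - b) * fls_X powi (int (3 * k + 1) * cas a b - int k * (2 * a + b - 2)))" by blast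
  show "G.half_norm a b \<le> int (3 * k + 1) * cas a b - int k * (2 * a + b - 2)" if "chi3 (a - b) \<noteq> (0 :: complex fps)" for a b
    by (rule seed_exponent_a(2)) (use assms that in auto)
  show "((\<lambda>(a, b). chi3 (a - b) * fps_X ^ nat (int (3 * k + 1) * cas a b - int k * (2 * a + b - 2))) has_sum theta_prod k (3 * k + 1)) UNIV"
    unfolding theta_prod_def by (rule macdonald_A2) (use assms in auto)
qed

lemma chain_value_b:
  assumes "k \<ge> 2"
  shows "((\<lambda>x. fps_X ^ quad_form (fst x) (snd x) * xchain_sum xstart_b (k - 2) (fst x) (snd x)) has_sum
    theta_prod (k + 1) (3 * k + 2) / euler\<^sup>2) UNIV"
proof (rule chain_limit[OF xstart_b_support])
  show "G.bailey_sum (\<lambda>a b. G.seed_b_weight a b * fls_X powi G.half_norm a b * fls_X powi G.half_norm a b) (int n) (int T) = (\<Sum>R\<le>n. \<Sum>M\<le>2 * R. G.iqfac (int n - int R) * fls_X powi G.qform R M *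
     fps_to_fls (xstart_b R M) * G.iqfac (int T) * G.iqfac (int T + int M - int R))" for n T
    unfolding xstart_b_fls by (rule G.bailey_sum_b_2)
  have j: "int (k - 2) = int k - 2" using assms by simp
  have "G.seed_b_weight a b * fls_X powi G.half_norm a b * fls_X powi G.half_norm a b * fls_X powi (int (k - 2) * G.half_norm a b) =
    chi3 (a - b) * fls_X powi (int (3 * k + 2) * cas a b - int (k + 1) * (2 * a + b - 2))" for a b
    unfolding seed_exponent_b(1)[symmetric] G.seed_b_weight_def mult.assoc G.powi_add[symmetric] j by (simp add: algebra_simps)
  thus "(\<lambda>a b. G.seed_b_weight a b * fls_X powi G.half_norm a b * fls_X powi G.half_norm a b * fls_X powi (int (k - 2) * G.half_norm a b)) =
    (\<lambda>a b. chi3 (a - b) * fls_X powi (int (3 * k + 2) * cas a b - int (k + 1) * (2 * a + b - 2)))" by blast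
  show "G.half_norm a b \<le> int (3 * k + 2) * cas a b - int (k + 1) * (2 * a + b - 2)" if "chi3 (a - b) \<noteq> (0 :: complex fps)" for a b
    by (rule seed_exponent_b(2)) (use assms that in auto)
  show "((\<lambda>(a, b). chi3 (a - b) * fps_X ^ nat (int (3 * k + 2) * cas a b - int (k + 1) * (2 * a + b - 2))) has_sum theta_prod (k + 1) (3 * k + 2)) UNIV"
    unfolding theta_prod_def by (rule macdonald_A2) (use assms in auto)
qed

text \<open>The first Rogers-Ramanujan identity. It comes from a single Bailey step, at a stage
  where no q-binomial is present, so \<open>chain_limit\<close> does not cover it.\<close>

lemma chain_value_1: "((\<lambda>r. fps_X ^ (r\<^sup>2) * ixfac (int r)) has_sum theta_prod 2 5 / euler\<^sup>2) UNIV"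
proof (rule seed_limit[of "\<lambda>r. r\<^sup>2" _ "\<lambda>n. {..n}" int "\<lambda>a b. int (3 * 1 + 2) * cas a b - int (1 + 1) * (2 * a + b - 2)" int])
  show "finite {r :: nat. r\<^sup>2 \<le> k}" for k
    by (rule finite_subset[of _ "{..k}"]) (auto intro: power2_nat_le_imp_le)
  show "ixfac (int n - int r) * (fps_X ^ (r\<^sup>2) * ixfac (int r)) = 0" if "r \<notin> {..n}" for n r
    using that by (simp add: ixfac_def)
  show "G.half_norm a b \<le> int (3 * 1 + 2) * cas a b - int (1 + 1) * (2 * a + b - 2)" if "chi3 (a - b) \<noteq> (0 :: complex fps)" for a b
    by (rule seed_exponent_b(2)) (use that in auto)
  have "((\<lambda>(a, b). chi3 (a - b) * fps_X ^ nat (int 5 * cas a b - int 2 * (2 * a + b - 2))) has_sum theta_prod 2 5) UNIV"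
    unfolding theta_prod_def by (rule macdonald_A2) auto
  thus "((\<lambda>(a, b). chi3 (a - b) * fps_X ^ nat (int (3 * 1 + 2) * cas a b - int (1 + 1) * (2 * a + b - 2))) has_sum theta_prod 2 5) UNIV"
    by simp
  fix n
  have "(\<lambda>a b. chi3 (a - b) * fls_X powi (int (3 * 1 + 2) * cas a b - int (1 + 1) * (2 * a + b - 2))) =
    (\<lambda>a b. G.seed_b_weight a b * fls_X powi G.half_norm a b)"
    unfolding seed_exponent_b(1)[symmetric] G.seed_b_weight_def mult.assoc G.powi_add[symmetric] by simp
  thus "G.bailey_sum (\<lambda>a b. chi3 (a - b) * fls_X powi (int (3 * 1 + 2) * cas a b - int (1 + 1) * (2 * a + b - 2))) (int n) (int n) =
    fps_to_fls (\<Sum>x\<le>n. ixfac (int n - int x) * (fps_X ^ (x\<^sup>2) * ixfac (int x)) * ixfac (int n) * ixfac (int n + int x))"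
    by (simp only: G.bailey_sum_b_1 fps_to_fls_sum fls_times_fps_to_fls ixfac_fls fps_to_fls_power fps_X_to_fls mult_ac)
qed (auto intro: fps_nth_power_X_mult_eq_0)

section \<open>The right-hand sides\<close>

lemma fps_X_power_div: "s \<le> K \<Longrightarrow> (fps_X ^ K :: complex fps) / fps_X ^ s = fps_X ^ (K - s)"
proof -
  assume "s \<le> K"
  hence e: "fps_X ^ K = (fps_X ^ (K - s) * fps_X ^ s :: complex fps)" unfolding power_add[symmetric] by simp
  have "(fps_X ^ s :: complex fps) \<noteq> 0" by simp
  thus ?thesis unfolding e by (rule nonzero_mult_div_cancel_right)
qed

lemma theta_powers:
  assumes "\<forall>s\<in>set ss. s \<le> K"
  shows "theta (map (\<lambda>s. fps_X ^ s) ss) (fps_X ^ K) = (\<Prod>s\<leftarrow>ss. qprod s K * qprod (K - s) K)"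
  using assms by (induction ss) (auto simp: theta_def fps_X_power_div)

lemma rhs1_eq: "k \<ge> 1 \<Longrightarrow> rhs1 k = theta_prod (k + 1) (3 * k + 2) / euler\<^sup>2"
proof -
  assume "k \<ge> 1"
  have e: "3 * k + 2 - 2 * (k + 1) = k" "2 * (k + 1) = 3 * k + 2 - k" by auto
  show ?thesis
    unfolding rhs1_def theta_prod_def e
    using theta_powers[of "[k, k + 1, k + 1]" "3 * k + 2"] 
    by (simp add: fps_divide_unit mult_ac)
qed

lemma rhs2_eq: "k \<ge> 1 \<Longrightarrow> rhs2 k = theta_prod k (3 * k + 1) / euler\<^sup>2"
proof -
  assume "k \<ge> 1"
  have e: "3 * k + 1 - 2 * k = k + 1" "2 * k = 3 * k + 1 - (k + 1)" by auto
  show ?thesis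
    unfolding rhs2_def theta_prod_def e
    using theta_powers[of "[k, k, k + 1]" "3 * k + 1"] 
    by (simp add: fps_divide_unit mult_ac)
qed

lemma qpoch_quad: "qpoch fps_X fps_X (4 * n) = qpoch (fps_X ^ 1) (fps_X ^ 4) n * qpoch (fps_X ^ 2) (fps_X ^ 4) n *
  qpoch (fps_X ^ 3) (fps_X ^ 4) n * qpoch (fps_X ^ 4) (fps_X ^ 4) n"
proof (induction n)
  case (Suc n)
  have "4 * Suc n = Suc (Suc (Suc (Suc (4 * n))))" by simp
  hence P: "qpoch fps_X fps_X (4 * Suc n) = qpoch fps_X fps_X (4 * n) *
    (1 - fps_X * fps_X ^ (4 * n)) * (1 - fps_X * fps_X ^ Suc (4 * n)) *
    (1 - fps_X * fps_X ^ Suc (Suc (4 * n))) * (1 - fps_X * fps_X ^ Suc (Suc (Suc (4 * n))))"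
    by (simp only: qpoch_Suc)
  have e: "fps_X * fps_X ^ Suc (4 * n) = fps_X ^ 2 * (fps_X ^ 4 :: complex fps) ^ n"
    "fps_X * fps_X ^ Suc (Suc (4 * n)) = fps_X ^ 3 * (fps_X ^ 4 :: complex fps) ^ n"
    "fps_X * fps_X ^ Suc (Suc (Suc (4 * n))) = fps_X ^ 4 * (fps_X ^ 4 :: complex fps) ^ n"
    "fps_X * fps_X ^ (4 * n) = fps_X ^ 1 * (fps_X ^ 4 :: complex fps) ^ n"
    unfolding power_Suc[symmetric] power_mult[symmetric] power_add[symmetric]
    by (rule arg_cong[of _ _ "(^) fps_X"], simp)+
  show ?case unfolding P e Suc.IH qpoch_Suc by (simp only: mult_ac)
qed (simp add: qpoch_def)

text \<open>For k = 1 the modulus is 4, and among the factors of \<open>theta_prod 1 4\<close> each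
  residue class modulo 4 occurs exactly twice.\<close>

lemma rhs2_1: "rhs2 1 = 1"
proof -
  have "filterlim (\<lambda>n::nat. 4 * n) at_top sequentially"
    by (rule filterlim_at_top_mono[OF filterlim_ident]) simp
  from filterlim_compose[OF xfac_tendsto this]
  have "(\<lambda>n. xfac (4 * n)) \<longlonglongrightarrow> euler" .
  moreover have "(\<lambda>n. xfac (4 * n)) \<longlonglongrightarrow> qprod 1 4 * qprod 2 4 * qprod 3 4 * qprod 4 4"
    unfolding qpoch_quad by (intro tendsto_mult_fps qpoch_tendsto) auto
  ultimately have P: "euler = qprod 1 4 * qprod 2 4 * qprod 3 4 * qprod 4 4" by (rule LIMSEQ_unique)
  have "theta_prod 1 (3 * 1 + 1) = (qprod 1 4 * qprod 2 4 * qprod 3 4 * qprod 4 4)\<^sup>2"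
    by (simp add: theta_prod_def power2_eq_square mult_ac)
  hence "theta_prod 1 (3 * 1 + 1) = euler\<^sup>2" by (simp only: P)
  moreover have "euler\<^sup>2 \<noteq> 0" by (metis fps_zero_nth power_not_zero euler_nth_0 zero_neq_one)
  ultimately show ?thesis by (simp add: rhs2_eq)
qed

section \<open>Summation over chains\<close>

text \<open>
The part of a summand at the positions from \<open>i\<close> to \<open>d\<close>, without the weight of position \<open>i\<close>, so that
position \<open>i\<close> is the outer parameter in the recursion of \<open>xchain_sum\<close>.
\<close>

definition chain_body :: "(nat \<Rightarrow> nat \<Rightarrow> complex fps) \<Rightarrow> nat \<Rightarrow> nat \<Rightarrow> (nat \<Rightarrow> nat) \<Rightarrow> (nat \<Rightarrow> nat) \<Rightarrow> complex fps" where
  "chain_body V d i n m = (\<Prod>l\<in>{i<..d}. fps_X ^ quad_form (n l) (m l)) *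
     (\<Prod>l\<in>{i..<d}. ixfac (int (n l) - int (n (l + 1))) *
        qbinom (int (n l) - int (n (l + 1)) + int (m (l + 1))) (int (m l))) * V (n d) (m d)"

abbreviation tuples :: "nat set \<Rightarrow> (nat \<Rightarrow> nat) set" where "tuples A \<equiv> A \<rightarrow>\<^sub>E UNIV"

text \<open>Tuples are \<open>undefined\<close> outside their index set, so removing a position
  means resetting it to that value.\<close>

lemma tuples_insert_bij:
  assumes "a \<notin> A"
  shows "bij_betw (\<lambda>((x, y), (n, m)). (n(a := x), m(a := y))) ((UNIV \<times> UNIV) \<times> (tuples A \<times> tuples A)) (tuples (insert a A) \<times> tuples (insert a A))"
proof (rule bij_betwI)
  let ?r = "\<lambda>n :: nat \<Rightarrow> nat. n(a := undefined)"
  show "(\<lambda>((x, y), (n, m)). (n(a := x), m(a := y))) \<in> (UNIV \<times> UNIV) \<times> (tuples A \<times> tuples A) \<rightarrow> tuples (insert a A) \<times> tuples (insert a A)"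
    by (auto simp: PiE_def extensional_def)
  show "(\<lambda>(n, m). ((n a, m a), (?r n, ?r m))) \<in> tuples (insert a A) \<times> tuples (insert a A) \<rightarrow> (UNIV \<times> UNIV) \<times> (tuples A \<times> tuples A)"
    by (auto simp: PiE_def extensional_def)
  show "(\<lambda>(n, m). ((n a, m a), (?r n, ?r m))) ((\<lambda>((x, y), (n, m)). (n(a := x), m(a := y))) z) = z"
    if "z \<in> (UNIV \<times> UNIV) \<times> (tuples A \<times> tuples A)" for z
    using that assms by (auto simp: PiE_def extensional_def fun_eq_iff)
  show "(\<lambda>((x, y), (n, m)). (n(a := x), m(a := y))) ((\<lambda>(n, m). ((n a, m a), (?r n, ?r m))) z) = z" for z
    by (cases z) (simp add: fun_eq_iff)
qed

lemma tuples_insert_bij_left: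
  assumes "a \<notin> A"
  shows "bij_betw (\<lambda>((n, m), x). (n(a := x), m)) ((tuples A \<times> B) \<times> UNIV) (tuples (insert a A) \<times> B)"
proof (rule bij_betwI)
  let ?r = "\<lambda>n :: nat \<Rightarrow> nat. n(a := undefined)"
  show "(\<lambda>((n, m), x). (n(a := x), m)) \<in> (tuples A \<times> B) \<times> UNIV \<rightarrow> tuples (insert a A) \<times> B"
    by (auto simp: PiE_def extensional_def)
  show "(\<lambda>(n, m). ((?r n, m), n a)) \<in> tuples (insert a A) \<times> B \<rightarrow> (tuples A \<times> B) \<times> UNIV"
    by (auto simp: PiE_def extensional_def)
  show "(\<lambda>(n, m). ((?r n, m), n a)) ((\<lambda>((n, m), x). (n(a := x), m)) z) = z"
    if "z \<in> (tuples A \<times> B) \<times> UNIV" for z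
    using that assms by (auto simp: PiE_def extensional_def fun_eq_iff)
  show "(\<lambda>((n, m), x). (n(a := x), m)) ((\<lambda>(n, m). ((?r n, m), n a)) z) = z" for z
    by (cases z) (simp add: fun_eq_iff)
qed

lemma finite_tuples_bounded:
  assumes "finite A" "finite B" "\<And>x l. x \<in> tuples A \<times> tuples B \<Longrightarrow> e x \<le> k \<Longrightarrow> l \<in> A \<Longrightarrow> fst x l \<le> k"
    "\<And>x l. x \<in> tuples A \<times> tuples B \<Longrightarrow> e x \<le> (k::nat) \<Longrightarrow> l \<in> B \<Longrightarrow> snd x l \<le> k"
  shows "finite {x \<in> tuples A \<times> tuples B. e x \<le> k}"
proof (rule finite_subset)
  show "{x \<in> tuples A \<times> tuples B. e x \<le> k} \<subseteq> (A \<rightarrow>\<^sub>E {..k}) \<times> (B \<rightarrow>\<^sub>E {..k})"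
    using assms(3,4) by (force simp: PiE_def)
  show "finite ((A \<rightarrow>\<^sub>E {..k}) \<times> (B \<rightarrow>\<^sub>E {..k}))"
    using assms(1,2) by (intro finite_cartesian_product finite_PiE) auto
qed

lemma finite_tuples_quad_form:
  assumes "finite A"
  shows "finite {x \<in> tuples A \<times> tuples A. (\<Sum>l\<in>A. quad_form (fst x l) (snd x l)) \<le> k}"
proof (rule finite_tuples_bounded[OF assms assms])
  fix x :: "(nat \<Rightarrow> nat) \<times> (nat \<Rightarrow> nat)" and l
  assume "(\<Sum>l\<in>A. quad_form (fst x l) (snd x l)) \<le> k" "l \<in> A"
  hence "quad_form (fst x l) (snd x l) \<le> k"
    using member_le_sum[of l A "\<lambda>l. quad_form (fst x l) (snd x l)"] assms by simp
  with quad_form_ge(1)[of "fst x l" "snd x l"] quad_form_ge(2)[of "snd x l" "fst x l"]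
  show "fst x l \<le> k" "snd x l \<le> k" by simp_all
qed

lemma chain_body_nth_eq_0:
  assumes "k < (\<Sum>l\<in>{i<..d}. quad_form (n l) (m l))"
  shows "fps_nth (c * chain_body V d i n m) k = 0"
proof -
  have "c * chain_body V d i n m = fps_X ^ (\<Sum>l\<in>{i<..d}. quad_form (n l) (m l)) * (c * ((\<Prod>l\<in>{i..<d}. ixfac (int (n l) - int (n (l + 1))) *
        qbinom (int (n l) - int (n (l + 1)) + int (m (l + 1))) (int (m l))) * V (n d) (m d)))"
    by (simp add: chain_body_def power_sum mult_ac)
  thus ?thesis using assms by (simp only: fps_nth_power_X_mult_eq_0)
qed

lemma chain_body_step:
  assumes "i < d"
  shows "chain_body V d i n m = fps_X ^ quad_form (n (i + 1)) (m (i + 1)) * (ixfac (int (n i) - int (n (i + 1))) *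
     qbinom (int (n i) - int (n (i + 1)) + int (m (i + 1))) (int (m i))) * chain_body V d (i + 1) n m"
proof -
  have "{i<..d} = insert (i + 1) {i + 1<..d}" "{i..<d} = insert i {i + 1..<d}" using assms by auto
  thus ?thesis by (simp add: chain_body_def mult_ac)
qed

lemma chain_body_upd:
  assumes "l < i" "i \<le> d"
  shows "chain_body V d i (n(l := x)) m = chain_body V d i n m" "chain_body V d i n (m(l := x)) = chain_body V d i n m"
  using assms unfolding chain_body_def by (auto intro!: arg_cong2[of _ _ _ _ "(*)"] prod.cong)

text \<open>Downward induction on the position i, with x and y as the values held there. Beyond an
  outer position every sum is finite in effect: the reciprocal forces r <= x, and
  \<open>xchain_sum_support\<close> forces s <= 2 r.\<close>

lemma chain_body_has_sum:
  assumes V: "\<And>n m. m > 2 * n \<Longrightarrow> V n m = 0" and "i \<le> d"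
  shows "((\<lambda>(n, m). chain_body V d i (n(i := x)) (m(i := y))) has_sum xchain_sum V (d - i) x y) (tuples {i<..d} \<times> tuples {i<..d})"
  using assms(2)
proof (induction i arbitrary: x y rule: inc_induct)
  case base
  have "(tuples {d<..d} \<times> tuples {d<..d}) = {(\<lambda>_. undefined, \<lambda>_. undefined)}" by (auto simp: PiE_def extensional_def fun_eq_iff)
  thus ?case using has_sum_finite[of "{(\<lambda>_. undefined, \<lambda>_. undefined)}" "\<lambda>(n, m). chain_body V d d (n(d := x)) (m(d := y))"]
    by (simp add: chain_body_def case_prod_unfold)
next
  case (step i)
  define F where "F = (\<lambda>(n, m). chain_body V d i (n(i := x)) (m(i := y)))"
  define h where "h = (\<lambda>((r, s), (n, m)). (n(Suc i := r), m(Suc i := s)) :: (nat \<Rightarrow> nat) \<times> (nat \<Rightarrow> nat))"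
  define c where "c = (\<lambda>(r, s). fps_X ^ quad_form r s * (ixfac (int x - int r) * qbinom (int x - int r + int s) (int y)))"
  have ins: "insert (Suc i) {Suc i<..d} = {i<..d}" using step.hyps by auto
  \<comment> \<open>Summability over all tuples at once follows from the total exponent. It is what
    \<open>has_sum_fps_Sigma\<close> needs; the value is identified afterwards.\<close>
  obtain S where S: "(F has_sum S) (tuples {i<..d} \<times> tuples {i<..d})"
  proof (rule fps_dominated_has_sum[OF finite_tuples_quad_form[of "{i<..d}"]])
    fix z :: "(nat \<Rightarrow> nat) \<times> (nat \<Rightarrow> nat)" and k
    assume k: "k < (\<Sum>l\<in>{i<..d}. quad_form (fst z l) (snd z l))"
    have e: "(\<Sum>l\<in>{i<..d}. quad_form (fst z l) (snd z l)) = (\<Sum>l\<in>{i<..d}. quad_form (((fst z)(i := x)) l) (((snd z)(i := y)) l))"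
      by (rule sum.cong) auto
    have "fps_nth (1 * chain_body V d i ((fst z)(i := x)) ((snd z)(i := y))) k = 0"
      by (rule chain_body_nth_eq_0, rule k[unfolded e])
    thus "fps_nth (F z) k = 0" by (simp only: F_def case_prod_unfold mult_1)
  qed simp
  have bij: "bij_betw h ((UNIV \<times> UNIV) \<times> (tuples {Suc i<..d} \<times> tuples {Suc i<..d})) (tuples {i<..d} \<times> tuples {i<..d})"
    unfolding h_def ins[symmetric] by (rule tuples_insert_bij) simp
  have S': "((\<lambda>z. F (h z)) has_sum S) ((UNIV \<times> UNIV) \<times> (tuples {Suc i<..d} \<times> tuples {Suc i<..d}))"
    using has_sum_reindex_bij_betw[OF bij, of F S] S by blast
  have Fh: "F (h ((r, s), (n, m))) = c (r, s) * chain_body V d (Suc i) (n(Suc i := r)) (m(Suc i := s))" for r s n m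
  proof -
    have "F (h ((r, s), (n, m))) = chain_body V d i (n(Suc i := r, i := x)) (m(Suc i := s, i := y))" by (simp add: F_def h_def)
    also have "\<dots> = c (r, s) * chain_body V d (Suc i) (n(Suc i := r, i := x)) (m(Suc i := s, i := y))"
      using chain_body_step[of i d V "n(Suc i := r, i := x)" "m(Suc i := s, i := y)"] step.hyps by (simp add: c_def)
    also have "\<dots> = c (r, s) * chain_body V d (Suc i) (n(Suc i := r)) (m(Suc i := s))"
      using chain_body_upd[of i "Suc i" d V] step.hyps by simp
    finally show ?thesis .
  qed
  have sumW: "((\<lambda>z. c z * xchain_sum V (d - Suc i) (fst z) (snd z)) has_sum S) (UNIV \<times> UNIV)"
  proof (rule has_sum_fps_Sigma[OF S'])
    fix z :: "nat \<times> nat"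
    show "((\<lambda>w. F (h (z, w))) has_sum c z * xchain_sum V (d - Suc i) (fst z) (snd z)) (tuples {Suc i<..d} \<times> tuples {Suc i<..d})"
    proof -
      have "(\<lambda>w. F (h (z, w))) = (\<lambda>w. c z * (case w of (n, m) \<Rightarrow> chain_body V d (Suc i) (n(Suc i := fst z)) (m(Suc i := snd z))))"
      proof
        fix w :: "(nat \<Rightarrow> nat) \<times> (nat \<Rightarrow> nat)"
        obtain r s n m where "z = (r, s)" "w = (n, m)" by (metis prod.exhaust)
        thus "F (h (z, w)) = c z * (case w of (n, m) \<Rightarrow> chain_body V d (Suc i) (n(Suc i := fst z)) (m(Suc i := snd z)))"
          by (simp only: Fh case_prod_conv fst_conv snd_conv)
      qed
      thus ?thesis
        using has_sum_fps_cmult[OF step.IH[of "fst z" "snd z"], where c = "c z"] by (simp only:)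
    qed
  qed
  have "((\<lambda>z. c z * xchain_sum V (d - Suc i) (fst z) (snd z)) has_sum xchain_sum V (d - i) x y) (UNIV \<times> UNIV)"
  proof (rule has_sum_finite_neutralI[of "Sigma {..x} (\<lambda>R. {..2 * R})"])
    show "c z * xchain_sum V (d - Suc i) (fst z) (snd z) = 0" if "z \<in> UNIV \<times> UNIV - Sigma {..x} (\<lambda>R. {..2 * R})" for z
      using that xchain_sum_support[of V "fst z" "snd z" "d - Suc i"] V by (cases z) (auto simp: ixfac_def c_def)
    have "d - i = Suc (d - Suc i)" using step.hyps by simp
    thus "xchain_sum V (d - i) x y = (\<Sum>z\<in>Sigma {..x} (\<lambda>R. {..2 * R}). c z * xchain_sum V (d - Suc i) (fst z) (snd z))"
      by (simp only: xchain_sum.simps) (subst sum.Sigma, auto intro!: sum.cong simp: c_def mult_ac)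
  qed auto
  from has_sum_fps_unique[OF sumW this] have "S = xchain_sum V (d - i) x y" .
  thus ?case using S unfolding F_def by (simp only:)
qed

text \<open>No outer variable bounds n_1, so the sum over position 1 is genuinely infinite; its
  value \<open>Z\<close> is supplied by the limit of the Bailey sums.\<close>

lemma chain_has_sum:
  assumes V: "\<And>n m. m > 2 * n \<Longrightarrow> V n m = 0" and d: "d \<ge> 1"
    and Z: "((\<lambda>x. fps_X ^ quad_form (fst x) (snd x) * xchain_sum V (d - 1) (fst x) (snd x)) has_sum Z) UNIV"
  shows "((\<lambda>(n, m). fps_X ^ quad_form (n 1) (m 1) * chain_body V d 1 n m) has_sum Z) (tuples {1..d} \<times> tuples {1..d})"
proof -
  define F where "F = (\<lambda>(n, m). fps_X ^ quad_form (n 1) (m 1) * chain_body V d 1 n m)"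
  define h where "h = (\<lambda>((r, s), (n, m)). (n(1 := r), m(1 := s)) :: (nat \<Rightarrow> nat) \<times> (nat \<Rightarrow> nat))"
  have ins: "insert 1 {1<..d} = {1..d}" using d by auto
  obtain S where S: "(F has_sum S) (tuples {1..d} \<times> tuples {1..d})"
  proof (rule fps_dominated_has_sum[OF finite_tuples_quad_form[of "{1..d}"]])
    fix z :: "(nat \<Rightarrow> nat) \<times> (nat \<Rightarrow> nat)" and k
    assume k: "k < (\<Sum>l\<in>{1..d}. quad_form (fst z l) (snd z l))"
    have "F z = fps_X ^ (\<Sum>l\<in>{1..d}. quad_form (fst z l) (snd z l)) * ((\<Prod>l\<in>{1..<d}. ixfac (int (fst z l) - int (fst z (l + 1))) *
        qbinom (int (fst z l) - int (fst z (l + 1)) + int (snd z (l + 1))) (int (snd z l))) * V (fst z d) (snd z d))"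
      unfolding ins[symmetric] by (simp add: F_def chain_body_def case_prod_unfold power_sum power_add mult_ac)
    thus "fps_nth (F z) k = 0" using k by (simp only: fps_nth_power_X_mult_eq_0)
  qed simp
  have bij: "bij_betw h ((UNIV \<times> UNIV) \<times> (tuples {1<..d} \<times> tuples {1<..d})) (tuples {1..d} \<times> tuples {1..d})"
    unfolding h_def ins[symmetric] by (rule tuples_insert_bij) simp
  have S': "((\<lambda>z. F (h z)) has_sum S) ((UNIV \<times> UNIV) \<times> (tuples {1<..d} \<times> tuples {1<..d}))"
    using has_sum_reindex_bij_betw[OF bij, of F S] S by blast
  have SZ: "((\<lambda>z. fps_X ^ quad_form (fst z) (snd z) * xchain_sum V (d - 1) (fst z) (snd z)) has_sum S) (UNIV \<times> UNIV)"
  proof (rule has_sum_fps_Sigma[OF S'])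
    fix z :: "nat \<times> nat"
    show "((\<lambda>w. F (h (z, w))) has_sum fps_X ^ quad_form (fst z) (snd z) * xchain_sum V (d - 1) (fst z) (snd z)) (tuples {1<..d} \<times> tuples {1<..d})"
    proof -
      have "(\<lambda>w. F (h (z, w))) = (\<lambda>w. fps_X ^ quad_form (fst z) (snd z) *
        (case w of (n, m) \<Rightarrow> chain_body V d 1 (n(1 := fst z)) (m(1 := snd z))))"
      proof
        fix w :: "(nat \<Rightarrow> nat) \<times> (nat \<Rightarrow> nat)"
        obtain r s n m where "z = (r, s)" "w = (n, m)" by (metis prod.exhaust)
        thus "F (h (z, w)) = fps_X ^ quad_form (fst z) (snd z) *
          (case w of (n, m) \<Rightarrow> chain_body V d 1 (n(1 := fst z)) (m(1 := snd z)))"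
          by (simp only: F_def h_def case_prod_conv fst_conv snd_conv fun_upd_same)
      qed
      thus ?thesis
        using has_sum_fps_cmult[OF chain_body_has_sum[where V = V and x = "fst z" and y = "snd z", OF V d],
          where c = "fps_X ^ quad_form (fst z) (snd z)"] by (simp only:)
    qed
  qed
  have "S = Z" by (rule has_sum_fps_unique[OF SZ[unfolded UNIV_Times_UNIV] Z])
  thus ?thesis using S by (simp add: F_def)
qed

section \<open>The summands written as chains\<close>

lemma ixfac_mult_qbinom: "ixfac (int n) * qbinom (int n) (int m) = ixfac (int n - int m) * ixfac (int m)"
proof (cases "m \<le> n")
  case True
  have "ixfac (int n) * xfac n = 1" by (simp add: ixfac_def inverse_mult_eq_1)
  moreover have "qbinom (int n) (int m) = xfac n * (ixfac (int n - int m) * ixfac (int m))"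
    using True by (simp add: qbinom_def ixfac_def fps_divide_unit fps_inverse_mult mult_ac)
  ultimately show ?thesis by (simp flip: mult.assoc)
qed (simp add: qbinom_def ixfac_def)

text \<open>The factor 1/(q)_(n_1) travels down the chain by 1/(q)_a [a; b] = 1/((q)_(a-b) (q)_b),
  where both sides are 0 for b > a.\<close>

lemma telescope_qbinom:
  fixes n :: "nat \<Rightarrow> nat"
  assumes "d \<ge> 1"
  shows "ixfac (int (n 1)) * (\<Prod>i\<in>{1..<d}. qbinom (int (n i)) (int (n (i + 1)))) =
    (\<Prod>i\<in>{1..<d}. ixfac (int (n i) - int (n (i + 1)))) * ixfac (int (n d))"
  using assms
proof (induction d rule: dec_induct)
  case (step d)
  have "ixfac (int (n 1)) * (\<Prod>i\<in>{1..<Suc d}. qbinom (int (n i)) (int (n (i + 1)))) =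
    (ixfac (int (n 1)) * (\<Prod>i\<in>{1..<d}. qbinom (int (n i)) (int (n (i + 1))))) * qbinom (int (n d)) (int (n (d + 1)))"
    using step.hyps by (simp add: mult_ac)
  also have "\<dots> = (\<Prod>i\<in>{1..<d}. ixfac (int (n i) - int (n (i + 1)))) * (ixfac (int (n d)) * qbinom (int (n d)) (int (n (d + 1))))"
    unfolding step.IH by (simp only: mult_ac)
  also have "\<dots> = (\<Prod>i\<in>{1..<Suc d}. ixfac (int (n i) - int (n (i + 1)))) * ixfac (int (n (Suc d)))"
    unfolding ixfac_mult_qbinom using step.hyps by (simp add: mult_ac)
  finally show ?case .
qed simp

lemma divide_xf: "f / xfac n = f * ixfac (int n)"
  by (simp add: fps_divide_unit ixfac_def)

lemma summand2_eq:
  assumes "k \<ge> 2"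
  shows "summand2 k n m = fps_X ^ quad_form (n 1) (m 1) * chain_body xstart_a (k - 1) 1 n m"
proof -
  define d where "d = k - 1"
  have d: "d \<ge> 1" "{1..k - 2} = {1..<d}" "{1..d} = insert 1 {1<..d}" using assms by (auto simp: d_def)
  have "summand2 k n m = fps_X ^ (\<Sum>i=1..d. quad_form (n i) (m i)) * qbinom (2 * int (n d)) (int (m d)) *
    (ixfac (int (n 1)) * (\<Prod>i\<in>{1..<d}. qbinom (int (n i)) (int (n (i + 1))))) *
    (\<Prod>i\<in>{1..<d}. qbinom (int (n i) - int (n (i + 1)) + int (m (i + 1))) (int (m i)))"
    unfolding summand2_def divide_xf d_def[symmetric] d(2) prod.distrib by (simp only: mult_ac)
  also have "\<dots> = fps_X ^ quad_form (n 1) (m 1) * chain_body xstart_a d 1 n m"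
    unfolding telescope_qbinom[OF d(1)] d(3) by (simp add: chain_body_def xstart_a_def power_add power_sum prod.distrib mult_ac)
  finally show ?thesis by (simp add: d_def)
qed

text \<open>The variable n_k = r has no independent partner m_k, so it is split off as a parameter
  of the innermost factor; summing that factor over r gives \<open>xstart_b\<close>.\<close>

lemma summand1_eq:
  assumes "k \<ge> 2"
  shows "summand1 k (n(k := r)) m = fps_X ^ quad_form (n 1) (m 1) *
    chain_body (\<lambda>a b. fps_X ^ (r\<^sup>2) * ixfac (int a - int r) * ixfac (int r) * qbinom (int a + int r) (int b)) (k - 1) 1 n m"
proof -
  define d where "d = k - 1"
  define n' where "n' = n(k := r)"
  define m' where "m' = m(k := 2 * r)"
  have d: "d \<ge> 1" "k = Suc d" "{1..d} = insert d {1..<d}" "{1..d} = insert 1 {1<..d}" using assms by (auto simp: d_def)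
  have "summand1 k (n(k := r)) m = fps_X ^ (r\<^sup>2) * ixfac (int (n' 1)) *
    (\<Prod>i\<in>{1..d}. fps_X ^ quad_form (n' i) (m' i) * qbinom (int (n' i)) (int (n' (i + 1))) *
       qbinom (int (n' i) - int (n' (i + 1)) + int (m' (i + 1))) (int (m' i)))"
    unfolding summand1_def Let_def d_def[symmetric] divide_xf n'_def[symmetric] by (simp add: n'_def m'_def)
  also have "\<dots> = fps_X ^ (r\<^sup>2) * (\<Prod>i\<in>{1..d}. fps_X ^ quad_form (n' i) (m' i)) *
     (ixfac (int (n' 1)) * (\<Prod>i\<in>{1..<d}. qbinom (int (n' i)) (int (n' (i + 1))))) *
     (qbinom (int (n d)) (int r)) * qbinom (int (n d) + int r) (int (m d)) *
     (\<Prod>i\<in>{1..<d}. qbinom (int (n' i) - int (n' (i + 1)) + int (m' (i + 1))) (int (m' i)))"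
  proof -
    have x: "n' d = n d" "n' (d + 1) = r" "m' d = m d" "m' (d + 1) = 2 * r"
      using d(2) by (simp_all add: n'_def m'_def)
    \<comment> \<open>This is where m_k = 2 n_k enters.\<close>
    have e: "int (n d) - int r + int (2 * r) = int (n d) + int r" by simp
    have split: "(\<Prod>i\<in>{1..d}. f i) = f d * (\<Prod>i\<in>{1..<d}. f i)" for f :: "nat \<Rightarrow> complex fps"
      unfolding d(3) by simp
    show ?thesis
      unfolding prod.distrib split[of "\<lambda>i. qbinom (int (n' i)) (int (n' (i + 1)))"]
        split[of "\<lambda>i. qbinom (int (n' i) - int (n' (i + 1)) + int (m' (i + 1))) (int (m' i))"] x e
      by (simp only: mult_ac)
  qed
  also have "(ixfac (int (n' 1)) * (\<Prod>i\<in>{1..<d}. qbinom (int (n' i)) (int (n' (i + 1))))) =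
     (\<Prod>i\<in>{1..<d}. ixfac (int (n i) - int (n (i + 1)))) * ixfac (int (n d))"
    unfolding telescope_qbinom[OF d(1)] by (rule arg_cong2[of _ _ _ _ "(*)"], rule prod.cong) (auto simp: n'_def d(2))
  also have "(\<Prod>i\<in>{1..<d}. qbinom (int (n' i) - int (n' (i + 1)) + int (m' (i + 1))) (int (m' i))) =
     (\<Prod>i\<in>{1..<d}. qbinom (int (n i) - int (n (i + 1)) + int (m (i + 1))) (int (m i)))"
    by (rule prod.cong) (auto simp: n'_def m'_def d(2))
  also have "(\<Prod>i\<in>{1..d}. fps_X ^ quad_form (n' i) (m' i)) = (\<Prod>i\<in>{1..d}. fps_X ^ quad_form (n i) (m i))"
    by (rule prod.cong) (auto simp: n'_def m'_def d(2))
  also have "fps_X ^ (r\<^sup>2) * (\<Prod>i\<in>{1..d}. fps_X ^ quad_form (n i) (m i)) *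
     ((\<Prod>i\<in>{1..<d}. ixfac (int (n i) - int (n (i + 1)))) * ixfac (int (n d))) *
     (qbinom (int (n d)) (int r)) * qbinom (int (n d) + int r) (int (m d)) *
     (\<Prod>i\<in>{1..<d}. qbinom (int (n i) - int (n (i + 1)) + int (m (i + 1))) (int (m i))) =
     fps_X ^ (r\<^sup>2) * (\<Prod>i\<in>{1..d}. fps_X ^ quad_form (n i) (m i)) *
     (\<Prod>i\<in>{1..<d}. ixfac (int (n i) - int (n (i + 1)))) * (ixfac (int (n d)) * qbinom (int (n d)) (int r)) *
      qbinom (int (n d) + int r) (int (m d)) *
     (\<Prod>i\<in>{1..<d}. qbinom (int (n i) - int (n (i + 1)) + int (m (i + 1))) (int (m i)))"
    by (simp only: mult_ac)
  also have "\<dots> = fps_X ^ quad_form (n 1) (m 1) *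
    chain_body (\<lambda>a b. fps_X ^ (r\<^sup>2) * ixfac (int a - int r) * ixfac (int r) * qbinom (int a + int r) (int b)) d 1 n m"
    unfolding ixfac_mult_qbinom d(4) by (simp add: chain_body_def prod.distrib mult_ac)
  finally show ?thesis unfolding d_def .
qed


lemma summand1_has_sum:
  assumes "k \<ge> 1"
  shows "((\<lambda>(n, m). summand1 k n m) has_sum rhs1 k) (tuples {1..k} \<times> tuples {1..k - 1})"
proof (cases "k = 1")
  case True
  have bij: "bij_betw (\<lambda>r. ((\<lambda>_. undefined)(1 := r), \<lambda>_. undefined)) UNIV (tuples {1..1} \<times> tuples {1..1 - 1 :: nat})"
    by (rule bij_betwI[of _ _ _ "\<lambda>(n, m). n 1"]) (auto simp: PiE_def extensional_def fun_eq_iff)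
  have "summand1 1 ((\<lambda>_. undefined)(1 := r)) m = fps_X ^ (r\<^sup>2) * ixfac (int r)" for r m
    by (simp add: summand1_def Let_def divide_xf)
  moreover have "rhs1 1 = theta_prod 2 5 / euler\<^sup>2"
    using rhs1_eq[of 1] by (simp add: eval_nat_numeral)
  ultimately have "((\<lambda>r. (\<lambda>(n, m). summand1 1 n m) ((\<lambda>_. undefined)(1 := r), \<lambda>_. undefined)) has_sum rhs1 1) UNIV"
    using chain_value_1 by (simp only: case_prod_conv)
  thus ?thesis unfolding True
    using has_sum_reindex_bij_betw[OF bij, of "\<lambda>(n, m). summand1 1 n m" "rhs1 1"] by blast
next
  case False
  hence k: "k \<ge> 2" using assms by simp
  define d where "d = k - 1"
  have d: "d \<ge> 1" "insert k {1..d} = {1..k}" "k \<notin> {1..d}" "d - 1 = k - 2" using k by (auto simp: d_def)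
  define F where "F = (\<lambda>(n, m). summand1 k n m)"
  define h where "h = (\<lambda>((n, m), x). (n(k := x), m) :: (nat \<Rightarrow> nat) \<times> (nat \<Rightarrow> nat))"
  define v where "v r a b = fps_X ^ (r\<^sup>2) * ixfac (int a - int r) * ixfac (int r) * qbinom (int a + int r) (int b)" for r a b :: nat
  define P where "P n m = fps_X ^ quad_form (n 1) (m 1) * ((\<Prod>l\<in>{1<..d}. fps_X ^ quad_form (n l) (m l)) *
     (\<Prod>l\<in>{1..<d}. ixfac (int (n l) - int (n (l + 1))) *
        qbinom (int (n l) - int (n (l + 1)) + int (m (l + 1))) (int (m l))))" for n m :: "nat \<Rightarrow> nat"
  have Fh: "F (h ((n, m), r)) = P n m * v r (n d) (m d)" for n m r
    unfolding F_def h_def case_prod_conv summand1_eq[OF k] d_def[symmetric] by (simp add: chain_body_def P_def v_def mult_ac)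
  have bij: "bij_betw h ((tuples {1..d} \<times> tuples {1..d}) \<times> UNIV) (tuples {1..k} \<times> tuples {1..d})"
    unfolding h_def d(2)[symmetric] by (rule tuples_insert_bij_left[OF d(3)])
  obtain S where S: "((\<lambda>z. F (h z)) has_sum S) ((tuples {1..d} \<times> tuples {1..d}) \<times> UNIV)"
  proof (rule fps_dominated_has_sum)
    let ?e = "\<lambda>z. (\<Sum>l\<in>{1..d}. quad_form (fst (fst z) l) (snd (fst z) l)) + (snd z)\<^sup>2"
    show "finite {z \<in> (tuples {1..d} \<times> tuples {1..d}) \<times> UNIV. ?e z \<le> j}" for j
    proof (rule finite_subset)
      show "{z \<in> (tuples {1..d} \<times> tuples {1..d}) \<times> UNIV. ?e z \<le> j} \<subseteq>
        {x \<in> tuples {1..d} \<times> tuples {1..d}. (\<Sum>l\<in>{1..d}. quad_form (fst x l) (snd x l)) \<le> j} \<times> {..j}"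
        by (auto dest: add_leD1 add_leD2 intro: power2_nat_le_imp_le)
    qed (intro finite_cartesian_product finite_tuples_quad_form finite_atMost finite_atLeastAtMost)
    fix z :: "((nat \<Rightarrow> nat) \<times> (nat \<Rightarrow> nat)) \<times> nat" and j
    assume j: "j < ?e z"
    obtain n m r where z: "z = ((n, m), r)" by (metis prod.exhaust)
    have "{1..d} = insert 1 {1<..d}" using d(1) by auto
    hence "F (h z) = fps_X ^ ?e z * ((\<Prod>l\<in>{1..<d}. ixfac (int (n l) - int (n (l + 1))) *
        qbinom (int (n l) - int (n (l + 1)) + int (m (l + 1))) (int (m l))) *
        (ixfac (int (n d) - int r) * ixfac (int r) * qbinom (int (n d) + int r) (int (m d))))"
      unfolding z Fh by (simp add: P_def v_def power_add power_sum mult_ac)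
    thus "fps_nth (F (h z)) j = 0" using j by (simp only: fps_nth_power_X_mult_eq_0)
  qed
  \<comment> \<open>Summing over n_k first replaces the parametrised end of the chain by
    \<open>xstart_b\<close>.\<close>
  have "((\<lambda>z. P (fst z) (snd z) * xstart_b (fst z d) (snd z d)) has_sum S) (tuples {1..d} \<times> tuples {1..d})"
  proof (rule has_sum_fps_Sigma[OF S])
    fix z :: "(nat \<Rightarrow> nat) \<times> (nat \<Rightarrow> nat)"
    have "((\<lambda>r. v r (fst z d) (snd z d)) has_sum xstart_b (fst z d) (snd z d)) UNIV"
      by (rule has_sum_finite_neutralI[of "{..fst z d}"]) (auto simp: v_def ixfac_def xstart_b_def)
    from has_sum_fps_cmult[OF this, of "P (fst z) (snd z)"]
    show "((\<lambda>r. F (h (z, r))) has_sum P (fst z) (snd z) * xstart_b (fst z d) (snd z d)) UNIV"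
      by (cases z) (simp add: Fh)
  qed
  moreover have "((\<lambda>z. P (fst z) (snd z) * xstart_b (fst z d) (snd z d)) has_sum rhs1 k) (tuples {1..d} \<times> tuples {1..d})"
  proof -
    have Z: "((\<lambda>x. fps_X ^ quad_form (fst x) (snd x) * xchain_sum xstart_b (d - 1) (fst x) (snd x)) has_sum rhs1 k) UNIV"
      unfolding d(4) rhs1_eq[OF assms] by (rule chain_value_b[OF k])
    have "fps_X ^ quad_form (n 1) (m 1) * chain_body xstart_b d 1 n m = P n m * xstart_b (n d) (m d)" for n m
      by (simp add: chain_body_def P_def mult_ac)
    thus ?thesis using chain_has_sum[OF xstart_b_support d(1) Z] by (simp only: case_prod_unfold)
  qed
  ultimately have "S = rhs1 k" by (rule has_sum_fps_unique)
  with S have "(F has_sum rhs1 k) (tuples {1..k} \<times> tuples {1..d})"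
    using has_sum_reindex_bij_betw[OF bij, of F S] by blast
  thus ?thesis by (simp add: F_def d_def)
qed

lemma summand2_has_sum:
  assumes "k \<ge> 2"
  shows "((\<lambda>(n, m). summand2 k n m) has_sum rhs2 k) (tuples {1..k - 1} \<times> tuples {1..k - 1})"
proof -
  have e: "k - 1 \<ge> 1" "k - 1 - 1 = k - 2" "k \<ge> 1" using assms by auto
  have Z: "((\<lambda>x. fps_X ^ quad_form (fst x) (snd x) * xchain_sum xstart_a (k - 1 - 1) (fst x) (snd x)) has_sum rhs2 k) UNIV"
    unfolding e(2) rhs2_eq[OF e(3)] by (rule chain_value_a[OF assms])
  show ?thesis unfolding summand2_eq[OF assms] by (rule chain_has_sum[OF xstart_a_support e(1) Z])
qed

theorem theorem1p1:
  shows "(\<forall>k::nat. k \<ge> 1 \<longrightarrow>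
            ((\<lambda>(n, m). summand1 k n m) has_sum rhs1 k)
              (({1..k} \<rightarrow>\<^sub>E (UNIV :: nat set)) \<times> ({1..k-1} \<rightarrow>\<^sub>E (UNIV :: nat set)))) \<and>
         (\<forall>k::nat. k \<ge> 2 \<longrightarrow>
            ((\<lambda>(n, m). summand2 k n m) has_sum rhs2 k)
              (({1..k-1} \<rightarrow>\<^sub>E (UNIV :: nat set)) \<times> ({1..k-1} \<rightarrow>\<^sub>E (UNIV :: nat set)))) \<and>
         rhs2 1 = 1"
  using summand1_has_sum summand2_has_sum rhs2_1 by blast

end
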